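(* Let $\varkappa\in\{1,-1\}$, let $\mathcal{R}\subset\mathbb{R}^N$ be a finite root system, let $W(\mathcal{R})\subset \mathrm{End}(\mathbb{R}^N)$ be the Coxeter group generated by $\mathcal{R}$, let $\nu$ be a set of constants as described in the context, and let $H_{W(\mathcal{R})}(\nu)$ be the superalgebra of observables of the rational Calogero model based on $\mathcal{R}$. Then the dimension of the space of $\varkappa$-traces on the superalgebra $H_{W(\mathcal{R})}(\nu)$ is equal to the number of conjugacy classes of $W(\mathcal{R})$ consisting of elements without eigenvalue $\varkappa$.
   Context: Root system and group: $V=\mathbb{R}^N$ carries the symmetric bilinear form $(\cdot,\cdot)$ for which the standard basis is orthonormal. For nonzero $\vec v\in V$ the reflection $R_{\vec v}$ is $R_{\vec v}(\vec x)=\vec x-2\frac{(\vec x,\vec v)}{(\vec v,\vec v)}\vec v$. A root system is a finite set $\mathcal{R}\subset V$ of nonzero vectors such that (i) $R_{\vec v}(\mathcal{R})=\mathcal{R}$ for every $\vec v\in\mathcal{R}$, and (ii) if $\vec v_1,\vec v_2\in\mathcal{R}$ are collinear then $\vec v_1=\pm\vec v_2$. It need not be crystallographic and may be empty. $W(\mathcal{R})\subset O(N,\mathbb{R})$ is the (finite) group generated by all $R_{\vec v}$, $\vec v\in\mathcal{R}$ (trivial if $\mathcal{R}$ is empty). Eigenvalues of elements of $W(\mathcal{R})$ refer to their action on $\mathbb{R}^N$. Constants: $\nu=(\nu_{\vec v})_{\vec v\in\mathcal{R}}$ is a family of (complex) constants with $\nu_{\vec v}=\nu_{\vec w}$ whenever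 $R_{\vec v}$ and $R_{\vec w}$ are conjugate in $W(\mathcal{R})$. The superalgebra: let $\mathcal{H}^0,\mathcal{H}^1$ be two copies of $V$, with orthonormal bases $a_{\alpha i}\in\mathcal{H}^\alpha$ ($\alpha=0,1$; $i=1,\dots,N$); for $\vec x=(x^1,\dots,x^N)\in V$ write $x_\alpha=\sum_i a_{\alpha i}x^i\in\mathcal{H}^\alpha$. $W(\mathcal{R})$ acts on each $\mathcal{H}^\alpha$ as on $V$. $H_{W(\mathcal{R})}(\nu)$ is the associative unital superalgebra over $\mathbb{C}$ of polynomials in the $a_{\alpha i}$ with coefficients in the group algebra $\mathbb{C}[W(\mathcal{R})]$, subject to the relations (besides those of the group algebra) $$g\,h_\alpha=g(h_\alpha)\,g\quad(g\in W(\mathcal{R}),\ h_\alpha\in\mathcal{H}^\alpha),$$ $$[x_\alpha,y_\beta]=x_\alpha y_\beta-y_\beta x_\alpha=\varepsilon_{\alpha\beta}\Big((\vec x,\vec y)+\sum_{\vec v\in\mathcal{R}}\nu_{\vec v}\frac{(\vec x,\vec v)(\vec y,\vec v)}{(\vec v,\vec v)}R_{\vec v}\Big)\quad(\vec x,\vec y\in V),$$ where $\varepsilon_{\alpha\beta}$ is antisymmetric with $\varepsilon_{01}=1$. The parity $\pi$ is given by $\pi(a_{\alpha i})=1$ and $\pi(g)=0$ for $g\in W(\mathcal{R})$. $\varkappa$-traces: for an associative superalgebra $\mathcal{A}$ over $\mathbb{C}$ with parity $\pi$, a $\varkappa$-trace is a linear function $sp:\mathcal{A}\to\mathbb{C}$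 with $sp(fg)=\varkappa^{\pi(f)\pi(g)}sp(gf)$ for all homogeneous $f,g\in\mathcal{A}$ (so $\varkappa=1$: trace; $\varkappa=-1$: supertrace). *)

theory Defs
  imports
    "HOL-Analysis.Analysis"
    "HOL-Library.Function_Algebras"
    "HOL-Library.Poly_Mapping"
    "HOL-Library.Numeral_Type"
    "HOL-Algebra.Module"
    "HOL-Algebra.QuotRing"
    "HOL-Algebra.Elementary_Groups"
begin

section \<open>Root systems and their reflection groups\<close>

definition reflection :: "real^'n \<Rightarrow> real^'n \<Rightarrow> real^'n" where
  "reflection v x = x - (2 * (x \<bullet> v) / (v \<bullet> v)) *\<^sub>R v"

definition root_system :: "(real^'n) set \<Rightarrow> bool" where
  "root_system R \<longleftrightarrow>
     finite R \<and> 0 \<notin> R \<and>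
     (\<forall>v\<in>R. reflection v ` R = R) \<and>
     (\<forall>v\<in>R. \<forall>w\<in>R. collinear {0, v, w} \<longrightarrow> v = w \<or> v = - w)"

definition orthogonal_group :: "(real^'n \<Rightarrow> real^'n) monoid" where
  "orthogonal_group = \<lparr>carrier = {f. orthogonal_transformation f}, mult = (\<circ>), one = id\<rparr>"

definition coxeter_group :: "(real^'n) set \<Rightarrow> (real^'n \<Rightarrow> real^'n) monoid" where
  "coxeter_group R = subgroup_generated orthogonal_group (reflection ` R)"

definition conjugate_in :: "('a, 'b) monoid_scheme \<Rightarrow> 'a \<Rightarrow> 'a \<Rightarrow> bool" where
  "conjugate_in G x y \<longleftrightarrow> (\<exists>g\<in>carrier G. y = g \<otimes>\<^bsub>G\<^esub> x \<otimes>\<^bsub>G\<^esub> inv\<^bsub>G\<^esub> g)"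

definition conjugacy_classes :: "('a, 'b) monoid_scheme \<Rightarrow> 'a set set" where
  "conjugacy_classes G = (\<lambda>x. {y \<in> carrier G. conjugate_in G x y}) ` carrier G"

definition has_eigenvalue :: "('a::real_vector \<Rightarrow> 'a) \<Rightarrow> real \<Rightarrow> bool" where
  "has_eigenvalue f c \<longleftrightarrow> (\<exists>x. x \<noteq> 0 \<and> f x = c *\<^sub>R x)"

definition root_constants :: "(real^'n) set \<Rightarrow> (real^'n \<Rightarrow> complex) \<Rightarrow> bool" where
  "root_constants R \<nu> \<longleftrightarrow>
     (\<forall>v\<in>R. \<forall>w\<in>R. conjugate_in (coxeter_group R) (reflection v) (reflection w) \<longrightarrow> \<nu> v = \<nu> w)"


section \<open>Superalgebras over the complex numbers\<close>

text \<open>Only the components \<open>homog A 0\<close> (even) and \<open>homog A 1\<close> (odd) are used.\<close>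

record 'b superalgebra = "(complex, 'b) module" +
  homog :: "nat \<Rightarrow> 'b set"

text \<open>In the quotient, multiplication by a scalar \<open>c\<close> is multiplication by the class of \<open>c\<close>
  times the unit, so that no choice of representatives is involved.\<close>

definition quotient_superalgebra :: "'b superalgebra \<Rightarrow> 'b set \<Rightarrow> 'b set superalgebra" where
  "quotient_superalgebra A I =
     \<lparr>carrier = carrier (A Quot I), mult = mult (A Quot I), one = one (A Quot I),
      zero = zero (A Quot I), add = add (A Quot I),
      smult = (\<lambda>c X. (I +>\<^bsub>A\<^esub> (c \<odot>\<^bsub>A\<^esub> \<one>\<^bsub>A\<^esub>)) \<otimes>\<^bsub>A Quot I\<^esub> X),
      homog = (\<lambda>p. (\<lambda>f. I +>\<^bsub>A\<^esub> f) ` homog A p)\<rparr>"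

text \<open>Linear functionals on \<open>carrier A\<close> are represented by functions that vanish outside
  \<open>carrier A\<close>, so that distinct functions are distinct functionals and the traces form a
  subspace of the space of all complex-valued functions.\<close>

definition kappa_traces :: "real \<Rightarrow> 'b superalgebra \<Rightarrow> ('b \<Rightarrow> complex) set" where
  "kappa_traces \<kappa> A =
     {sp. (\<forall>f. f \<notin> carrier A \<longrightarrow> sp f = 0) \<and>
          (\<forall>f\<in>carrier A. \<forall>g\<in>carrier A. sp (f \<oplus>\<^bsub>A\<^esub> g) = sp f + sp g) \<and>
          (\<forall>c. \<forall>f\<in>carrier A. sp (c \<odot>\<^bsub>A\<^esub> f) = c * sp f) \<and>
          (\<forall>p\<in>{0,1}. \<forall>q\<in>{0,1}. \<forall>f\<in>homog A p. \<forall>g\<in>homog A q.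
             sp (f \<otimes>\<^bsub>A\<^esub> g) = complex_of_real \<kappa> ^ (p * q) * sp (g \<otimes>\<^bsub>A\<^esub> f))}"

definition fun_scale :: "complex \<Rightarrow> ('b \<Rightarrow> complex) \<Rightarrow> 'b \<Rightarrow> complex" where
  "fun_scale c f = (\<lambda>x. c * f x)"

global_interpretation cfun: vector_space "fun_scale :: complex \<Rightarrow> ('b \<Rightarrow> complex) \<Rightarrow> 'b \<Rightarrow> complex"
  by unfold_locales (auto simp: fun_scale_def fun_eq_iff algebra_simps)


section \<open>Free superalgebras\<close>

text \<open>Words under concatenation, as an additive monoid: finitely supported functions on words
  with the convolution product of \<open>Poly_Mapping\<close> are then the noncommutative polynomials.\<close>

datatype 'l fword = FWord (letters: "'l list")

instantiation fword :: (type) monoid_add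
begin

definition zero_fword :: "'a fword" where "zero_fword = FWord []"

definition plus_fword :: "'a fword \<Rightarrow> 'a fword \<Rightarrow> 'a fword" where
  "plus_fword u w = FWord (letters u @ letters w)"

instance
  by standard (auto simp: zero_fword_def plus_fword_def)

end

type_synonym 'l ncpoly = "'l fword \<Rightarrow>\<^sub>0 complex"

definition scalar :: "complex \<Rightarrow> 'l ncpoly" where
  "scalar c = Poly_Mapping.single 0 c"

definition letter :: "'l \<Rightarrow> 'l ncpoly" where
  "letter l = Poly_Mapping.single (FWord [l]) 1"

text \<open>The free superalgebra on the letters in \<open>L\<close>; the letters satisfying \<open>odd_letter\<close> have
  parity one, all others have parity zero.\<close>

definition free_superalgebra :: "'l set \<Rightarrow> ('l \<Rightarrow> bool) \<Rightarrow> 'l ncpoly superalgebra" where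
  "free_superalgebra L odd_letter =
     \<lparr>carrier = {f. \<forall>w\<in>Poly_Mapping.keys f. set (letters w) \<subseteq> L},
      mult = (*), one = 1, zero = 0, add = (+),
      smult = (\<lambda>c f. scalar c * f),
      homog = (\<lambda>p. {f. \<forall>w\<in>Poly_Mapping.keys f.
        set (letters w) \<subseteq> L \<and> length (filter odd_letter (letters w)) mod 2 = p})\<rparr>"

lemma free_superalgebra_ring: "ring (free_superalgebra L odd_letter)" (is "ring ?F")
proof (rule ringI)
  have carrier: "f \<in> carrier ?F \<longleftrightarrow> (\<forall>w\<in>Poly_Mapping.keys f. set (letters w) \<subseteq> L)" for f
    by (simp add: free_superalgebra_def)
  have ops: "f \<oplus>\<^bsub>?F\<^esub> g = f + g" "f \<otimes>\<^bsub>?F\<^esub> g = f * g" "\<one>\<^bsub>?F\<^esub> = 1" "\<zero>\<^bsub>?F\<^esub> = 0" for f g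
    by (simp_all add: free_superalgebra_def)
  have add: "f + g \<in> carrier ?F" if "f \<in> carrier ?F" "g \<in> carrier ?F" for f g
    using that Poly_Mapping.keys_add[of f g] unfolding carrier by blast
  have neg: "- f \<in> carrier ?F" if "f \<in> carrier ?F" for f
    using that unfolding carrier by simp
  have mult: "f * g \<in> carrier ?F" if fg: "f \<in> carrier ?F" "g \<in> carrier ?F" for f g
    unfolding carrier
  proof
    fix w assume "w \<in> Poly_Mapping.keys (f * g)"
    then obtain u v where "w = u + v" "u \<in> Poly_Mapping.keys f" "v \<in> Poly_Mapping.keys g"
      using Poly_Mapping.keys_mult[of f g] by blast
    then show "set (letters w) \<subseteq> L"
      using fg unfolding carrier by (simp add: plus_fword_def)
  qed
  have zero: "0 \<in> carrier ?F" and one: "1 \<in> carrier ?F"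
    unfolding carrier by (simp_all add: zero_fword_def)
  show "abelian_group ?F"
  proof (rule abelian_groupI)
    fix f assume "f \<in> carrier ?F"
    then show "\<exists>g\<in>carrier ?F. g \<oplus>\<^bsub>?F\<^esub> f = \<zero>\<^bsub>?F\<^esub>"
      unfolding ops by (intro bexI[OF _ neg]) simp_all
  qed (simp_all only: ops add zero ac_simps add_0 add_0_right)
  show "Group.monoid ?F"
    by (rule monoidI) (simp_all only: ops mult one mult.assoc mult_1_left mult_1_right)
qed (simp_all add: free_superalgebra_def distrib_left distrib_right)


section \<open>The superalgebra of observables\<close>

text \<open>The letter \<open>Gen \<alpha> i\<close> is the generator \<open>a\<^sub>\<alpha>\<^sub>i\<close>, with \<open>\<alpha>\<close> ranging over the two elements 0 and 1
  of the type \<open>2\<close>; the letter \<open>Grp g\<close> is the group element \<open>g\<close>.\<close>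

datatype ('i, 'g) generator = Gen 2 'i | Grp 'g

type_synonym 'n observable = "('n, real^'n \<Rightarrow> real^'n) generator ncpoly"

fun is_gen :: "('i, 'g) generator \<Rightarrow> bool" where
  "is_gen (Gen \<alpha> i) = True"
| "is_gen (Grp g) = False"

definition generators :: "(real^'n) set \<Rightarrow> ('n, real^'n \<Rightarrow> real^'n) generator set" where
  "generators R = {Gen \<alpha> i | \<alpha> i. True} \<union> {Grp g | g. g \<in> carrier (coxeter_group R)}"

definition vec_elem :: "2 \<Rightarrow> real^'n \<Rightarrow> 'n observable" where
  "vec_elem \<alpha> x = (\<Sum>i\<in>UNIV. scalar (complex_of_real (x $ i)) * letter (Gen \<alpha> i))"

definition grp_elem :: "(real^'n \<Rightarrow> real^'n) \<Rightarrow> 'n observable" where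
  "grp_elem g = letter (Grp g)"

definition eps :: "2 \<Rightarrow> 2 \<Rightarrow> complex" where
  "eps \<alpha> \<beta> = (if \<alpha> = 0 \<and> \<beta> = 1 then 1 else if \<alpha> = 1 \<and> \<beta> = 0 then - 1 else 0)"

definition commutator_rhs ::
    "(real^'n) set \<Rightarrow> (real^'n \<Rightarrow> complex) \<Rightarrow> real^'n \<Rightarrow> real^'n \<Rightarrow> 'n observable" where
  "commutator_rhs R \<nu> x y =
     scalar (complex_of_real (x \<bullet> y)) +
     (\<Sum>v\<in>R. scalar (\<nu> v * complex_of_real ((x \<bullet> v) * (y \<bullet> v) / (v \<bullet> v))) * grp_elem (reflection v))"

text \<open>Each relation \<open>l = r\<close> is recorded as \<open>l - r\<close>. The first two families are the relations of
  the group algebra.\<close>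

definition calogero_relations ::
    "(real^'n) set \<Rightarrow> (real^'n \<Rightarrow> complex) \<Rightarrow> 'n observable set" where
  "calogero_relations R \<nu> =
     {grp_elem \<one>\<^bsub>coxeter_group R\<^esub> - 1} \<union>
     {grp_elem g * grp_elem h - grp_elem (g \<otimes>\<^bsub>coxeter_group R\<^esub> h) | g h.
        g \<in> carrier (coxeter_group R) \<and> h \<in> carrier (coxeter_group R)} \<union>
     {grp_elem g * vec_elem \<alpha> x - vec_elem \<alpha> (g x) * grp_elem g | g \<alpha> x.
        g \<in> carrier (coxeter_group R)} \<union>
     {vec_elem \<alpha> x * vec_elem \<beta> y - vec_elem \<beta> y * vec_elem \<alpha> x
        - scalar (eps \<alpha> \<beta>) * commutator_rhs R \<nu> x y | \<alpha> \<beta> x y. True}"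

definition calogero_superalgebra ::
    "(real^'n) set \<Rightarrow> (real^'n \<Rightarrow> complex) \<Rightarrow> 'n observable set superalgebra" where
  "calogero_superalgebra R \<nu> =
     (let F = free_superalgebra (generators R) is_gen
      in quotient_superalgebra F (Idl\<^bsub>F\<^esub> (calogero_relations R \<nu>)))"

lemma orthogonal_transformation_reflection: "orthogonal_transformation (reflection v)"
proof -
  have "linear (reflection v)"
    by (rule linearI) (auto simp: reflection_def inner_add_left algebra_simps add_divide_distrib)
  moreover have "reflection v x \<bullet> reflection v y = x \<bullet> y" for x y
    by (cases "v = 0") (auto simp: reflection_def inner_diff_left inner_diff_right inner_commute)
  ultimately show ?thesis
    by (simp add: orthogonal_transformation_def)
qed

lemma reflection_in_coxeter_group:
  assumes "v \<in> R"
  shows "reflection v \<in> carrier (coxeter_group R)"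
  using assms orthogonal_transformation_reflection[of v]
  by (auto simp: coxeter_group_def carrier_subgroup_generated orthogonal_group_def
      intro!: generate.incl)

lemma group_orthogonal_group: "group orthogonal_group"
proof (rule groupI)
  fix f :: "real^'n \<Rightarrow> real^'n" assume "f \<in> carrier orthogonal_group"
  then have "orthogonal_transformation f" by (simp add: orthogonal_group_def)
  then show "\<exists>g\<in>carrier orthogonal_group. g \<otimes>\<^bsub>orthogonal_group\<^esub> f = \<one>\<^bsub>orthogonal_group\<^esub>"
    by (intro bexI[of _ "inv_into UNIV f"])
      (auto simp: orthogonal_group_def orthogonal_transformation_inv orthogonal_transformation_inj)
qed (auto simp: orthogonal_group_def comp_assoc linear_compose
  orthogonal_transformation_def linear_id)

lemma group_coxeter_group: "group (coxeter_group R)"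
  unfolding coxeter_group_def by (rule group.group_subgroup_generated[OF group_orthogonal_group])

lemma calogero_relations_carrier:
  "calogero_relations R \<nu> \<subseteq> carrier (free_superalgebra (generators R) is_gen)"
proof -
  let ?F = "free_superalgebra (generators R) is_gen"
  interpret F: ring ?F by (rule free_superalgebra_ring)
  interpret W: group "coxeter_group R" by (rule group_coxeter_group)
  have ops: "x + y \<in> carrier ?F" "x - y \<in> carrier ?F" "x * y \<in> carrier ?F"
    if "x \<in> carrier ?F" "y \<in> carrier ?F" for x y
  proof -
    have neg: "- y \<in> carrier ?F"
      using that by (simp add: free_superalgebra_def)
    show "x + y \<in> carrier ?F" using F.a_closed[OF that] by (simp add: free_superalgebra_def)
    show "x - y \<in> carrier ?F" using F.a_closed[OF that(1) neg] by (simp add: free_superalgebra_def)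
    show "x * y \<in> carrier ?F" using F.m_closed[OF that] by (simp add: free_superalgebra_def)
  qed
  have sums: "(\<Sum>i\<in>I. f i) \<in> carrier ?F" if "\<And>i. i \<in> I \<Longrightarrow> f i \<in> carrier ?F"
    for I :: "'z set" and f
    using that
  proof (induction I rule: infinite_finite_induct)
    case (insert i I)
    then show ?case using ops(1)[of "f i" "\<Sum>i\<in>I. f i"] by simp
  qed (simp_all add: free_superalgebra_def)
  have scal: "scalar c \<in> carrier ?F" for c
    by (auto simp: free_superalgebra_def scalar_def zero_fword_def)
  have one: "1 \<in> carrier ?F"
    using F.one_closed by (simp add: free_superalgebra_def)
  have grp: "grp_elem g \<in> carrier ?F" if "g \<in> carrier (coxeter_group R)" for g
    using that by (auto simp: free_superalgebra_def grp_elem_def letter_def generators_def)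
  have vec: "vec_elem \<alpha> x \<in> carrier ?F" for \<alpha> x
    unfolding vec_elem_def
    by (intro sums ops scal) (auto simp: free_superalgebra_def letter_def generators_def)
  have comm: "commutator_rhs R \<nu> x y \<in> carrier ?F" for x y
    unfolding commutator_rhs_def by (intro ops sums scal grp reflection_in_coxeter_group)
  show ?thesis
    unfolding calogero_relations_def
    by (auto intro!: ops scal one grp vec comm)
qed

end

(* By its commutation relations the superalgebra is spanned by the elements P w Q with w in W,
   P a polynomial in the a_1i and Q one in the a_0i. It acts from both sides on functions on W
   with polynomial values, one of the generators a_0i, a_1i on each side acting by Dunkl
   operators. On this bimodule a kappa-trace becomes a functional that is invariant under
   conjugation and kills the twisted commutators T b u. A Koszul-type contraction GG built from
   the T b u satisfies GG f = (degree + 2 E) f + terms that lower degree + E, where E w is the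
   dimension of the eigenspace of w for kappa. Hence a trace is determined by its values on the
   group elements without eigenvalue kappa.

   Conversely, each class function defines a functional sp by this recursion,
   and it has to be shown that sp vanishes on all twisted commutators. Multiply nu by a formal
   parameter s. Moving T b u past the contraction costs only a factor s, so that if s^k divides
   all sp (T b u f), then so does s^(k+1). Therefore they vanish, and one sets s = 1. *)

theory Submission
  imports Defs "HOL-Computational_Algebra.Polynomial"
begin

section \<open>Commutative polynomials and divided differences\<close>

text \<open>At s = 0 the operator \<open>T b u\<close> multiplies the component at w by the linear
  form of u - \<kappa> w u (or the same with the inverse of w) and subtracts \<kappa> times the
  derivative along u in the other copy of the variables. Orthogonally to the eigenspace the first
  part is invertible, and the contraction is of Koszul type, by derivatives. On the eigenspace only
  the derivative is left, and the contraction is of de Rham type, by multiplications; there the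
  Leibniz rule produces E once for each copy of V, hence 2 E.

  Moving \<open>T c u\<close> past the contraction turns u into 2 p u - u, with p the projection
  onto the eigenspace. For u in the eigenspace or orthogonal to it, the coefficient degree + 2 E
  therefore changes by -1 or +1. It stays nonzero, because a nonzero u in the eigenspace forces E
  \<ge> 1.

  The formal parameter is there because the reflection terms arising in this commutation need not be
  lower in degree + E, so that an induction on that number does not close. Each of them carries a
  factor s instead.\<close>

type_synonym ('a, 'k) mpol = "'a multiset \<Rightarrow>\<^sub>0 'k"

definition Cst :: "'k \<Rightarrow> ('a, 'k::comm_ring_1) mpol" where
  "Cst c = Poly_Mapping.single 0 c"

definition X :: "'a \<Rightarrow> ('a, 'k::comm_ring_1) mpol" where
  "X a = Poly_Mapping.single {#a#} 1"

definition ring_map :: "('k::comm_ring_1 \<Rightarrow> 'r::comm_ring_1) \<Rightarrow> bool" where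
  "ring_map h \<longleftrightarrow> h 1 = 1 \<and> (\<forall>a b. h (a + b) = h a + h b) \<and> (\<forall>a b. h (a * b) = h a * h b)"

lemma ring_mapD:
  assumes "ring_map h"
  shows "h 1 = 1" "h 0 = 0" "h (a + b) = h a + h b" "h (a * b) = h a * h b"
    "h (- a) = - h a" "h (a - b) = h a - h b" "h (sum f I) = (\<Sum>i\<in>I. h (f i))"
proof -
  show 1: "h 1 = 1" "h (a * b) = h a * h b" using assms by (auto simp: ring_map_def)
  have add: "h (a + b) = h a + h b" for a b using assms by (auto simp: ring_map_def)
  then show "h (a + b) = h a + h b" .
  show 0: "h 0 = 0" using add[of 0 0] by simp
  show neg: "h (- a) = - h a" using add[of a "- a"] 0 by (simp add: eq_neg_iff_add_eq_0 add.commute)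
  have "h (- b) = - h b" for b using add[of b "- b"] 0 by (simp add: eq_neg_iff_add_eq_0 add.commute)
  then show "h (a - b) = h a - h b" using add[of a "- b"] by simp
  show "h (sum f I) = (\<Sum>i\<in>I. h (f i))"
    by (induction I rule: infinite_finite_induct) (auto simp: 0 add)
qed

lemma Cst_simps:
  "Cst 0 = 0" "Cst 1 = 1" "Cst (a + b) = Cst a + Cst b" "Cst (a * b) = Cst a * Cst b"
  "Cst (- a) = - Cst a" "Cst (a - b) = Cst a - Cst b"
  by (auto simp: Cst_def single_add mult_single single_uminus single_diff)

lemma ring_map_Cst: "ring_map Cst"
  by (auto simp: ring_map_def Cst_simps)

lemma Cst_sum: "Cst (sum f I) = (\<Sum>i\<in>I. Cst (f i))"
  by (rule ring_mapD(7)[OF ring_map_Cst])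

lemma single_mset_add: "Poly_Mapping.single (add_mset a m) c = X a * Poly_Mapping.single m c"
  by (simp add: X_def mult_single)

lemma Cst_single: "Cst c * Poly_Mapping.single m d = Poly_Mapping.single m (c * d)"
  by (simp add: Cst_def mult_single)

lemma poly_mapping_expand:
  fixes f :: "'x \<Rightarrow>\<^sub>0 'k::comm_ring_1"
  shows "f = (\<Sum>m\<in>Poly_Mapping.keys f. Poly_Mapping.single m (Poly_Mapping.lookup f m))"
  by (rule poly_mapping_eqI)
    (auto simp: lookup_sum lookup_single when_def in_keys_iff if_distrib cong: if_cong)

lemma poly_mapping_single_induct [case_names zero single add]:
  fixes f :: "'x \<Rightarrow>\<^sub>0 'k::comm_ring_1"
  assumes "P 0" "\<And>m c. P (Poly_Mapping.single m c)" "\<And>f g. P f \<Longrightarrow> P g \<Longrightarrow> P (f + g)"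
  shows "P f"
proof -
  have "P (\<Sum>m\<in>A. Poly_Mapping.single m (Poly_Mapping.lookup f m))" for A
    by (induction A rule: infinite_finite_induct) (auto intro: assms)
  then show ?thesis using poly_mapping_expand[of f] by metis
qed

lemma mpol_induct [case_names const var add]:
  fixes f :: "('a, 'k::comm_ring_1) mpol"
  assumes c: "\<And>c. P (Cst c)" and X: "\<And>a f. P f \<Longrightarrow> P (X a * f)"
    and add: "\<And>f g. P f \<Longrightarrow> P g \<Longrightarrow> P (f + g)"
  shows "P f"
proof (induction f rule: poly_mapping_single_induct)
  case zero
  then show ?case using c[of 0] by (simp add: Cst_simps)
next
  case (single m c)
  then show ?case
    by (induction m) (auto simp: c[unfolded Cst_def, simplified] single_mset_add intro: X)
qed (rule add)

section \<open>Evaluation and substitution homomorphisms\<close>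

definition ev :: "('k::comm_ring_1 \<Rightarrow> 'r::comm_ring_1) \<Rightarrow> ('a \<Rightarrow> 'r) \<Rightarrow> ('a, 'k) mpol \<Rightarrow> 'r" where
  "ev h t f = (\<Sum>m\<in>Poly_Mapping.keys f. h (Poly_Mapping.lookup f m) * (\<Prod>a\<in>#m. t a))"

context
  fixes h :: "'k::comm_ring_1 \<Rightarrow> 'r::comm_ring_1"
  assumes h: "ring_map h"
begin

lemma ev_superset:
  assumes "finite A" "Poly_Mapping.keys f \<subseteq> A"
  shows "ev h t f = (\<Sum>m\<in>A. h (Poly_Mapping.lookup f m) * (\<Prod>a\<in>#m. t a))"
  unfolding ev_def
  by (rule sum.mono_neutral_left) (use assms in \<open>auto simp: in_keys_iff ring_mapD[OF h]\<close>)

lemma ev_add: "ev h t (f + g) = ev h t f + ev h t g"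
proof -
  let ?A = "Poly_Mapping.keys f \<union> Poly_Mapping.keys g"
  have "Poly_Mapping.keys (f + g) \<subseteq> ?A" by (rule Poly_Mapping.keys_add)
  then show ?thesis
    by (simp add: ev_superset[of ?A] lookup_add ring_mapD[OF h] distrib_right sum.distrib)
qed

lemma ev_single: "ev h t (Poly_Mapping.single m c) = h c * (\<Prod>a\<in>#m. t a)"
  by (cases "c = 0") (auto simp: ev_def ring_mapD[OF h])

lemma ev_0: "ev h t 0 = 0"
  by (simp add: ev_def)

lemma ev_Cst: "ev h t (Cst c) = h c"
  by (simp add: Cst_def ev_single)

lemma ev_X: "ev h t (X a) = t a"
  by (simp add: X_def ev_single ring_mapD[OF h])

lemma ev_X_mult: "ev h t (X a * f) = t a * ev h t f"
proof (induction f rule: poly_mapping_single_induct)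
  case (single m c)
  then show ?case by (simp add: single_mset_add[symmetric] ev_single mult_ac)
qed (auto simp: ev_add distrib_left ev_0)

lemma ev_Cst_mult: "ev h t (Cst c * f) = h c * ev h t f"
proof (induction f rule: poly_mapping_single_induct)
  case (single m d)
  then show ?case by (simp add: Cst_single ev_single ring_mapD[OF h] mult_ac)
qed (auto simp: ev_add distrib_left ev_0)

lemma ev_mult: "ev h t (f * g) = ev h t f * ev h t g"
proof (induction f rule: mpol_induct)
  case (var a f)
  then show ?case by (simp add: mult.assoc ev_X_mult)
qed (auto simp: ev_add distrib_right ev_Cst_mult ev_Cst)

lemma ring_map_ev: "ring_map (ev h t)"
  using ev_Cst[of t 1] by (auto simp: ring_map_def ev_add ev_mult Cst_simps ring_mapD[OF h])

end

lemma ring_map_compose: "ring_map f \<Longrightarrow> ring_map g \<Longrightarrow> ring_map (\<lambda>x. f (g x))"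
  by (simp add: ring_map_def)

text \<open>Constants and variables generate the polynomial ring. Identities between composed
  substitutions are proved by this comparison, without touching the sum that defines
  \<open>ev\<close>.\<close>

lemma ring_map_eqI:
  fixes F G :: "('a, 'k::comm_ring_1) mpol \<Rightarrow> 'r::comm_ring_1"
  assumes F: "ring_map F" and G: "ring_map G"
    and "\<And>c. F (Cst c) = G (Cst c)" "\<And>a. F (X a) = G (X a)"
  shows "F f = G f"
  by (induction f rule: mpol_induct) (auto simp: assms ring_mapD[OF F] ring_mapD[OF G])

definition sub :: "('a \<Rightarrow> ('b, 'k::comm_ring_1) mpol) \<Rightarrow> ('a, 'k) mpol \<Rightarrow> ('b, 'k) mpol" where
  "sub t = ev Cst t"

lemma ring_map_sub: "ring_map (sub t)"
  unfolding sub_def by (rule ring_map_ev[OF ring_map_Cst])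

lemmas sub_simps = ring_mapD[OF ring_map_sub]

lemma sub_Cst [simp]: "sub t (Cst c) = Cst c"
  by (simp add: sub_def ev_Cst ring_map_Cst)

lemma sub_X [simp]: "sub t (X a) = t a"
  by (simp add: sub_def ev_X ring_map_Cst)

lemma sub_sub: "sub t (sub t' f) = sub (\<lambda>a. sub t (t' a)) f"
  by (rule ring_map_eqI) (auto intro!: ring_map_sub ring_map_compose[OF ring_map_sub])

lemma ring_map_ident: "ring_map (\<lambda>x. x)"
  by (simp add: ring_map_def)

lemma sub_id: "sub X f = f"
  by (rule ring_map_eqI) (auto intro!: ring_map_sub ring_map_ident)

text \<open>The amount \<open>V\<close> of the shift is itself a polynomial. With \<open>z\<close>
  the direction of a root and \<open>V\<close> a multiple of its linear form this is the reflection
  in that root (\<open>tr_DD\<close>); with \<open>V = 0\<close> it is the identity.\<close>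

definition tr :: "('a \<Rightarrow> 'k::comm_ring_1) \<Rightarrow> ('a, 'k) mpol \<Rightarrow> ('a, 'k) mpol \<Rightarrow> ('a, 'k) mpol" where
  "tr z V = sub (\<lambda>a. X a + Cst (z a) * V)"

text \<open>Substituting \<open>X a + \<tau> z a\<close> for \<open>X a\<close> in \<open>f\<close> gives a polynomial in \<open>\<tau>\<close>; \<open>dd z V f\<close> is the
  difference of its values at \<open>\<tau> = V\<close> and \<open>\<tau> = 0\<close>, divided by \<open>V\<close>. It is a divided difference
  of \<open>f\<close>, and for \<open>V = 0\<close> the derivative of \<open>f\<close> in the direction \<open>z\<close>.\<close>

definition dd :: "('a \<Rightarrow> 'k::comm_ring_1) \<Rightarrow> ('a, 'k) mpol \<Rightarrow> ('a, 'k) mpol \<Rightarrow> ('a, 'k) mpol" where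
  "dd z V f = poly (synthetic_div (ev (\<lambda>c. [:Cst c:]) (\<lambda>a. [:X a, Cst (z a):]) f) 0) V"

lemma synthetic_div_0_pCons: "synthetic_div (pCons a q) 0 = q"
  using synthetic_div_correct[of "pCons a q" 0] by (metis add.right_neutral pCons_eq_iff smult_0_left)

lemma ring_map_poly_Cst: "ring_map (\<lambda>c. [:Cst c:])"
  by (auto simp: ring_map_def Cst_simps)

lemmas tr_simps = sub_simps[of "\<lambda>a. X a + Cst (z a) * V" for z V, folded tr_def]

lemma tr_Cst [simp]: "tr z V (Cst c) = Cst c"
  by (simp add: tr_def)

lemma tr_X [simp]: "tr z V (X a) = X a + Cst (z a) * V"
  by (simp add: tr_def)

lemma ring_map_tr: "ring_map (tr z V)"
  unfolding tr_def by (rule ring_map_sub)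

lemma ring_map_poly: "ring_map (\<lambda>p. poly p V)"
  by (simp add: ring_map_def)

lemma poly_ev: "poly (ev (\<lambda>c. [:Cst c:]) (\<lambda>a. [:X a, Cst (z a):]) f) V = tr z V f"
  by (rule ring_map_eqI)
    (auto intro!: ring_map_tr ring_map_compose[OF ring_map_poly] ring_map_ev ring_map_poly_Cst
      simp: ev_Cst ev_X ring_map_poly_Cst mult.commute)

lemma dd_add: "dd z V (f + g) = dd z V f + dd z V g"
proof -
  have "synthetic_div (p + q) 0 = synthetic_div p 0 + synthetic_div q 0" for p q :: "('a, 'b) mpol poly"
    by (cases p; cases q) (simp add: synthetic_div_0_pCons del: synthetic_div_pCons)
  then show ?thesis by (simp add: dd_def ev_add ring_map_poly_Cst)
qed

lemma dd_Cst [simp]: "dd z V (Cst c) = 0"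
  by (simp add: dd_def ev_Cst ring_map_poly_Cst)

text \<open>With additivity and the value on constants this rule determines \<open>dd\<close>. Every
  later fact about \<open>dd\<close> rests on these three, so that synthetic division does not occur
  again.\<close>

lemma dd_X_mult: "dd z V (X a * f) = X a * dd z V f + Cst (z a) * tr z V f"
proof -
  let ?e = "ev (\<lambda>c. [:Cst c:]) (\<lambda>a. [:X a, Cst (z a):])"
  obtain p0 q where f: "?e f = pCons p0 q" by (cases "?e f")
  have "?e (X a * f) = pCons (X a * p0) (Polynomial.smult (X a) q + Polynomial.smult (Cst (z a)) (pCons p0 q))"
    by (simp add: ev_X_mult ring_map_poly_Cst f mult_pCons_left)
  then have "dd z V (X a * f) = X a * poly q V + Cst (z a) * poly (?e f) V"
    by (simp add: dd_def synthetic_div_0_pCons f algebra_simps del: synthetic_div_pCons)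
  then show ?thesis
    unfolding poly_ev by (simp add: dd_def f synthetic_div_0_pCons del: synthetic_div_pCons)
qed

lemma dd_0 [simp]: "dd z V 0 = 0"
  using dd_Cst[of z V 0] by (simp add: Cst_simps)

lemma dd_1 [simp]: "dd z V 1 = 0"
  using dd_Cst[of z V 1] by (simp add: Cst_simps)

lemma tr_1 [simp]: "tr z V 1 = 1"
  by (rule ring_mapD(1)[OF ring_map_tr])

lemma dd_X [simp]: "dd z V (X a) = Cst (z a)"
  using dd_X_mult[of z V a 1] by simp

lemma tr_eq: "tr z V f = f + V * dd z V f"
  by (induction f rule: mpol_induct; simp add: tr_simps dd_add dd_X_mult; (simp add: algebra_simps)?)

lemma dd_Cst_mult: "dd z V (Cst c * f) = Cst c * dd z V f"
proof (induction f rule: mpol_induct)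
  case (const d)
  then show ?case by (simp add: Cst_simps(4)[symmetric])
next
  case (var a f)
  have "Cst c * (X a * f) = X a * (Cst c * f)" by (simp add: mult_ac)
  then have "dd z V (Cst c * (X a * f)) = X a * (Cst c * dd z V f) + Cst (z a) * (Cst c * tr z V f)"
    using var by (simp only: dd_X_mult tr_simps tr_Cst)
  then show ?case by (simp only: dd_X_mult) (simp add: algebra_simps)
qed (simp add: distrib_left dd_add)

lemma dd_mult: "dd z V (f * g) = f * dd z V g + dd z V f * tr z V g"
proof (induction f rule: mpol_induct)
  case (var a f)
  then show ?case
    by (simp add: mult.assoc dd_X_mult tr_simps) (simp add: algebra_simps)
qed (simp_all add: distrib_right dd_add dd_Cst_mult)

lemma dd_uminus: "dd z V (- f) = - dd z V f"
  using dd_Cst_mult[of z V "- 1" f] by (simp add: Cst_simps)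

lemma dd_diff: "dd z V (f - g) = dd z V f - dd z V g"
  using dd_add[of z V f "- g"] by (simp add: dd_uminus)

lemma dd_sum: "dd z V (sum f I) = (\<Sum>i\<in>I. dd z V (f i))"
  by (induction I rule: infinite_finite_induct) (auto simp: dd_add)

text \<open>By \<open>tr_eq\<close> the two hypotheses say that each shift fixes the amount of the
  other.\<close>

lemma tr_tr_commute:
  assumes "dd z V V' = 0" "dd z' V' V = 0"
  shows "tr z V (tr z' V' f) = tr z' V' (tr z V f)"
  by (rule ring_map_eqI)
    (use assms in \<open>auto intro!: ring_map_compose[OF ring_map_tr] ring_map_tr simp: tr_simps tr_eq[of z' V' V]
      tr_eq[of z V V'] algebra_simps\<close>)

lemma dd_tr_commute:
  assumes "dd z V V' = 0" "dd z' V' V = 0"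
  shows "dd z V (tr z' V' f) = tr z' V' (dd z V f)"
proof (induction f rule: mpol_induct)
  case (var a f)
  have [simp]: "tr z' V' V = V" by (simp add: tr_eq assms)
  show ?case
    by (simp add: var tr_simps dd_X_mult dd_mult dd_add dd_Cst_mult assms tr_tr_commute[OF assms])
qed (simp_all add: tr_simps dd_add)

lemma dd_dd_commute:
  assumes "dd z V V' = 0" "dd z' V' V = 0"
  shows "dd z V (dd z' V' f) = dd z' V' (dd z V f)"
proof (induction f rule: mpol_induct)
  case (var a f)
  show ?case
    by (simp add: var dd_X_mult dd_add dd_Cst_mult dd_tr_commute[OF assms] dd_tr_commute[OF assms(2,1)] add_ac)
qed (simp_all add: dd_add)

text \<open>Naturality under a substitution that carries amount and direction of one shift to those
  of another. It covers derivatives and reflection quotients alike, and yields the equivariance of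
  both parts of a Dunkl operator.\<close>

lemma sub_dd:
  assumes V: "sub t V = V'" and z: "\<And>a. dd z' V' (t a) = Cst (z a)"
  shows "sub t (dd z V f) = dd z' V' (sub t f)"
proof (induction f rule: mpol_induct)
  case (var a f)
  have "sub t (tr z V g) = tr z' V' (sub t g)" for g
    by (rule ring_map_eqI)
      (auto intro!: ring_map_compose[OF ring_map_sub] ring_map_compose[OF ring_map_tr] ring_map_sub
        ring_map_tr simp: sub_simps V tr_eq[of z' V' "t _"] z mult.commute)
  then show ?case using var by (simp add: dd_X_mult dd_mult sub_simps z)
qed (auto simp: sub_simps dd_add)

abbreviation pd :: "('a \<Rightarrow> 'k::comm_ring_1) \<Rightarrow> ('a, 'k) mpol \<Rightarrow> ('a, 'k) mpol" where
  "pd z \<equiv> dd z 0"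

lemma tr_0 [simp]: "tr z 0 f = f"
  by (simp add: tr_eq)

lemma pd_mult: "pd z (f * g) = f * pd z g + pd z f * g"
  by (simp add: dd_mult)

lemma pd_dir_add: "pd (\<lambda>a. z a + z' a) f = pd z f + pd z' f"
  by (induction f rule: mpol_induct; simp add: dd_add dd_X_mult Cst_simps; (simp add: algebra_simps)?)

lemma pd_dir_scale: "pd (\<lambda>a. c * z a) f = Cst c * pd z f"
  by (induction f rule: mpol_induct; simp add: dd_add dd_X_mult Cst_simps; (simp add: algebra_simps)?)

definition del :: "'a \<Rightarrow> ('a, 'k::comm_ring_1) mpol \<Rightarrow> ('a, 'k) mpol" where
  "del a = pd (\<lambda>b. if b = a then 1 else 0)"

lemma pd_eq_sum_del:
  fixes f :: "('a::finite, 'k::comm_ring_1) mpol"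
  shows "pd z f = (\<Sum>a\<in>UNIV. Cst (z a) * del a f)"
proof (induction f rule: mpol_induct)
  case (var b f)
  have "(\<Sum>a\<in>UNIV. Cst (z a) * del a (X b * f)) =
      (\<Sum>a\<in>UNIV. X b * (Cst (z a) * del a f) + (if a = b then Cst (z a) * f else 0))"
    by (rule sum.cong) (auto simp: del_def dd_X_mult Cst_simps distrib_left mult_ac(3))
  then show ?case using var by (simp add: dd_X_mult sum.distrib sum_distrib_left)
qed (auto simp: dd_add del_def distrib_left sum.distrib)

text \<open>Sets of degrees serve homogeneity (a singleton), filtrations (a ray) and parity at once.
  The degrees are integers, so that lowering them is never truncated.\<close>

definition Graded :: "int set \<Rightarrow> ('a, 'k::comm_ring_1) mpol set" where
  "Graded A = {f. \<forall>m\<in>Poly_Mapping.keys f. int (size m) \<in> A}"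

lemma Graded_add: "f \<in> Graded A \<Longrightarrow> g \<in> Graded A \<Longrightarrow> f + g \<in> Graded A"
  using Poly_Mapping.keys_add[of f g] by (auto simp: Graded_def)

lemma Graded_0 [simp]: "0 \<in> Graded A"
  by (simp add: Graded_def)

lemma Graded_single: "Poly_Mapping.single m c \<in> Graded A \<longleftrightarrow> c = 0 \<or> int (size m) \<in> A"
  by (auto simp: Graded_def)

lemma Graded_mono: "f \<in> Graded A \<Longrightarrow> A \<subseteq> B \<Longrightarrow> f \<in> Graded B"
  by (auto simp: Graded_def)

lemma Graded_induct [consumes 1, case_names zero single add]:
  assumes f: "f \<in> Graded A" and "P 0"
    and "\<And>m c. int (size m) \<in> A \<Longrightarrow> P (Poly_Mapping.single m c)"
    and "\<And>f g. P f \<Longrightarrow> P g \<Longrightarrow> P (f + g)"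
  shows "P f"
proof -
  have "P (\<Sum>m\<in>B. Poly_Mapping.single m (Poly_Mapping.lookup f m))"
    if "B \<subseteq> Poly_Mapping.keys f" for B
    using finite_subset[OF that finite_keys] that
    by (induction B rule: finite_induct) (use f in \<open>auto intro!: assms simp: Graded_def\<close>)
  then show ?thesis using poly_mapping_expand[of f] by (metis order_refl)
qed

lemma Graded_sum: "(\<And>i. i \<in> I \<Longrightarrow> f i \<in> Graded A) \<Longrightarrow> sum f I \<in> Graded A"
  by (induction I rule: infinite_finite_induct) (auto intro: Graded_add)

lemma Graded_X_mult: "f \<in> Graded A \<Longrightarrow> X a * f \<in> Graded ((+) 1 ` A)"
  by (induction rule: Graded_induct)
    (auto simp: single_mset_add[symmetric] Graded_single distrib_left intro: Graded_add)

lemma Graded_Cst_mult: "f \<in> Graded A \<Longrightarrow> Cst c * f \<in> Graded A"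
  by (induction rule: Graded_induct)
    (auto simp: Cst_single Graded_single distrib_left intro: Graded_add)

lemma Graded_uminus: "f \<in> Graded A \<Longrightarrow> - f \<in> Graded A"
  using Graded_Cst_mult[of f A "- 1"] by (simp add: Cst_simps)

lemma Graded_diff: "f \<in> Graded A \<Longrightarrow> g \<in> Graded A \<Longrightarrow> f - g \<in> Graded A"
  using Graded_add[of f A "- g"] Graded_uminus[of g A] by simp

definition linear_form :: "('a, 'k::comm_ring_1) mpol \<Rightarrow> bool" where
  "linear_form V \<longleftrightarrow> (\<exists>c I. V = (\<Sum>a\<in>I. Cst (c a) * X a))"

lemma Graded_linear_mult:
  assumes "linear_form V" "f \<in> Graded A"
  shows "V * f \<in> Graded ((+) 1 ` A)"
  using assms by (auto simp: linear_form_def sum_distrib_right mult.assoc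
      intro!: Graded_sum Graded_Cst_mult Graded_X_mult)

lemma Graded_sub:
  assumes t: "\<And>a. linear_form (t a)" and f: "f \<in> Graded A"
  shows "sub t f \<in> Graded A"
  using f
proof (induction rule: Graded_induct)
  case (single m c)
  have "sub t (Poly_Mapping.single m c) \<in> Graded {int (size m)}"
  proof (induction m)
    case empty
    then show ?case by (simp add: Cst_def[symmetric]) (simp add: Cst_def Graded_single)
  next
    case (add a m)
    then show ?case
      using Graded_linear_mult[OF t add] by (simp add: single_mset_add sub_simps add.commute)
  qed
  then show ?case using single by (auto intro: Graded_mono)
qed (auto simp: sub_simps intro: Graded_add)

lemma linear_form_simps:
  "linear_form 0" "linear_form (X a)" "linear_form V \<Longrightarrow> linear_form (Cst c * V)"
proof -
  show "linear_form 0" unfolding linear_form_def by (rule exI[of _ 0], rule exI[of _ "{}"]) simp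
  show "linear_form (X a)" unfolding linear_form_def
    by (rule exI[of _ "\<lambda>_. 1"], rule exI[of _ "{a}"]) (simp add: Cst_simps)
  assume "linear_form V"
  then obtain d I where "V = (\<Sum>a\<in>I. Cst (d a) * X a)" by (auto simp: linear_form_def)
  then have "Cst c * V = (\<Sum>a\<in>I. Cst (c * d a) * X a)"
    by (simp add: Cst_simps sum_distrib_left mult.assoc)
  then show "linear_form (Cst c * V)" unfolding linear_form_def
    by (intro exI[of _ "\<lambda>a. c * d a"] exI[of _ I])
qed

lemma Graded_dd:
  assumes V: "linear_form V" and f: "f \<in> Graded A"
  shows "dd z V f \<in> Graded ((\<lambda>j. j - 1) ` A)"
  using f
proof (induction rule: Graded_induct)
  case (single m c)
  \<comment> \<open>\<open>dd_X_mult\<close> leads from \<open>dd\<close> back to \<open>tr\<close>,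
    so both statements have to go through the induction together.\<close>
  have "tr z V (Poly_Mapping.single m c) \<in> Graded {int (size m)}
      \<and> dd z V (Poly_Mapping.single m c) \<in> Graded {int (size m) - 1}"
  proof (induction m)
    case empty
    then show ?case by (simp add: Cst_def[symmetric]) (simp add: Cst_def Graded_single)
  next
    case (add a m)
    let ?s = "Poly_Mapping.single m c"
    have "V * dd z V ?s \<in> Graded {int (size m)}"
      using Graded_linear_mult[OF V conjunct2[OF add]] by simp
    then have 1: "X a * dd z V ?s \<in> Graded {int (size m)}"
      using Graded_X_mult[OF conjunct2[OF add]] by simp
    have 2: "Cst (z a) * tr z V ?s \<in> Graded {int (size m)}"
      by (rule Graded_Cst_mult[OF conjunct1[OF add]])
    have 3: "dd z V (X a * ?s) \<in> Graded {int (size m)}"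
      unfolding dd_X_mult by (rule Graded_add[OF 1 2])
    have "X a * ?s + V * dd z V (X a * ?s) \<in> Graded {int (size m) + 1}"
      using Graded_linear_mult[OF V 3] by (auto intro!: Graded_add simp: Graded_single single_mset_add[symmetric] add.commute)
    then show ?case using 3 by (simp add: single_mset_add tr_eq add.commute)
  qed
  then show ?case using single by (auto intro: Graded_mono)
qed (auto simp: dd_add intro: Graded_add)

lemma homogeneous_decomposition [case_names homogeneous add]:
  assumes "\<And>j f. f \<in> Graded {int j} \<Longrightarrow> P f" "\<And>f g. P f \<Longrightarrow> P g \<Longrightarrow> P (f + g)"
  shows "P f"
proof (induction f rule: poly_mapping_single_induct)
  case zero
  then show ?case using assms(1)[of 0 0] by simp
next
  case (single m c)
  then show ?case using assms(1)[of _ "size m"] by (simp add: Graded_single)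
qed (rule assms(2))

section \<open>The Euler operator and rescaling by degree\<close>

definition eul :: "('a::finite, 'k::comm_ring_1) mpol \<Rightarrow> ('a, 'k) mpol" where
  "eul f = (\<Sum>a\<in>UNIV. X a * del a f)"

lemma eul_add: "eul (f + g) = eul f + eul g"
  by (simp add: eul_def del_def dd_add distrib_left sum.distrib)

lemma eul_X_mult: "eul (X b * f) = X b * (eul f + f)"
proof -
  have "eul (X b * f) = (\<Sum>a\<in>UNIV. X b * (X a * del a f) + (if a = b then X b * f else 0))"
    unfolding eul_def by (rule sum.cong) (auto simp: del_def dd_X_mult Cst_simps distrib_left mult_ac(3))
  also have "\<dots> = X b * (eul f + f)"
    by (simp add: sum.distrib eul_def sum_distrib_left distrib_left)
  finally show ?thesis .
qed

lemma eul_Graded: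
  assumes "f \<in> Graded {int j}"
  shows "eul f = Cst (of_nat j) * f"
  using assms
proof (induction rule: Graded_induct)
  case (single m c)
  have "eul (Poly_Mapping.single m c) = Cst (of_nat (size m)) * Poly_Mapping.single m c"
  proof (induction m)
    case empty
    then show ?case by (simp add: Cst_def[symmetric] eul_def del_def Cst_simps)
  next
    case (add a m)
    then show ?case by (simp add: single_mset_add eul_X_mult Cst_simps algebra_simps)
  qed
  then show ?case using single by simp
qed (auto simp: eul_add distrib_left, simp add: eul_def del_def)

text \<open>Serves twice: with the factors 1 / (degree + 2 E) to invert the diagonal operator
  \<open>J\<close>, and with factors 0 and 1 to project onto even or odd degrees.\<close>

definition degree_scale :: "(nat \<Rightarrow> 'k::comm_ring_1) \<Rightarrow> ('a, 'k) mpol \<Rightarrow> ('a, 'k) mpol" where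
  "degree_scale r f = Poly_Mapping.mapp (\<lambda>m c. r (size m) * c) f"

lemma lookup_degree_scale:
  "Poly_Mapping.lookup (degree_scale r f) m = r (size m) * Poly_Mapping.lookup f m"
  by (auto simp: degree_scale_def lookup_mapp when_def in_keys_iff)

lemma degree_scale_add: "degree_scale r (f + g) = degree_scale r f + degree_scale r g"
  by (rule poly_mapping_eqI) (simp add: lookup_degree_scale lookup_add algebra_simps)

lemma lookup_Cst_mult: "Poly_Mapping.lookup (Cst c * f) m = c * Poly_Mapping.lookup f m"
  by (induction f rule: poly_mapping_single_induct)
    (auto simp: Cst_single lookup_single when_def lookup_add distrib_left)

lemma degree_scale_Graded: "f \<in> Graded {int j} \<Longrightarrow> degree_scale r f = Cst (r j) * f"
  by (rule poly_mapping_eqI) (auto simp: lookup_degree_scale lookup_Cst_mult Graded_def in_keys_iff)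

lemma degree_scale_in_Graded: "f \<in> Graded A \<Longrightarrow> degree_scale r f \<in> Graded A"
  by (auto simp: Graded_def in_keys_iff lookup_degree_scale)

lemma degree_scale_Cst_mult: "degree_scale r (Cst c * f) = Cst c * degree_scale r f"
  by (rule poly_mapping_eqI) (simp add: lookup_degree_scale lookup_Cst_mult mult.left_commute)

section \<open>Orthogonal projections and eigenspaces\<close>

definition proj :: "'a::euclidean_space set \<Rightarrow> 'a \<Rightarrow> 'a" where
  "proj S x = (THE y. y \<in> S \<and> (\<forall>s\<in>S. (x - y) \<bullet> s = 0))"

context
  fixes S :: "'a::euclidean_space set"
  assumes S: "subspace S"
begin

lemma proj_ex1: "\<exists>!y. y \<in> S \<and> (\<forall>s\<in>S. (x - y) \<bullet> s = 0)"
proof -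
  obtain y z where "y \<in> span S" "\<And>w. w \<in> span S \<Longrightarrow> orthogonal z w" "x = y + z"
    using orthogonal_subspace_decomp_exists[of S x] by metis
  moreover have "span S = S" using S by (simp add: span_eq_iff)
  ultimately have y: "y \<in> S \<and> (\<forall>s\<in>S. (x - y) \<bullet> s = 0)" by (auto simp: orthogonal_def)
  show ?thesis
  proof (rule ex1I[where a = y], rule y)
    fix y' assume y': "y' \<in> S \<and> (\<forall>s\<in>S. (x - y') \<bullet> s = 0)"
    have "y - y' \<in> S" using y y' S by (simp add: subspace_diff)
    then have "(x - y') \<bullet> (y - y') = 0" "(x - y) \<bullet> (y - y') = 0" using y y' by auto
    then have "(y - y') \<bullet> (y - y') = 0" by (simp add: inner_diff_left)
    then show "y' = y" by simp
  qed
qed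

lemma proj_in: "proj S x \<in> S" and proj_orth: "s \<in> S \<Longrightarrow> (x - proj S x) \<bullet> s = 0"
  using theI'[OF proj_ex1[of x]] unfolding proj_def by auto

lemma proj_unique: "y \<in> S \<Longrightarrow> (\<And>s. s \<in> S \<Longrightarrow> (x - y) \<bullet> s = 0) \<Longrightarrow> proj S x = y"
  unfolding proj_def by (rule the1_equality[OF proj_ex1]) auto

lemma proj_id: "x \<in> S \<Longrightarrow> proj S x = x"
  by (rule proj_unique) auto

lemma linear_proj: "linear (proj S)"
proof (rule linearI)
  fix x y :: 'a and c :: real
  show "proj S (x + y) = proj S x + proj S y"
    by (rule proj_unique) (use proj_orth[of _ x] proj_orth[of _ y] in
      \<open>auto simp: subspace_add[OF S] proj_in inner_diff_left inner_add_left algebra_simps\<close>)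
  show "proj S (c *\<^sub>R x) = c *\<^sub>R proj S x"
    by (rule proj_unique) (use proj_orth[of _ x] in
      \<open>auto simp: subspace_scale[OF S] proj_in inner_diff_left algebra_simps\<close>)
qed

lemma proj_symmetric: "proj S x \<bullet> y = x \<bullet> proj S y"
proof -
  have "(x - proj S x) \<bullet> proj S y = 0" "(y - proj S y) \<bullet> proj S x = 0"
    by (auto intro: proj_orth proj_in)
  then show ?thesis by (simp add: inner_diff_left inner_commute[of y] inner_commute[of "proj S y"])
qed

text \<open>Expanding the projection in an orthonormal basis of \<open>S\<close> makes the trace the
  number of basis vectors. This trace is the source of the term \<open>E\<close> in the Euler
  identity.\<close>

lemma trace_proj: "(\<Sum>b\<in>Basis. proj S b \<bullet> b) = real (dim S)"
proof -
  obtain B where B: "B \<subseteq> S" "pairwise orthogonal B" "\<And>x. x \<in> B \<Longrightarrow> norm x = 1"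
    "independent B" "card B = dim S" "span B = S"
    using orthonormal_basis_subspace[OF S] by metis
  have finB: "finite B" using B(4) by (rule independent_imp_finite)
  have inner: "b \<bullet> c = (if b = c then 1 else 0)" if "b \<in> B" "c \<in> B" for b c
    using B(2,3) that by (auto simp: pairwise_def orthogonal_def dot_square_norm)
  have p: "proj S x = (\<Sum>b\<in>B. (x \<bullet> b) *\<^sub>R b)" for x
  proof (rule proj_unique)
    show "(\<Sum>b\<in>B. (x \<bullet> b) *\<^sub>R b) \<in> S"
      using S B(1) by (intro subspace_sum subspace_scale) auto
    fix s assume "s \<in> S"
    then have "s \<in> span B" using B(6) by simp
    then show "(x - (\<Sum>b\<in>B. (x \<bullet> b) *\<^sub>R b)) \<bullet> s = 0"
    proof (induction rule: span_induct_alt)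
      case (step c b y)
      have "(\<Sum>a\<in>B. (x \<bullet> a) *\<^sub>R a) \<bullet> b = (\<Sum>a\<in>B. (x \<bullet> a) * (if a = b then 1 else 0))"
        using step(1) by (simp add: inner_sum_left inner cong: sum.cong)
      then have "(\<Sum>a\<in>B. (x \<bullet> a) *\<^sub>R a) \<bullet> b = x \<bullet> b" using step(1) finB
        by (simp add: if_distrib cong: if_cong)
      then show ?case using step by (simp add: inner_add_right inner_diff_left)
    qed simp
  qed
  have "(\<Sum>b\<in>Basis. proj S b \<bullet> b) = (\<Sum>c\<in>B. \<Sum>b\<in>Basis. (b \<bullet> c) * (c \<bullet> b))"
    unfolding p by (simp add: inner_sum_left) (rule sum.swap)
  also have "\<dots> = (\<Sum>c\<in>B. c \<bullet> c)"
    by (rule sum.cong[OF refl]) (simp only: euclidean_inner[of c c for c] inner_commute[of b c for b c])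
  also have "\<dots> = real (dim S)" using B(5) by (simp add: inner)
  finally show ?thesis .
qed

end

text \<open>For k = 1 or k = -1 this is the eigenspace of \<open>w\<close> for k
  (\<open>Fix_iff\<close>). The condition is written with \<open>k *\<^sub>R w\<close> because the
  operator to be inverted is 1 - k w.\<close>

definition Fix :: "real \<Rightarrow> ('a::euclidean_space \<Rightarrow> 'a) \<Rightarrow> 'a set" where
  "Fix k w = {u. k *\<^sub>R w u = u}"

context
  fixes k :: real and w :: "'a::euclidean_space \<Rightarrow> 'a"
  assumes k: "k \<in> {1, - 1}" and w: "orthogonal_transformation w"
begin

lemma lin_w: "linear w" using w by (rule orthogonal_transformation_linear)

lemma subspace_Fix: "subspace (Fix k w)"
proof -
  have "k *\<^sub>R w (c *\<^sub>R u) = c *\<^sub>R (k *\<^sub>R w u)" for c u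
    by (simp add: linear_scale[OF lin_w] mult.commute)
  then have "k *\<^sub>R w (c *\<^sub>R u) = c *\<^sub>R u" if "k *\<^sub>R w u = u" for c u
    using that by metis
  then show ?thesis
    by (auto simp: subspace_def Fix_def linear_0[OF lin_w] linear_add[OF lin_w] scaleR_add_right)
qed

lemma Fix_iff: "u \<in> Fix k w \<longleftrightarrow> w u = k *\<^sub>R u"
  using k by (auto simp: Fix_def minus_equation_iff[of _ u] eq_commute[of u])

lemma proj_Fix: "k *\<^sub>R w (proj (Fix k w) u) = proj (Fix k w) u"
  using proj_in[OF subspace_Fix] by (auto simp: Fix_def)

lemma proj_Fix_w: "proj (Fix k w) (k *\<^sub>R w u) = proj (Fix k w) u"
proof (rule proj_unique[OF subspace_Fix proj_in[OF subspace_Fix]])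
  fix s assume s: "s \<in> Fix k w"
  have "(k *\<^sub>R w u) \<bullet> s = (k *\<^sub>R w u) \<bullet> (k *\<^sub>R w s)" using s by (simp add: Fix_def)
  also have "\<dots> = u \<bullet> s" using k w by (auto simp: orthogonal_transformation_def)
  finally show "(k *\<^sub>R w u - proj (Fix k w) u) \<bullet> s = 0"
    using proj_orth[OF subspace_Fix s, of u] by (simp add: inner_diff_left)
qed

text \<open>Identity on the eigenspace and 1 - k w on its orthogonal complement, hence invertible
  everywhere. Consequently \<open>untwist\<close> is the inverse of 1 - k w on the complement,
  extended by zero on the eigenspace.\<close>

definition "twist u = u - k *\<^sub>R w u + proj (Fix k w) u"

lemma linear_twist: "linear twist"
  unfolding twist_def[abs_def] using lin_w linear_proj[OF subspace_Fix]
  by (intro linear_compose_add linear_compose_sub linear_compose_scale_right linear_id[unfolded id_def])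

text \<open>The projection kills u - k w u. So a vector in the kernel has projection 0; then it
  satisfies k w u = u, lies in the eigenspace and equals its projection.\<close>

lemma bij_twist: "bij twist"
proof -
  have "inj twist"
    unfolding linear_injective_0[OF linear_twist]
  proof (intro allI impI)
    fix u assume 0: "twist u = 0"
    have "proj (Fix k w) (twist u) = proj (Fix k w) u"
      unfolding twist_def using proj_Fix_w[of u] linear_proj[OF subspace_Fix] proj_in[OF subspace_Fix, of u]
      by (simp add: linear_add linear_diff proj_id[OF subspace_Fix])
    then have pu: "proj (Fix k w) u = 0"
      using 0 linear_proj[OF subspace_Fix] by (simp add: linear_0)
    then have "u \<in> Fix k w" using 0 by (simp add: twist_def Fix_def)
    then show "u = 0" using pu proj_id[OF subspace_Fix] by simp
  qed
  then show ?thesis using linear_twist by (simp add: linear_injective_imp_surjective bij_def)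
qed

definition "untwist u = inv_into UNIV twist (u - proj (Fix k w) u)"

lemma linear_untwist: "linear untwist"
proof -
  have "linear (inv_into UNIV twist)"
    using linear_twist bij_twist by (simp add: linear_inj_imp_surj bij_is_inj inj_linear_imp_inv_linear)
  moreover have "linear (\<lambda>u. u - proj (Fix k w) u)"
    using linear_proj[OF subspace_Fix] by (intro linear_compose_sub linear_id[unfolded id_def])
  ultimately show ?thesis
    using linear_compose[of "\<lambda>u. u - proj (Fix k w) u" "inv_into UNIV twist"]
    by (simp add: untwist_def[abs_def] o_def)
qed

lemma proj_proj: "proj (Fix k w) (proj (Fix k w) u) = proj (Fix k w) u"
  by (rule proj_id[OF subspace_Fix proj_in[OF subspace_Fix]])

lemma untwist_twist: "untwist (u - k *\<^sub>R w u) = u - proj (Fix k w) u"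
proof -
  note lin = linear_diff[OF lin_w] linear_diff[OF linear_proj[OF subspace_Fix]]
  have "twist (u - proj (Fix k w) u) = u - k *\<^sub>R w u"
    unfolding twist_def lin by (simp add: proj_proj scaleR_diff_right proj_Fix)
  moreover have "(u - k *\<^sub>R w u) - proj (Fix k w) (u - k *\<^sub>R w u) = u - k *\<^sub>R w u"
    unfolding lin by (simp add: proj_Fix_w)
  ultimately show ?thesis unfolding untwist_def
    by (metis bij_twist bij_is_inj inv_f_f)
qed

lemma twist_untwist: "untwist u - k *\<^sub>R w (untwist u) = u - proj (Fix k w) u"
proof -
  note lin = linear_diff[OF lin_w] linear_diff[OF linear_proj[OF subspace_Fix]]
    linear_add[OF linear_proj[OF subspace_Fix]]
  have tw: "twist (untwist u) = u - proj (Fix k w) u"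
    unfolding untwist_def by (meson bij_twist bij_is_surj surj_f_inv_f)
  have "proj (Fix k w) (twist (untwist u)) = proj (Fix k w) (untwist u)"
    unfolding twist_def lin by (simp add: proj_Fix_w proj_proj)
  then have "proj (Fix k w) (untwist u) = 0" unfolding tw lin by (simp add: proj_proj)
  then show ?thesis using tw unfolding twist_def by simp
qed

end

lemma inv_g:
  assumes "orthogonal_transformation (g :: 'a::euclidean_space \<Rightarrow> 'a)"
  shows "inv_into UNIV g (g x) = x" "g (inv_into UNIV g x) = x"
  using assms by (auto simp: orthogonal_transformation_inj orthogonal_transformation_surj surj_f_inv_f)

context
  fixes k :: real and w g :: "'a::euclidean_space \<Rightarrow> 'a"
  assumes k: "k \<in> {1, - 1}" and w: "orthogonal_transformation w" and g: "orthogonal_transformation g"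
begin

lemma ot_conj: "orthogonal_transformation (g \<circ> w \<circ> inv_into UNIV g)"
  using w g by (intro orthogonal_transformation_compose orthogonal_transformation_inv)

lemma Fix_conj: "Fix k (g \<circ> w \<circ> inv_into UNIV g) = g ` Fix k w"
proof -
  have lg: "linear g" using g by (rule orthogonal_transformation_linear)
  have "u \<in> Fix k (g \<circ> w \<circ> inv_into UNIV g) \<longleftrightarrow> inv_into UNIV g u \<in> Fix k w" for u
  proof -
    have "k *\<^sub>R g (w (inv_into UNIV g u)) = u \<longleftrightarrow> g (k *\<^sub>R w (inv_into UNIV g u)) = g (inv_into UNIV g u)"
      by (simp add: linear_scale[OF lg] inv_g[OF g])
    also have "\<dots> \<longleftrightarrow> k *\<^sub>R w (inv_into UNIV g u) = inv_into UNIV g u"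
      using orthogonal_transformation_inj[OF g] by (simp add: inj_eq)
    finally show ?thesis by (simp add: Fix_def)
  qed
  then have iff: "u \<in> Fix k (g \<circ> w \<circ> inv_into UNIV g) \<longleftrightarrow> inv_into UNIV g u \<in> Fix k w" for u .
  show ?thesis
  proof (intro equalityI subsetI)
    fix u assume "u \<in> Fix k (g \<circ> w \<circ> inv_into UNIV g)"
    then show "u \<in> g ` Fix k w" using iff[of u] inv_g(2)[OF g, of u] by (metis imageI)
  next
    fix u assume "u \<in> g ` Fix k w"
    then obtain t where "t \<in> Fix k w" "u = g t" by blast
    then show "u \<in> Fix k (g \<circ> w \<circ> inv_into UNIV g)" using iff[of u] inv_g(1)[OF g, of t] by simp
  qed
qed

lemma proj_conj: "proj (Fix k (g \<circ> w \<circ> inv_into UNIV g)) (g u) = g (proj (Fix k w) u)"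
proof (rule proj_unique[OF subspace_Fix[OF k ot_conj]])
  show "g (proj (Fix k w) u) \<in> Fix k (g \<circ> w \<circ> inv_into UNIV g)"
    unfolding Fix_conj using proj_in[OF subspace_Fix[OF k w]] by auto
  fix s assume "s \<in> Fix k (g \<circ> w \<circ> inv_into UNIV g)"
  then obtain t where t: "t \<in> Fix k w" "s = g t" unfolding Fix_conj by auto
  have "g u - g (proj (Fix k w) u) = g (u - proj (Fix k w) u)"
    using g by (simp add: linear_diff orthogonal_transformation_linear)
  then have "(g u - g (proj (Fix k w) u)) \<bullet> s = (u - proj (Fix k w) u) \<bullet> t"
    using g t by (simp add: orthogonal_transformation_def)
  then show "(g u - g (proj (Fix k w) u)) \<bullet> s = 0"
    using proj_orth[OF subspace_Fix[OF k w] t(1)] by simp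
qed

lemma dim_Fix_conj: "dim (Fix k (g \<circ> w \<circ> inv_into UNIV g)) = dim (Fix k w)"
  unfolding Fix_conj using g
  by (intro dim_image_eq) (auto intro: orthogonal_transformation_linear orthogonal_transformation_inj inj_on_subset)

lemma untwist_conj: "untwist k (g \<circ> w \<circ> inv_into UNIV g) (g u) = g (untwist k w u)"
proof -
  let ?w = "g \<circ> w \<circ> inv_into UNIV g"
  note lg = orthogonal_transformation_linear[OF g]
  have "twist k ?w (g v) = g (twist k w v)" for v
    unfolding twist_def[OF k ot_conj] twist_def[OF k w] proj_conj
    by (simp add: linear_add[OF lg] linear_diff[OF lg] linear_scale[OF lg] inv_g[OF g])
  then have "inv_into UNIV (twist k ?w) (g v) = g (inv_into UNIV (twist k w) v)" for v
    by (metis bij_twist[OF k w] bij_twist[OF k ot_conj] bij_inv_eq_iff)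
  then show ?thesis
    unfolding untwist_def[OF k ot_conj] untwist_def[OF k w] proj_conj
      linear_diff[OF lg, symmetric] .
qed

end


section \<open>The effect of a reflection on the dimension of the eigenspace\<close>

lemma reflection_reflection: "reflection v (reflection v x) = x"
  by (cases "v = 0") (simp_all add: reflection_def inner_diff_left)

lemma orthogonal_reflection_commute:
  assumes "orthogonal_transformation g"
  shows "g (reflection v x) = reflection (g v) (g x)"
  using assms linear_diff[OF orthogonal_transformation_linear[OF assms]]
    linear_scale[OF orthogonal_transformation_linear[OF assms]]
  by (simp add: reflection_def orthogonal_transformation_def)

text \<open>If x is an eigenvector of the product, then w x is the reflection of k x. Comparing the
  inner product of x and u with that of w x and w u gives (x, v) (v, u) = 0, so x is orthogonal to v
  and already an eigenvector of \<open>w\<close>. The eigenspace thus shrinks, and it loses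
  \<open>u\<close>.\<close>

lemma Fix_reflection_strict:
  fixes v :: "real^'n"
  assumes k: "k \<in> {1, - 1}" and w: "orthogonal_transformation w"
    and u: "u \<in> Fix k w" "u \<bullet> v \<noteq> 0"
  shows "dim (Fix k (reflection v \<circ> w)) < dim (Fix k w)"
proof -
  have rw: "orthogonal_transformation (reflection v \<circ> w)"
    by (intro orthogonal_transformation_compose orthogonal_transformation_reflection w)
  have xv: "x \<bullet> v = 0 \<and> x \<in> Fix k w" if x: "x \<in> Fix k (reflection v \<circ> w)" for x
  proof -
    have "reflection v (w x) = k *\<^sub>R x" using x Fix_iff[OF k rw] by simp
    then have wx: "w x = reflection v (k *\<^sub>R x)" by (metis reflection_reflection)
    have wu: "w u = k *\<^sub>R u" using u(1) Fix_iff[OF k w] by simp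
    have "x \<bullet> u = w x \<bullet> w u" using w by (simp add: orthogonal_transformation_def)
    also have "\<dots> = (x - (2 * (x \<bullet> v) / (v \<bullet> v)) *\<^sub>R v) \<bullet> u"
      unfolding wx wu reflection_def using k by (auto simp: inner_diff_left)
    finally have "(x \<bullet> v) * (v \<bullet> u) / (v \<bullet> v) = 0" by (simp add: inner_diff_left)
    then have xv: "x \<bullet> v = 0" using u(2) by (auto simp: inner_commute)
    then have "w x = k *\<^sub>R x" unfolding wx by (simp add: reflection_def)
    then show ?thesis using xv Fix_iff[OF k w] by simp
  qed
  then have "Fix k (reflection v \<circ> w) \<subset> Fix k w" using u by auto
  then show ?thesis
    by (metis dim_psubset span_eq_iff subspace_Fix[OF k w] subspace_Fix[OF k rw])
qed

text \<open>On the hyperplane orthogonal to \<open>v\<close> the reflection does nothing, so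
  intersecting with it lands in the eigenspace of \<open>w\<close> and costs at most one
  dimension.\<close>

lemma Fix_reflection_le:
  fixes v :: "real^'n"
  assumes k: "k \<in> {1, - 1}" and w: "orthogonal_transformation w"
  shows "dim (Fix k (reflection v \<circ> w)) \<le> dim (Fix k w) + 1"
proof -
  let ?S = "Fix k (reflection v \<circ> w)" and ?H = "{x. v \<bullet> x = 0}"
  have rw: "orthogonal_transformation (reflection v \<circ> w)"
    by (intro orthogonal_transformation_compose orthogonal_transformation_reflection w)
  have H: "dim ?H \<ge> DIM(real^'n) - 1"
  proof (cases "v = 0")
    case False
    then show ?thesis using dim_hyperplane[of v] by simp
  qed simp
  have "?S \<inter> ?H \<subseteq> Fix k w"
  proof
    fix x assume x: "x \<in> ?S \<inter> ?H"
    then have "reflection v (w x) = k *\<^sub>R x" using Fix_iff[OF k rw] by simp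
    then have "w x = reflection v (k *\<^sub>R x)" by (metis reflection_reflection)
    then have "w x = k *\<^sub>R x" using x by (simp add: reflection_def inner_commute)
    then show "x \<in> Fix k w" using Fix_iff[OF k w] by simp
  qed
  then have le: "dim (?S \<inter> ?H) \<le> dim (Fix k w)" by (rule dim_subset)
  have "dim {x + y |x y. x \<in> ?S \<and> y \<in> ?H} + dim (?S \<inter> ?H) = dim ?S + dim ?H"
    by (rule dim_sums_Int[OF subspace_Fix[OF k rw] subspace_hyperplane])
  moreover have "dim {x + y |x y. x \<in> ?S \<and> y \<in> ?H} \<le> DIM(real^'n)" by (rule dim_subset_UNIV)
  ultimately show ?thesis using H le by linarith
qed

section \<open>The reflection group\<close>

locale reflection_group =
  fixes R :: "(real^'n) set"
  assumes R: "root_system R"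
begin

abbreviation W :: "(real^'n \<Rightarrow> real^'n) set" where
  "W \<equiv> carrier (coxeter_group R)"

lemma W_ops [simp]:
  "f \<otimes>\<^bsub>coxeter_group R\<^esub> g = f \<circ> g" "\<one>\<^bsub>coxeter_group R\<^esub> = id"
  by (simp_all add: coxeter_group_def orthogonal_group_def subgroup_generated_def)

lemma W_orth: "w \<in> W \<Longrightarrow> orthogonal_transformation w"
  using group.carrier_subgroup_generated_subset[OF group_orthogonal_group]
  by (force simp: coxeter_group_def orthogonal_group_def)

lemmas W_linear = orthogonal_transformation_linear[OF W_orth]

lemma W_inv_apply:
  assumes "w \<in> W"
  shows "inv_into UNIV w (w x) = x" "w (inv_into UNIV w x) = x"
  using inv_g[OF W_orth[OF assms]] by auto

interpretation W: group "coxeter_group R" by (rule group_coxeter_group)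

lemma W_id: "id \<in> W" and W_comp: "v \<in> W \<Longrightarrow> w \<in> W \<Longrightarrow> v \<circ> w \<in> W"
  using W.one_closed W.m_closed[of v w] by simp_all

lemma W_inv_eq: "w \<in> W \<Longrightarrow> inv\<^bsub>coxeter_group R\<^esub> w = inv_into UNIV w"
  using W.r_inv[of w] W_inv_apply[of w]
  by (simp add: fun_eq_iff) (metis)

lemma W_inv: "w \<in> W \<Longrightarrow> inv_into UNIV w \<in> W"
  using W.inv_closed[of w] by (simp add: W_inv_eq)

lemma W_inv_inv: "w \<in> W \<Longrightarrow> inv_into UNIV (inv_into UNIV w) = w"
  by (rule ext) (metis W_inv W_inv_apply)

lemma W_inv_comp:
  assumes "v \<in> W" "w \<in> W"
  shows "inv_into UNIV (v \<circ> w) = inv_into UNIV w \<circ> inv_into UNIV v"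
  by (rule ext) (metis W_comp W_inv_apply assms comp_apply)

lemma W_refl: "v \<in> R \<Longrightarrow> reflection v \<in> W"
  by (rule reflection_in_coxeter_group)

lemma R_props: "finite R" "0 \<notin> R" "v \<in> R \<Longrightarrow> reflection v ` R = R"
  using R by (auto simp: root_system_def)

lemma inv_reflection: "inv_into UNIV (reflection v) = reflection v"
  by (rule ext) (metis inv_g(1)[OF orthogonal_transformation_reflection] reflection_reflection)

text \<open>A reflection is its own inverse, so the closure under inverses in
  \<open>generate\<close> adds no case.\<close>

lemma W_induct [consumes 1, case_names id refl comp]:
  assumes "w \<in> W" "P id" "\<And>v. v \<in> R \<Longrightarrow> P (reflection v)"
    "\<And>f g. f \<in> W \<Longrightarrow> g \<in> W \<Longrightarrow> P f \<Longrightarrow> P g \<Longrightarrow> P (f \<circ> g)"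
  shows "P w"
proof -
  let ?G = "generate orthogonal_group (carrier orthogonal_group \<inter> reflection ` R)"
  have W: "W = ?G" by (simp add: coxeter_group_def carrier_subgroup_generated)
  interpret G: group orthogonal_group by (rule group_orthogonal_group)
  have inv: "inv\<^bsub>orthogonal_group\<^esub> (reflection v) = reflection v" for v :: "real^'n"
    by (rule G.inv_equality)
      (auto simp: orthogonal_group_def orthogonal_transformation_reflection fun_eq_iff reflection_reflection)
  have "w \<in> ?G" using assms(1) W by simp
  then have "w \<in> W \<and> P w"
  proof (induction rule: generate.induct)
    case one
    have "\<one>\<^bsub>orthogonal_group\<^esub> = (id :: real^'n \<Rightarrow> real^'n)" by (simp add: orthogonal_group_def)
    then show ?case using W_id assms(2) by metis
  next
    case (incl h)
    then show ?case using W_refl assms(3) by auto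
  next
    case (inv h)
    then show ?case using W_refl assms(3) \<open>\<And>v. inv\<^bsub>orthogonal_group\<^esub> (reflection v) = reflection v\<close>
      by auto
  next
    case (eng f g)
    have "f \<otimes>\<^bsub>orthogonal_group\<^esub> g = f \<circ> g" by (simp add: orthogonal_group_def)
    then show ?case using eng W_comp assms(4) by metis
  qed
  then show ?thesis by simp
qed

lemma W_R: "w \<in> W \<Longrightarrow> v \<in> R \<Longrightarrow> w v \<in> R"
proof (induction arbitrary: v rule: W_induct)
  case (refl u)
  then show ?case using R_props(3)[OF refl(1)] by blast
qed auto

lemma W_R_bij: "w \<in> W \<Longrightarrow> bij_betw w R R"
  using W_R W_inv W_inv_apply
  by (intro bij_betw_byWitness[where f' = "inv_into UNIV w"]) auto

lemma W_refl_comp: "w \<in> W \<Longrightarrow> w \<circ> reflection v = reflection (w v) \<circ> w"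
  by (rule ext) (simp add: orthogonal_reflection_commute W_orth)

lemma W_fixes_complement:
  assumes "w \<in> W" "\<And>v. v \<in> R \<Longrightarrow> x \<bullet> v = 0"
  shows "w x = x"
  using assms by (induction rule: W_induct) (auto simp: reflection_def)

text \<open>An element of \<open>W\<close> permutes the finite set \<open>R\<close> and fixes the
  orthogonal complement of its span pointwise, so its restriction to \<open>R\<close> determines
  it.\<close>

lemma finite_W: "finite W"
proof -
  have "inj_on (\<lambda>w. restrict w R) W"
  proof (rule inj_onI, rule ext)
    fix v w x assume vw: "v \<in> W" "w \<in> W" and eq: "restrict v R = restrict w R"
    obtain y z where y: "y \<in> span R" and z: "\<And>u. u \<in> span R \<Longrightarrow> orthogonal z u" and x: "x = y + z"
      using orthogonal_subspace_decomp_exists[of R x] by metis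
    have "v y = w y"
      using y
    proof (rule linear_eq_on[OF W_linear[OF vw(1)] W_linear[OF vw(2)]])
      show "v u = w u" if "u \<in> R" for u using eq that by (metis restrict_apply')
    qed
    moreover have "z \<bullet> u = 0" if "u \<in> R" for u using z[of u] that by (simp add: span_base orthogonal_def)
    ultimately show "v x = w x"
      using vw by (simp add: x linear_add[OF W_linear] W_fixes_complement)
  qed
  moreover have "(\<lambda>w. restrict w R) ` W \<subseteq> R \<rightarrow>\<^sub>E R" using W_R by auto
  moreover have "finite (R \<rightarrow>\<^sub>E R)" using R_props(1) by (intro finite_PiE) auto
  ultimately show ?thesis by (metis inj_on_finite)
qed

end

section \<open>The polynomial bimodule\<close>

lemma sum_fun_apply: "(\<Sum>i\<in>I. f i) x = (\<Sum>i\<in>I. f i x)"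
  by (induction I rule: infinite_finite_induct) auto

definition scale :: "'k::comm_ring_1 \<Rightarrow> ('w \<Rightarrow> ('a, 'k) mpol) \<Rightarrow> 'w \<Rightarrow> ('a, 'k) mpol" where
  "scale c f = (\<lambda>w. Cst c * f w)"

definition linear_op :: "(('w \<Rightarrow> ('a, 'k::comm_ring_1) mpol) \<Rightarrow> ('v \<Rightarrow> ('b, 'k) mpol)) \<Rightarrow> bool" where
  "linear_op K \<longleftrightarrow> (\<forall>f g. K (f + g) = K f + K g) \<and> (\<forall>c f. K (scale c f) = scale c (K f))"

lemma scale_simps:
  "scale 0 f = 0" "scale 1 f = f" "scale c 0 = 0" "scale (- c) f = - scale c f"
  "scale c (f + g) = scale c f + scale c g" "scale c (f - g) = scale c f - scale c g"
  "scale (c + d) f = scale c f + scale d f" "scale c (scale d f) = scale (c * d) f"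
  "scale c (- f) = - scale c f"
  by (auto simp: scale_def fun_eq_iff Cst_simps algebra_simps)

lemma scale_sum: "scale c (sum f I) = (\<Sum>i\<in>I. scale c (f i))"
  by (simp add: fun_eq_iff scale_def sum_fun_apply sum_distrib_left)

lemma scale_sum_left: "scale (sum c I) f = (\<Sum>i\<in>I. scale (c i) f)"
  by (simp add: fun_eq_iff scale_def sum_fun_apply sum_distrib_right Cst_sum)

lemma linear_opD:
  assumes "linear_op K"
  shows "K (f + g) = K f + K g" "K (scale c f) = scale c (K f)" "K 0 = 0" "K (- f) = - K f"
    "K (f - g) = K f - K g" "K (sum F I) = (\<Sum>i\<in>I. K (F i))"
proof -
  show add: "K (f + g) = K f + K g" and sc: "K (scale c f) = scale c (K f)" for f g c
    using assms by (auto simp: linear_op_def)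
  show 0: "K 0 = 0" using sc[of 0 0] by (simp add: scale_simps)
  show neg: "K (- f) = - K f" for f using sc[of "- 1" f] by (simp add: scale_simps)
  show "K (f - g) = K f - K g" using add[of f "- g"] neg[of g] by simp
  show "K (sum F I) = (\<Sum>i\<in>I. K (F i))"
    using sum_comp_morphism[of K F I] by (simp add: 0 add o_def)
qed

lemma linear_opI:
  "(\<And>f g. K (f + g) = K f + K g) \<Longrightarrow> (\<And>c f. K (scale c f) = scale c (K f)) \<Longrightarrow> linear_op K"
  by (auto simp: linear_op_def)

lemma linear_op_compose: "linear_op K \<Longrightarrow> linear_op L \<Longrightarrow> linear_op (\<lambda>f. K (L f))"
  and linear_op_diff: "linear_op K \<Longrightarrow> linear_op L' \<Longrightarrow> linear_op (\<lambda>f. K f - L' f)"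
  and linear_op_scale: "linear_op K \<Longrightarrow> linear_op (\<lambda>f. scale c (K f))"
  and linear_op_id: "linear_op (\<lambda>f. f)"
  by (auto simp: linear_op_def scale_simps mult.commute)

lemma linear_op_sum: "(\<And>i. i \<in> I \<Longrightarrow> linear_op (K i)) \<Longrightarrow> linear_op (\<lambda>f. \<Sum>i\<in>I. K i f)"
  by (auto simp: linear_op_def sum.distrib scale_sum)

definition dl :: "'w \<Rightarrow> ('a, 'k::comm_ring_1) mpol \<Rightarrow> 'w \<Rightarrow> ('a, 'k) mpol" where
  "dl w F = (\<lambda>w'. if w' = w then F else 0)"

lemma dl_simps: "dl w (F + G) = dl w F + dl w G" "dl w (Cst c * F) = scale c (dl w F)" "dl w 0 = 0"
  "dl w (F - G) = dl w F - dl w G" "dl w (- F) = - dl w F"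
  by (auto simp: dl_def fun_eq_iff scale_def)

lemma dl_sum: "dl w (sum F I) = (\<Sum>i\<in>I. dl w (F i))"
  by (simp add: fun_eq_iff dl_def sum_fun_apply)

text \<open>The coefficient ring and \<open>s\<close> are left open because the development is used
  twice: over the complex numbers with s = 1, where the bimodule describes the superalgebra itself,
  and over complex polynomials with s the variable, where the functionals are constructed.\<close>

locale calogero = reflection_group R for R :: "(real^'n) set" +
  fixes \<nu> :: "real^'n \<Rightarrow> complex" and \<iota> :: "complex \<Rightarrow> 'k::comm_ring_1" and s :: 'k
  assumes \<nu>: "root_constants R \<nu>" and \<iota>: "ring_map \<iota>"
begin

section \<open>Linear forms, linear substitutions and difference quotients along roots\<close>

definition ir :: "real \<Rightarrow> 'k" where "ir c = \<iota> (complex_of_real c)"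

lemma ir_simps: "ir 0 = 0" "ir 1 = 1" "ir (a + b) = ir a + ir b" "ir (a * b) = ir a * ir b"
  "ir (- a) = - ir a" "ir (a - b) = ir a - ir b"
  by (simp_all add: ir_def ring_mapD[OF \<iota>])

lemma ir_sum: "ir (sum f I) = (\<Sum>i\<in>I. ir (f i))"
  by (simp add: ir_def ring_mapD[OF \<iota>])

definition lin :: "bool \<Rightarrow> real^'n \<Rightarrow> (bool \<times> 'n, 'k) mpol" where
  "lin b u = (\<Sum>i\<in>UNIV. Cst (ir (u $ i)) * X (b, i))"

definition dir :: "bool \<Rightarrow> real^'n \<Rightarrow> bool \<times> 'n \<Rightarrow> 'k" where
  "dir b u = (\<lambda>(c, i). if c = b then ir (u $ i) else 0)"

definition act_var :: "bool \<Rightarrow> (real^'n \<Rightarrow> real^'n) \<Rightarrow> bool \<times> 'n \<Rightarrow> (bool \<times> 'n, 'k) mpol" where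
  "act_var b g = (\<lambda>(c, i). if c = b then lin b (g (axis i 1)) else X (c, i))"

definition act :: "bool \<Rightarrow> (real^'n \<Rightarrow> real^'n) \<Rightarrow> (bool \<times> 'n, 'k) mpol \<Rightarrow> (bool \<times> 'n, 'k) mpol" where
  "act b g = sub (act_var b g)"

text \<open>By \<open>tr_DD\<close> the shift belonging to this direction and amount is the
  reflection in \<open>v\<close>. So for a root \<open>v\<close>, \<open>lin b v * DD b v F\<close>
  is half of (v, v) times the difference of \<open>F\<close> and its reflection: the difference
  quotient of a Dunkl operator, obtained without dividing polynomials.\<close>

definition DD :: "bool \<Rightarrow> real^'n \<Rightarrow> (bool \<times> 'n, 'k) mpol \<Rightarrow> (bool \<times> 'n, 'k) mpol" where
  "DD b v = dd (dir b v) (Cst (ir (- 2 / (v \<bullet> v))) * lin b v)"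

definition cc :: "real^'n \<Rightarrow> 'k" where
  "cc v = s * \<iota> (\<nu> v / complex_of_real (v \<bullet> v))"

lemma lin_simps: "lin b (u + v) = lin b u + lin b v" "lin b (c *\<^sub>R u) = Cst (ir c) * lin b u"
  "lin b 0 = 0" "lin b (u - v) = lin b u - lin b v" "lin b (- u) = - lin b u"
  by (auto simp: lin_def ir_simps Cst_simps algebra_simps sum.distrib sum_distrib_left sum_subtractf sum_negf)

lemma lin_axis: "lin b (axis i 1) = X (b, i)"
proof -
  have "lin b (axis i 1) = (\<Sum>j\<in>UNIV. if j = i then X (b, i) else 0)"
    unfolding lin_def by (rule sum.cong) (auto simp: axis_def ir_simps Cst_simps)
  then show ?thesis by simp
qed

lemma linear_form_lin: "linear_form (lin b u)"
proof -
  have "lin b u = (\<Sum>a\<in>Pair b ` UNIV. Cst (ir (u $ snd a)) * X a)"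
    unfolding lin_def by (subst sum.reindex) (auto simp: inj_on_def)
  then show ?thesis unfolding linear_form_def by (intro exI)
qed

lemma vec_expand: "u = (\<Sum>i\<in>UNIV. u $ i *\<^sub>R axis i (1::real))"
  using basis_expansion[of u] by (simp add: scalar_mult_eq_scaleR)

lemma linear_expand: "linear g \<Longrightarrow> g u = (\<Sum>i\<in>UNIV. u $ i *\<^sub>R g (axis i (1::real)))"
  for u :: "real^'m" and g :: "real^'m \<Rightarrow> real^'l"
  by (subst vec_expand[of u]) (simp add: linear_sum linear_scale)

lemma lin_sum: "lin b (sum u I) = (\<Sum>i\<in>I. lin b (u i))"
  by (induction I rule: infinite_finite_induct) (auto simp: lin_simps)

lemmas act_simps = sub_simps[of "act_var b g" for b g, folded act_def]

lemma act_Cst [simp]: "act b g (Cst c) = Cst c"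
  by (simp add: act_def)

lemma act_var_apply: "act_var b g (c, i) = (if c = b then lin b (g (axis i 1)) else X (c, i))"
  by (simp add: act_var_def)

lemma dir_apply: "dir b u (c, i) = (if c = b then ir (u $ i) else 0)"
  by (simp add: dir_def)

lemma act_X: "act b g (X (c, i)) = (if c = b then lin b (g (axis i 1)) else X (c, i))"
  by (simp add: act_def act_var_def)

lemma act_lin:
  assumes "linear g"
  shows "act b g (lin c u) = lin c (if c = b then g u else u)"
proof -
  have *: "act b g (lin c u) = (\<Sum>i\<in>UNIV. Cst (ir (u $ i)) * act b g (X (c, i)))"
    by (simp add: lin_def act_simps)
  show ?thesis
  proof (cases "c = b")
    case True
    have "lin b (g u) = (\<Sum>i\<in>UNIV. Cst (ir (u $ i)) * lin b (g (axis i 1)))"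
      by (subst linear_expand[OF assms]) (simp add: lin_sum lin_simps)
    then show ?thesis unfolding * using True by (simp add: act_X)
  next
    case False
    then show ?thesis unfolding * by (simp add: act_X) (simp add: lin_def)
  qed
qed

lemma act_act_var: "act b g (act c h f) = sub (\<lambda>a. act b g (act_var c h a)) f"
  by (simp add: act_def sub_sub)

lemma act_act:
  assumes "linear g"
  shows "act b g (act b h f) = act b (g \<circ> h) f"
proof -
  have "act b g (act_var b h a) = act_var b (g \<circ> h) a" for a
    by (cases a) (simp add: act_var_apply act_lin[OF assms] act_X)
  then show ?thesis unfolding act_act_var by (simp add: act_def)
qed

lemma act_act_commute:
  assumes "linear g" "linear h"
  shows "act b g (act (\<not> b) h f) = act (\<not> b) h (act b g f)"
proof -
  have "act b g (act_var (\<not> b) h a) = act (\<not> b) h (act_var b g a)" for a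
    by (cases a) (simp add: act_var_apply act_lin[OF assms(1)] act_lin[OF assms(2)] act_X)
  then show ?thesis unfolding act_act_var by simp
qed

lemma act_id: "act b id f = f"
proof -
  have "act_var b (\<lambda>x. x) = X" by (auto simp: act_var_def fun_eq_iff lin_axis)
  then show ?thesis by (simp add: act_def sub_id id_def)
qed

lemma dd_lin: "dd (dir b u) V (lin c x) = (if b = c then Cst (ir (u \<bullet> x)) else 0)"
proof -
  have "dd (dir b u) V (lin c x) = (\<Sum>i\<in>UNIV. Cst (ir (x $ i)) * Cst (dir b u (c, i)))"
    by (simp add: lin_def dd_sum dd_Cst_mult)
  then show ?thesis
    by (simp add: dir_apply inner_vec_def ir_sum Cst_sum ir_simps Cst_simps mult.commute)
qed

lemma tr_DD: "tr (dir b v) (Cst (ir (- 2 / (v \<bullet> v))) * lin b v) = act b (reflection v)"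
  unfolding tr_def act_def
proof (rule arg_cong[where f = sub], rule ext)
  fix a :: "bool \<times> 'n"
  obtain c i where a: "a = (c, i)" by (cases a)
  have "reflection v (axis i 1) = axis i 1 + (v $ i) *\<^sub>R ((- 2 / (v \<bullet> v)) *\<^sub>R v)"
    by (simp add: reflection_def inner_axis' scaleR_scaleR[symmetric] del: scaleR_scaleR) (simp add: algebra_simps)
  then show "X a + Cst (dir b v a) * (Cst (ir (- 2 / (v \<bullet> v))) * lin b v) = act_var b (reflection v) a"
    by (simp only: a act_var_def dir_def prod.case lin_simps lin_axis) (auto simp: Cst_simps lin_axis)
qed

lemma DD_mult: "DD b v (f * g) = f * DD b v g + DD b v f * act b (reflection v) g"
  unfolding DD_def dd_mult tr_DD ..

lemma DD_lin: "DD b v (lin c x) = (if b = c then Cst (ir (v \<bullet> x)) else 0)"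
  by (simp add: DD_def dd_lin)

lemma DD_simps: "DD b v (f + g) = DD b v f + DD b v g" "DD b v 0 = 0" "DD b v (Cst c * f) = Cst c * DD b v f"
  "DD b v (sum F I) = (\<Sum>i\<in>I. DD b v (F i))" "DD b v (f - g) = DD b v f - DD b v g" "DD b v (- f) = - DD b v f"
  by (simp_all add: DD_def dd_add dd_Cst_mult dd_sum dd_diff dd_uminus)

lemma pd_pd_commute: "pd z (pd z' f) = pd z' (pd z f)"
  by (rule dd_dd_commute) simp_all

lemma act_DD:
  assumes g: "orthogonal_transformation g"
  shows "act b g (DD b v f) = DD b (g v) (act b g f)"
  unfolding DD_def act_def
proof (rule sub_dd)
  have gg: "g x \<bullet> g y = x \<bullet> y" for x y using g by (simp add: orthogonal_transformation_def)
  show "sub (act_var b g) (Cst (ir (- 2 / (v \<bullet> v))) * lin b v) = Cst (ir (- 2 / (g v \<bullet> g v))) * lin b (g v)"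
    using act_lin[OF orthogonal_transformation_linear[OF g], of b b v]
    by (simp add: act_def[symmetric] act_simps gg)
  show "dd (dir b (g v)) (Cst (ir (- 2 / (g v \<bullet> g v))) * lin b (g v)) (act_var b g a) = Cst (dir b v a)" for a
    by (cases a) (simp add: act_var_apply dd_lin dir_apply gg inner_axis Cst_simps)
qed

lemma act_pd:
  assumes g: "orthogonal_transformation g"
  shows "act b g (pd (dir b v) f) = pd (dir b (g v)) (act b g f)"
  unfolding act_def
proof (rule sub_dd)
  show "pd (dir b (g v)) (act_var b g a) = Cst (dir b v a)" for a
    using g by (cases a) (simp add: act_var_apply dd_lin dir_apply orthogonal_transformation_def inner_axis Cst_simps)
qed (simp add: sub_simps)

lemma act_DD_other:
  assumes "linear g"
  shows "act b g (DD (\<not> b) v f) = DD (\<not> b) v (act b g f)"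
  unfolding DD_def act_def
proof (rule sub_dd)
  show "sub (act_var b g) (Cst (ir (- 2 / (v \<bullet> v))) * lin (\<not> b) v) = Cst (ir (- 2 / (v \<bullet> v))) * lin (\<not> b) v"
    using act_lin[OF assms, of b "\<not> b" v] by (simp add: act_def[symmetric] act_simps)
  show "dd (dir (\<not> b) v) (Cst (ir (- 2 / (v \<bullet> v))) * lin (\<not> b) v) (act_var b g a) = Cst (dir (\<not> b) v a)" for a
    by (cases a) (auto simp: act_var_apply dd_lin dir_apply Cst_simps)
qed

lemma act_pd_other: "act b g (pd (dir (\<not> b) v) f) = pd (dir (\<not> b) v) (act b g f)"
  unfolding act_def
proof (rule sub_dd)
  show "pd (dir (\<not> b) v) (act_var b g a) = Cst (dir (\<not> b) v a)" for a
    by (cases a) (auto simp: act_var_apply dd_lin dir_apply Cst_simps)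
qed (simp add: sub_simps)

text \<open>The reflections in v and g v are conjugate, so the hypothesis on \<nu> applies. This
  makes the reflection sums of the Dunkl operators equivariant under \<open>W\<close>.\<close>

lemma cc_W:
  assumes "g \<in> W" "v \<in> R"
  shows "cc (g v) = cc v"
proof -
  have "reflection (g v) = g \<circ> reflection v \<circ> inv_into UNIV g"
    by (rule ext) (simp add: orthogonal_reflection_commute[OF W_orth[OF assms(1)]] W_inv_apply[OF assms(1)])
  then have "conjugate_in (coxeter_group R) (reflection v) (reflection (g v))"
    unfolding conjugate_in_def using assms by (auto simp: W_inv_eq)
  then have "\<nu> v = \<nu> (g v)" using \<nu> assms W_R by (auto simp: root_constants_def)
  moreover have "g v \<bullet> g v = v \<bullet> v" using W_orth[OF assms(1)] by (simp add: orthogonal_transformation_def)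
  ultimately show ?thesis by (simp add: cc_def)
qed

text \<open>A function \<open>f\<close> on \<open>W\<close> with polynomial values stands for the element
  \<open>\<Sum>w. P\<^sub>w w Q\<^sub>w\<close> of the superalgebra, where \<open>f w = P\<^sub>w Q\<^sub>w\<close> with \<open>P\<^sub>w\<close> in the \<open>a\<^sub>1\<^sub>i = X (True, i)\<close> and
  \<open>Q\<^sub>w\<close> in the \<open>a\<^sub>0\<^sub>i = X (False, i)\<close>. Then \<open>mul True\<close>, \<open>sh True\<close>, \<open>dun True\<close> are the
  multiplications from the left by \<open>u\<^sub>1\<close>, \<open>g\<close>, \<open>u\<^sub>0\<close>, and \<open>mul False\<close>, \<open>sh False\<close>, \<open>dun False\<close>
  those from the right by \<open>u\<^sub>0\<close>, \<open>g\<^sup>-\<^sup>1\<close>, \<open>u\<^sub>1\<close>; \<open>dun\<close> is a Dunkl operator.\<close>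

definition Ms :: "((real^'n \<Rightarrow> real^'n) \<Rightarrow> (bool \<times> 'n, 'k) mpol) set" where
  "Ms = {f. \<forall>w. w \<notin> W \<longrightarrow> f w = 0}"

text \<open>The component that is moved to w: left multiplication by g takes the one at
  \<open>inv_into UNIV g \<circ> w\<close> there, and right multiplication by the inverse of g the
  one at \<open>w \<circ> g\<close>.\<close>

definition trn :: "bool \<Rightarrow> (real^'n \<Rightarrow> real^'n) \<Rightarrow> (real^'n \<Rightarrow> real^'n) \<Rightarrow> real^'n \<Rightarrow> real^'n" where
  "trn b g w = (if b then inv_into UNIV g \<circ> w else w \<circ> g)"

text \<open>The vector after it has been moved past w to its proper side: \<open>u\<^sub>0\<close>
  from the left becomes the image under the inverse of w, to the right of w, and
  \<open>u\<^sub>1\<close> from the right becomes the image under w, to the left of w.\<close>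

definition tw :: "bool \<Rightarrow> (real^'n \<Rightarrow> real^'n) \<Rightarrow> real^'n \<Rightarrow> real^'n" where
  "tw b w u = (if b then inv_into UNIV w u else w u)"

definition mul where
  "mul b u f = (\<lambda>w::real^'n \<Rightarrow> real^'n. lin b u * f w)"

definition sh where
  "sh b g f = (\<lambda>w. act b g (f (trn b g w)))"

definition dun where
  "dun b u f = (\<lambda>w. lin (\<not> b) (tw b w u) * f w + pd (dir b u) (f w) +
     (\<Sum>v\<in>R. Cst (cc v * ir (u \<bullet> v)) * DD b v (f (trn b (reflection v) w))))"

lemma Ms_eqI: "f \<in> Ms \<Longrightarrow> g \<in> Ms \<Longrightarrow> (\<And>w. w \<in> W \<Longrightarrow> f w = g w) \<Longrightarrow> f = g"
  unfolding Ms_def by (rule ext) (case_tac "x \<in> W"; simp)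

lemma trn_W: "g \<in> W \<Longrightarrow> trn b g w \<in> W \<longleftrightarrow> w \<in> W"
proof -
  assume g: "g \<in> W"
  have "g \<circ> (inv_into UNIV g \<circ> w) = w" "(w \<circ> g) \<circ> inv_into UNIV g = w"
    using W_inv_apply[OF g] by (auto simp: fun_eq_iff)
  then show ?thesis unfolding trn_def using g by (auto intro: W_comp W_inv) (metis W_comp W_inv)+
qed

lemma Ms_simps: "0 \<in> Ms" "f \<in> Ms \<Longrightarrow> g \<in> Ms \<Longrightarrow> f + g \<in> Ms" "f \<in> Ms \<Longrightarrow> scale c f \<in> Ms"
  "f \<in> Ms \<Longrightarrow> g \<in> Ms \<Longrightarrow> f - g \<in> Ms" "f \<in> Ms \<Longrightarrow> - f \<in> Ms" "w \<in> W \<Longrightarrow> dl w F \<in> Ms"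
  by (auto simp: Ms_def scale_def dl_def)

lemma Ms_sum: "(\<And>i. i \<in> I \<Longrightarrow> f i \<in> Ms) \<Longrightarrow> sum f I \<in> Ms"
  by (simp add: Ms_def sum_fun_apply)

lemma mul_Ms: "f \<in> Ms \<Longrightarrow> mul b u f \<in> Ms"
  by (auto simp: Ms_def mul_def)

lemma sh_Ms: "g \<in> W \<Longrightarrow> f \<in> Ms \<Longrightarrow> sh b g f \<in> Ms"
  by (auto simp: Ms_def sh_def trn_W act_simps)

lemma dun_Ms: "f \<in> Ms \<Longrightarrow> dun b u f \<in> Ms"
  by (auto simp: Ms_def dun_def trn_W W_refl DD_simps)

lemma Ms_expand: "f \<in> Ms \<Longrightarrow> f = (\<Sum>w\<in>W. dl w (f w))"
  by (rule Ms_eqI, assumption, rule Ms_sum, erule Ms_simps(6))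
    (simp add: sum_fun_apply dl_def finite_W)

lemma Ms_induct [consumes 1, case_names zero dl add]:
  assumes f: "f \<in> Ms" and 0: "P 0" and dl: "\<And>w F. w \<in> W \<Longrightarrow> P (dl w F)"
    and add: "\<And>f g. f \<in> Ms \<Longrightarrow> g \<in> Ms \<Longrightarrow> P f \<Longrightarrow> P g \<Longrightarrow> P (f + g)"
  shows "P f"
proof -
  have "A \<subseteq> W \<longrightarrow> P (\<Sum>w\<in>A. dl w (f w)) \<and> (\<Sum>w\<in>A. dl w (f w)) \<in> Ms" if "finite A" for A
    using that
  proof (induction A rule: finite_induct)
    case empty
    show ?case unfolding sum.empty using 0 Ms_simps(1) by blast
  next
    case (insert w A)
    show ?case unfolding sum.insert[OF insert(1,2)]
      using insert(3) dl[of w "f w"] Ms_simps(6)[of w "f w"] add Ms_simps(2) by blast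
  qed
  then have "P (\<Sum>w\<in>W. dl w (f w))" using finite_W by blast
  then show ?thesis by (simp only: Ms_expand[OF f, symmetric])
qed

lemma linear_mul: "linear_op (mul b u)"
  by (rule linear_opI) (auto simp: mul_def scale_def fun_eq_iff algebra_simps)

lemma linear_sh: "linear_op (sh b g)"
  by (rule linear_opI) (auto simp: sh_def scale_def fun_eq_iff act_simps)

lemma linear_dun: "linear_op (dun b u)"
proof (rule linear_opI)
  show "dun b u (f + g) = dun b u f + dun b u g" for f g
    by (simp add: dun_def fun_eq_iff DD_simps dd_add distrib_left sum.distrib add_ac)
  have *: "A * (Cst c * B) = Cst c * (A * B)" for A B :: "(bool \<times> 'n, 'k) mpol" and c
    by (rule mult.left_commute)
  show "dun b u (scale c f) = scale c (dun b u f)" for f c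
    by (simp only: dun_def scale_def fun_eq_iff DD_simps dd_Cst_mult distrib_left sum_distrib_left *[of _ c]) simp
qed

lemma mul_dir: "mul b (u + v) f = mul b u f + mul b v f" "mul b (c *\<^sub>R u) f = scale (ir c) (mul b u f)"
  by (auto simp: mul_def scale_def fun_eq_iff lin_simps algebra_simps)

lemma dir_simps: "dir b (u + v) = (\<lambda>a. dir b u a + dir b v a)" "dir b (c *\<^sub>R u) = (\<lambda>a. ir c * dir b u a)"
  by (auto simp: dir_def fun_eq_iff ir_simps)

lemma dun_dir_scale: "dun b (c *\<^sub>R u) f = scale (ir c) (dun b u f)" if "f \<in> Ms"
proof (rule Ms_eqI)
  fix w assume w: "w \<in> W"
  have tw: "tw b w (c *\<^sub>R u) = c *\<^sub>R tw b w u"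
    using W_linear[OF w] W_linear[OF W_inv[OF w]] by (simp add: tw_def linear_scale)
  show "dun b (c *\<^sub>R u) f w = scale (ir c) (dun b u f) w"
    by (simp add: dun_def scale_def tw lin_simps dir_simps pd_dir_scale ir_simps Cst_simps
      distrib_left sum_distrib_left mult_ac)
qed (auto intro: dun_Ms Ms_simps that)

lemma dun_dir_add: "dun b (u + v) f = dun b u f + dun b v f" if "f \<in> Ms"
proof (rule Ms_eqI)
  fix w assume w: "w \<in> W"
  have tw: "tw b w (u + v) = tw b w u + tw b w v"
    using W_linear[OF w] W_linear[OF W_inv[OF w]] by (simp add: tw_def linear_add)
  show "dun b (u + v) f w = (dun b u f + dun b v f) w"
    by (simp add: dun_def tw lin_simps dir_simps pd_dir_add ir_simps Cst_simps
      distrib_left distrib_right sum.distrib inner_add_left)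
qed (auto intro: dun_Ms Ms_simps that)

lemma mul_mul: "mul b u (mul c v f) = mul c v (mul b u f)"
  by (auto simp: mul_def mult_ac)

lemma sh_mul:
  "g \<in> W \<Longrightarrow> sh b g (mul b u f) = mul b (g u) (sh b g f)"
  "g \<in> W \<Longrightarrow> sh b g (mul (\<not> b) u f) = mul (\<not> b) u (sh b g f)"
  by (auto simp: sh_def mul_def act_simps act_lin W_linear)

lemma sh_sh:
  assumes "g \<in> W" "h \<in> W"
  shows "sh b g (sh b h f) = sh b (g \<circ> h) f" "sh b g (sh (\<not> b) h f) = sh (\<not> b) h (sh b g f)"
  using assms
  by (auto simp: sh_def act_act act_act_commute W_linear trn_def W_inv_comp o_assoc)

lemma sh_id: "sh b id f = f"
  by (auto simp: sh_def act_id trn_def)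

lemma sh_dun:
  assumes g: "g \<in> W" and f: "f \<in> Ms"
  shows "sh b g (dun b u f) = dun b (g u) (sh b g f)"
proof (rule Ms_eqI)
  fix w assume w: "w \<in> W"
  note og = W_orth[OF g]
  have tw: "tw b (trn b g w) u = tw b w (g u)"
    using W_inv_comp[OF W_inv[OF g] w] W_inv_inv[OF g] by (auto simp: tw_def trn_def)
  have refl: "trn b (reflection v) (trn b g w) = trn b g (trn b (reflection (g v)) w)" for v
    by (auto simp: trn_def inv_reflection fun_eq_iff)
      (metis W_inv_apply[OF g] orthogonal_reflection_commute[OF og], simp add: orthogonal_reflection_commute[OF og])
  have "(\<Sum>v\<in>R. Cst (cc v * ir (u \<bullet> v)) * DD b (g v) (act b g (f (trn b (reflection v) (trn b g w))))) =
      (\<Sum>v\<in>R. Cst (cc (g v) * ir (g u \<bullet> g v)) * DD b (g v) (act b g (f (trn b g (trn b (reflection (g v)) w)))))"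
    by (rule sum.cong) (use og in \<open>auto simp: refl cc_W[OF g] orthogonal_transformation_def\<close>)
  also have "\<dots> = (\<Sum>v\<in>R. Cst (cc v * ir (g u \<bullet> v)) * DD b v (act b g (f (trn b g (trn b (reflection v) w)))))"
    by (rule sum.reindex_bij_betw[OF W_R_bij[OF g]])
  finally show "sh b g (dun b u f) w = dun b (g u) (sh b g f) w"
    by (simp add: sh_def dun_def act_simps act_lin W_linear[OF g] tw act_pd[OF og] act_DD[OF og])
qed (auto intro: dun_Ms sh_Ms g f)

lemma sh_dun_other:
  assumes g: "g \<in> W" and f: "f \<in> Ms"
  shows "sh b g (dun (\<not> b) u f) = dun (\<not> b) u (sh b g f)"
proof (rule Ms_eqI)
  fix w assume w: "w \<in> W"
  have tw: "g (tw (\<not> b) (trn b g w) u) = tw (\<not> b) w u"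
    using W_inv_comp[OF w g] W_inv_apply[OF g] by (auto simp: tw_def trn_def)
  have refl: "trn (\<not> b) (reflection v) (trn b g w) = trn b g (trn (\<not> b) (reflection v) w)" for v
    by (auto simp: trn_def inv_reflection fun_eq_iff)
  show "sh b g (dun (\<not> b) u f) w = dun (\<not> b) u (sh b g f) w"
    by (simp add: sh_def dun_def act_simps act_lin W_linear[OF g] tw act_pd_other act_DD_other refl)
qed (auto intro: dun_Ms sh_Ms g f)

lemma dun_mul_other: "f \<in> Ms \<Longrightarrow> dun b u (mul (\<not> b) x f) = mul (\<not> b) x (dun b u f)"
  by (rule ext) (simp add: dun_def mul_def dd_mult dd_lin DD_mult DD_lin algebra_simps sum_distrib_left)

lemma act_sh: "act b (reflection v) (f (trn b (reflection v) w)) = sh b (reflection v) f w"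
  by (simp add: sh_def)

text \<open>The defining commutator of the superalgebra, realised on the bimodule with s \<nu> in
  place of \<nu>: for \<open>b = True\<close> it is the bracket of \<open>u\<^sub>0\<close> and
  \<open>x\<^sub>1\<close> acting from the left, for \<open>b = False\<close> that of
  \<open>x\<^sub>0\<close> and \<open>u\<^sub>1\<close> acting from the right.\<close>

lemma dun_mul:
  "dun b u (mul b x f) = mul b x (dun b u f) + scale (ir (u \<bullet> x)) f
     + (\<Sum>v\<in>R. scale (cc v * ir (u \<bullet> v) * ir (v \<bullet> x)) (sh b (reflection v) f))"
  by (rule ext)
    (simp add: dun_def mul_def dd_mult dd_lin DD_mult DD_lin act_sh scale_def sum_fun_apply
      Cst_simps sum_distrib_left sum.distrib algebra_simps)

text \<open>Multiplications generate the bimodule from the group elements. Commutators of Dunkl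
  operators are shown to vanish in this way, without expanding them on a general polynomial.\<close>

lemma Ms_vanishI:
  assumes K: "linear_op K" and mul: "\<And>b u f. f \<in> Ms \<Longrightarrow> K (mul b u f) = mul b u (K f)"
    and 1: "\<And>w. w \<in> W \<Longrightarrow> K (dl w 1) = 0" and f: "f \<in> Ms"
  shows "K f = 0"
proof -
  have "K (dl w F) = 0" if w: "w \<in> W" for w F
  proof (rule mpol_induct[where f = F and P = "\<lambda>F. K (dl w F) = 0"])
    fix c :: 'k
    have "dl w (Cst c) = scale c (dl w 1)" using dl_simps(2)[of w c 1] by simp
    then show "K (dl w (Cst c)) = 0" using 1[OF w] by (metis linear_opD(2)[OF K] scale_simps(3))
  next
    fix a :: "bool \<times> 'n" and F :: "(bool \<times> 'n, 'k) mpol" assume var: "K (dl w F) = 0"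
    obtain b i where a: "a = (b, i)" by (cases a)
    have "dl w (X a * F) = mul b (axis i 1) (dl w F)"
      by (auto simp: a mul_def lin_axis dl_def)
    then show "K (dl w (X a * F)) = 0"
      using mul[OF Ms_simps(6)[OF w]] var by (simp add: linear_opD[OF linear_mul])
  qed (simp add: dl_simps linear_opD[OF K])
  then show ?thesis by (subst Ms_expand[OF f]) (simp add: linear_opD[OF K])
qed

lemma mul_apply_dl: "mul b u (dl w F) = dl w (lin b u * F)"
  by (auto simp: mul_def dl_def)

lemma dun_dl_1: "w \<in> W \<Longrightarrow> pd (dir b u) F = 0 \<Longrightarrow> (\<And>v. v \<in> R \<Longrightarrow> DD b v F = 0) \<Longrightarrow>
    dun b u (dl w F) = dl w (lin (\<not> b) (tw b w u) * F)"
  by (rule ext) (auto simp: dun_def dl_def DD_simps intro!: sum.neutral)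

end

lemmas fun_apply = plus_fun_apply zero_fun_apply minus_apply uminus_apply

text \<open>From here on functions on \<open>W\<close> are handled through operator identities;
  evaluating them pointwise would take these apart.\<close>

declare fun_apply [simp del]

context calogero
begin

section \<open>Commutativity of the Dunkl operators\<close>

lemma linear_op_mulD: "mul b u (f + g) = mul b u f + mul b u g" "mul b u (scale c f) = scale c (mul b u f)"
  "mul b u 0 = 0" "mul b u (- f) = - mul b u f" "mul b u (f - g) = mul b u f - mul b u g"
  "mul b u (sum F I) = (\<Sum>i\<in>I. mul b u (F i))"
  by (rule linear_opD[OF linear_mul])+

lemma linear_op_shD: "sh b g (f + f') = sh b g f + sh b g f'" "sh b g (scale c f) = scale c (sh b g f)"
  "sh b g 0 = 0" "sh b g (- f) = - sh b g f" "sh b g (f - f') = sh b g f - sh b g f'"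
  "sh b g (sum F I) = (\<Sum>i\<in>I. sh b g (F i))"
  by (rule linear_opD[OF linear_sh])+

lemma linear_op_dunD: "dun b u (f + g) = dun b u f + dun b u g" "dun b u (scale c f) = scale c (dun b u f)"
  "dun b u 0 = 0" "dun b u (- f) = - dun b u f" "dun b u (f - g) = dun b u f - dun b u g"
  "dun b u (sum F I) = (\<Sum>i\<in>I. dun b u (F i))"
  by (rule linear_opD[OF linear_dun])+

lemmas op_simps = linear_op_mulD linear_op_shD linear_op_dunD

text \<open>The correction in parentheses is arranged to be visibly symmetric in \<open>u\<close>
  and \<open>u'\<close>: moving the reflection past the inner Dunkl operator replaces
  \<open>u'\<close> by \<open>reflection v u'\<close>, and the extra multiple of \<open>v\<close>
  has the symmetric coefficient (u, v) (u', v).\<close>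

lemma dun_dun_mul:
  assumes f: "f \<in> Ms"
  shows "dun b u (dun b u' (mul b x f)) = mul b x (dun b u (dun b u' f))
    + (scale (ir (u \<bullet> x)) (dun b u' f) + scale (ir (u' \<bullet> x)) (dun b u f)
    + (\<Sum>v\<in>R. scale (cc v * ir (u \<bullet> v) * ir (v \<bullet> x)) (dun b u' (sh b (reflection v) f))
        + scale (cc v * ir (u' \<bullet> v) * ir (v \<bullet> x)) (dun b u (sh b (reflection v) f))
        + scale (cc v * ir (u \<bullet> v) * ir (u' \<bullet> v) * ir (v \<bullet> x) * ir (- 2 / (v \<bullet> v)))
            (dun b v (sh b (reflection v) f))))" (is "_ = ?r")
proof -
  have S: "sh b (reflection v) (dun b u' f) = dun b u' (sh b (reflection v) f)
      + scale (ir (u' \<bullet> v) * ir (- 2 / (v \<bullet> v))) (dun b v (sh b (reflection v) f))" if v: "v \<in> R" for v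
  proof -
    have Sf: "sh b (reflection v) f \<in> Ms" by (intro sh_Ms W_refl v f)
    have "reflection v u' = u' + ((u' \<bullet> v) * (- 2 / (v \<bullet> v))) *\<^sub>R v"
      by (simp add: reflection_def)
    then show ?thesis
      by (simp only: sh_dun[OF W_refl[OF v] f] dun_dir_add[OF Sf] dun_dir_scale[OF Sf] ir_simps)
  qed
  have "dun b u (dun b u' (mul b x f)) = mul b x (dun b u (dun b u' f)) + scale (ir (u \<bullet> x)) (dun b u' f)
      + (\<Sum>v\<in>R. scale (cc v * ir (u \<bullet> v) * ir (v \<bullet> x)) (sh b (reflection v) (dun b u' f)))
      + scale (ir (u' \<bullet> x)) (dun b u f)
      + (\<Sum>v\<in>R. scale (cc v * ir (u' \<bullet> v) * ir (v \<bullet> x)) (dun b u (sh b (reflection v) f)))"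
    by (simp add: dun_mul op_simps)
  also have "(\<Sum>v\<in>R. scale (cc v * ir (u \<bullet> v) * ir (v \<bullet> x)) (sh b (reflection v) (dun b u' f))) =
     (\<Sum>v\<in>R. scale (cc v * ir (u \<bullet> v) * ir (v \<bullet> x)) (dun b u' (sh b (reflection v) f))
       + scale (cc v * ir (u \<bullet> v) * ir (u' \<bullet> v) * ir (v \<bullet> x) * ir (- 2 / (v \<bullet> v)))
            (dun b v (sh b (reflection v) f)))"
    by (rule sum.cong) (simp_all add: S scale_simps mult_ac)
  finally show ?thesis by (simp add: sum.distrib add_ac)
qed

text \<open>By the symmetry in \<open>dun_dun_mul\<close> the commutator commutes with
  multiplications. On \<open>dl w 1\<close> both products reduce to the same product of two linear
  forms.\<close>

lemma dun_dun_same: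
  assumes f: "f \<in> Ms"
  shows "dun b u (dun b u' f) = dun b u' (dun b u f)"
proof -
  let ?K = "\<lambda>f. dun b u (dun b u' f) - dun b u' (dun b u f)"
  have "?K f = 0"
  proof (rule Ms_vanishI[where K = ?K, OF _ _ _ f])
    show "linear_op ?K"
      by (rule linear_op_diff; rule linear_op_compose[OF linear_dun linear_dun])
    fix c x and f :: "(real^'n \<Rightarrow> real^'n) \<Rightarrow> (bool \<times> 'n, 'k) mpol" assume f: "f \<in> Ms"
    show "?K (mul c x f) = mul c x (?K f)"
    proof (cases "c = b")
      case True
      show ?thesis unfolding True dun_dun_mul[OF f] op_simps
        by (simp add: sum.distrib add_ac mult_ac)
    next
      case False
      then have c: "c = (\<not> b)" by simp
      show ?thesis unfolding c by (simp add: dun_mul_other f dun_Ms op_simps)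
    qed
  next
    fix w assume w: "w \<in> W"
    have "dun b y (dun b z (dl w 1)) = dl w (lin (\<not> b) (tw b w y) * lin (\<not> b) (tw b w z))" for y z
    proof -
      have "DD b v 1 = 0" for v by (simp add: DD_def)
      then have "dun b z (dl w 1) = dl w (lin (\<not> b) (tw b w z))" using dun_dl_1[OF w, of b z 1] by simp
      then show ?thesis using dun_dl_1[OF w, of b y "lin (\<not> b) (tw b w z)"] by (simp add: dd_lin DD_lin)
    qed
    then show "?K (dl w 1) = 0" by (simp add: mult.commute)
  qed
  then show ?thesis by simp
qed

lemma trn_trn_inv:
  assumes g: "g \<in> W"
  shows "trn b g (trn b (inv_into UNIV g) w) = w" "trn b (inv_into UNIV g) (trn b g w) = w"
  using W_inv_apply[OF g] by (auto simp: trn_def fun_eq_iff W_inv_inv[OF g])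

lemma sh_dl: "g \<in> W \<Longrightarrow> sh b g (dl w F) = dl (trn b (inv_into UNIV g) w) (act b g F)"
  by (rule ext) (use trn_trn_inv in \<open>auto simp: sh_def dl_def act_simps fun_apply\<close>)

lemma act_1: "act b g 1 = 1"
  using act_Cst[of b g 1] by (simp add: Cst_simps)

lemma dun_dl_one: "w \<in> W \<Longrightarrow> dun b u (dl w 1) = mul (\<not> b) (tw b w u) (dl w 1)"
  using dun_dl_1[of w b u 1] by (simp add: mul_apply_dl DD_def)

text \<open>Left and right multiplications have to commute; this is the associativity of the
  bimodule. On \<open>dl w 1\<close> the two reflection sums agree because w times the reflection in
  v is the reflection in w v times w, and w permutes \<open>R\<close>.\<close>

lemma dun_dun_True_False:
  assumes f: "f \<in> Ms"
  shows "dun True u (dun False x f) = dun False x (dun True u f)"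
proof -
  let ?K = "\<lambda>f. dun True u (dun False x f) - dun False x (dun True u f)"
  have "?K f = 0"
  proof (rule Ms_vanishI[where K = ?K, OF _ _ _ f])
    show "linear_op ?K"
      by (rule linear_op_diff; rule linear_op_compose[OF linear_dun linear_dun])
    fix c y and f :: "(real^'n \<Rightarrow> real^'n) \<Rightarrow> (bool \<times> 'n, 'k) mpol" assume f: "f \<in> Ms"
    have 1: "(\<Sum>v\<in>R. scale (a v) (sh True (reflection v) (dun False x f))) =
        dun False x (\<Sum>v\<in>R. scale (a v) (sh True (reflection v) f))" for a
      unfolding op_simps by (rule sum.cong) (use sh_dun_other[OF W_refl f, of _ True] in auto)
    have 2: "(\<Sum>v\<in>R. scale (a v) (sh False (reflection v) (dun True x f))) =
        dun True x (\<Sum>v\<in>R. scale (a v) (sh False (reflection v) f))" for a x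
      unfolding op_simps by (rule sum.cong) (use sh_dun_other[OF W_refl f, of _ False] in auto)
    show "?K (mul c y f) = mul c y (?K f)"
      using dun_mul_other[of _ False] dun_mul_other[of _ True]
      by (cases c) (simp_all add: dun_mul f dun_Ms 1 2 linear_op_dunD(1,2,5) linear_op_mulD(5))
  next
    fix w assume w: "w \<in> W"
    let ?x = "w x" and ?u = "inv_into UNIV w u"
    have ow: "w a \<bullet> w b = a \<bullet> b" for a b using W_orth[OF w] by (simp add: orthogonal_transformation_def)
    have inner: "a \<bullet> inv_into UNIV w b = w a \<bullet> b" for a b
      using ow[of a "inv_into UNIV w b"] W_inv_apply[OF w] by simp
    have s1: "sh True (reflection v) (dl w 1) = dl (reflection v \<circ> w) 1" if "v \<in> R" for v
      using that by (simp add: sh_dl W_refl inv_reflection act_1 trn_def)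
    have s2: "sh False (reflection v) (dl w 1) = dl (reflection (w v) \<circ> w) 1" if "v \<in> R" for v
      using that by (simp add: sh_dl W_refl inv_reflection act_1 trn_def W_refl_comp[OF w])
    have "(\<Sum>v\<in>R. scale (cc v * ir (x \<bullet> v) * ir (v \<bullet> ?u)) (sh False (reflection v) (dl w 1))) =
       (\<Sum>v\<in>R. scale (cc (w v) * ir (u \<bullet> w v) * ir (w v \<bullet> w x)) (dl (reflection (w v) \<circ> w) 1))"
      by (rule sum.cong) (simp_all add: s2 cc_W[OF w] ow inner inner_commute mult_ac)
    also have "\<dots> = (\<Sum>v\<in>R. scale (cc v * ir (u \<bullet> v) * ir (v \<bullet> w x)) (dl (reflection v \<circ> w) 1))"
      by (rule sum.reindex_bij_betw[OF W_R_bij[OF w]])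
    also have "\<dots> = (\<Sum>v\<in>R. scale (cc v * ir (u \<bullet> v) * ir (v \<bullet> w x)) (sh True (reflection v) (dl w 1)))"
      by (rule sum.cong) (simp_all add: s1)
    finally have sum: "(\<Sum>v\<in>R. scale (cc v * ir (x \<bullet> v) * ir (v \<bullet> ?u)) (sh False (reflection v) (dl w 1))) =
      (\<Sum>v\<in>R. scale (cc v * ir (u \<bullet> v) * ir (v \<bullet> w x)) (sh True (reflection v) (dl w 1)))" .
    have d1: "dun True u (dl w 1) = mul False ?u (dl w 1)" "dun False x (dl w 1) = mul True ?x (dl w 1)"
      using dun_dl_one[OF w, of True u] dun_dl_one[OF w, of False x] by (simp_all add: tw_def)
    have ux: "u \<bullet> ?x = x \<bullet> ?u" by (simp add: inner inner_commute)
    show "?K (dl w 1) = 0"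
      unfolding d1 dun_mul by (simp add: d1 sum ux mul_mul)
  qed
  then show ?thesis by simp
qed

lemma dun_dun:
  assumes f: "f \<in> Ms"
  shows "dun b u (dun c x f) = dun c x (dun b u f)"
  using dun_dun_same[OF f] dun_dun_True_False[OF f] by (cases b; cases c) auto

lemma dun_dl:
  "dun b u (dl w F) = dl w (lin (\<not> b) (tw b w u) * F + pd (dir b u) F)
     + (\<Sum>v\<in>R. scale (cc v * ir (u \<bullet> v)) (dl (trn b (reflection v) w) (DD b v F)))"
proof -
  have tt: "trn b (reflection v) w' = w \<longleftrightarrow> w' = trn b (reflection v) w" for v w'
    by (auto simp: trn_def inv_reflection fun_eq_iff reflection_reflection) (metis reflection_reflection)+
  have DD_if: "DD b v (if P then F else 0) = (if P then DD b v F else 0)" for v P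
    by (simp add: DD_simps)
  have pd_if: "pd z (if P then F else 0) = (if P then pd z F else 0)" for z P
    by simp
  show ?thesis
    by (rule ext) (simp add: dun_def dl_def fun_apply sum_fun_apply scale_def tt DD_if pd_if)
qed

definition c0 :: "real^'n \<Rightarrow> 'k" where
  "c0 v = \<iota> (\<nu> v / complex_of_real (v \<bullet> v))"

lemma cc_eq: "cc v = s * c0 v"
  by (simp add: cc_def c0_def)

text \<open>Conjugation by g, since \<open>sh False g\<close> is right multiplication by the inverse
  of g.\<close>

definition Ad where
  "Ad g f = sh True g (sh False g f)"

lemma linear_Ad: "linear_op (Ad g)"
  unfolding Ad_def[abs_def] by (rule linear_op_compose[OF linear_sh linear_sh])

lemma Ad_dl: "g \<in> W \<Longrightarrow> Ad g (dl w F) = dl (g \<circ> w \<circ> inv_into UNIV g) (act True g (act False g F))"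
  by (simp add: Ad_def sh_dl trn_def W_inv_inv o_assoc)

lemma Ad_mul: "g \<in> W \<Longrightarrow> Ad g (mul b u f) = mul b (g u) (Ad g f)"
  using sh_mul[of g True] sh_mul[of g False] by (cases b) (simp_all add: Ad_def)

lemma Ad_dun:
  assumes g: "g \<in> W" and f: "f \<in> Ms"
  shows "Ad g (dun b u f) = dun b (g u) (Ad g f)"
  using sh_dun[OF g f, of b u] sh_dun_other[OF g f, of "\<not> b" u]
    sh_dun[OF g sh_Ms[OF g f]] sh_dun_other[OF g sh_Ms[OF g f], of "\<not> b"]
  by (cases b) (simp_all add: Ad_def)

end

section \<open>Twisted commutators\<close>

locale calogero_twist = calogero R \<nu> \<iota> s
  for R :: "(real^'n) set" and \<nu> and \<iota> :: "complex \<Rightarrow> 'k::comm_ring_1" and s +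
  fixes \<kappa> :: real
  assumes \<kappa>: "\<kappa> \<in> {1, - 1}"
begin

lemma ir_kk: "ir \<kappa> * ir \<kappa> = 1"
  using \<kappa> by (auto simp: ir_simps)

text \<open>In the superalgebra: \<open>u\<^sub>1 f - \<kappa> f u\<^sub>1\<close> for
  \<open>b = True\<close>, and \<open>f u\<^sub>0 - \<kappa> u\<^sub>0 f\<close> for
  \<open>b = False\<close>.\<close>

definition T where
  "T b u f = mul b u f - scale (ir \<kappa>) (dun (\<not> b) u f)"

lemma linear_T: "linear_op (T b u)"
  unfolding T_def[abs_def] by (intro linear_op_diff linear_op_scale linear_mul linear_dun)

lemmas T_simps = linear_opD[OF linear_T]

lemma T_Ms: "f \<in> Ms \<Longrightarrow> T b u f \<in> Ms"
  by (auto simp: T_def intro!: Ms_simps mul_Ms dun_Ms)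

lemma T_dir_add: "f \<in> Ms \<Longrightarrow> T b (u + v) f = T b u f + T b v f"
  by (simp add: T_def mul_dir dun_dir_add scale_simps)

lemma T_dir_scale: "f \<in> Ms \<Longrightarrow> T b (c *\<^sub>R u) f = scale (ir c) (T b u f)"
  by (simp add: T_def mul_dir dun_dir_scale scale_simps mult.commute)

lemma T_dir_0: "f \<in> Ms \<Longrightarrow> T b 0 f = 0"
  using T_dir_scale[of f b 0 0] by (simp add: scale_simps ir_simps)

lemma T_dir_diff: "f \<in> Ms \<Longrightarrow> T b (u - v) f = T b u f - T b v f"
  using T_dir_add[of f b "u - v" v] by simp

lemma T_dir_sum: "f \<in> Ms \<Longrightarrow> T b (sum u I) f = (\<Sum>i\<in>I. T b (u i) f)"
  using sum_comp_morphism[of "\<lambda>u. T b u f" u I] by (simp add: T_dir_0 T_dir_add o_def)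

lemma Ad_T: "g \<in> W \<Longrightarrow> f \<in> Ms \<Longrightarrow> Ad g (T b u f) = T b (g u) (Ad g f)"
  by (simp add: T_def linear_opD[OF linear_Ad] Ad_mul Ad_dun)

lemma T_T_same: "f \<in> Ms \<Longrightarrow> T b u (T b x f) = T b x (T b u f)"
  using dun_mul_other[of f "\<not> b"]
  by (simp add: T_def op_simps scale_simps mul_mul dun_dun[of f _ u] mul_Ms dun_Ms)

text \<open>The scalar parts of the two Dunkl commutators cancel, and the reflections survive only
  as differences of left and right multiplication. A functional invariant under conjugation does not
  see these, so for it the operators \<open>T\<close> commute.\<close>

lemma T_T_other:
  assumes f: "f \<in> Ms"
  shows "T b u (T (\<not> b) x f) = T (\<not> b) x (T b u f) + scale (ir \<kappa>)
    (\<Sum>v\<in>R. scale (cc v * ir (u \<bullet> v) * ir (v \<bullet> x)) (sh b (reflection v) f - sh (\<not> b) (reflection v) f))"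
proof -
  have "(\<Sum>v\<in>R. scale (cc v * ir (x \<bullet> v) * ir (v \<bullet> u)) (sh b (reflection v) f)) =
    (\<Sum>v\<in>R. scale (cc v * ir (u \<bullet> v) * ir (v \<bullet> x)) (sh b (reflection v) f))"
    by (rule sum.cong) (simp_all add: inner_commute mult_ac)
  then have *: "dun b x (mul b u f) = mul b u (dun b x f) + scale (ir (u \<bullet> x)) f
     + (\<Sum>v\<in>R. scale (cc v * ir (u \<bullet> v) * ir (v \<bullet> x)) (sh b (reflection v) f))"
    by (simp add: dun_mul inner_commute)
  have 1: "T b u (T (\<not> b) x f) = mul b u (mul (\<not> b) x f) - scale (ir \<kappa>) (mul b u (dun b x f))
      - scale (ir \<kappa>) (dun (\<not> b) u (mul (\<not> b) x f)) + dun (\<not> b) u (dun b x f)"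
    using ir_kk by (simp add: T_def op_simps scale_simps)
  have 2: "T (\<not> b) x (T b u f) = mul (\<not> b) x (mul b u f) - scale (ir \<kappa>) (mul (\<not> b) x (dun (\<not> b) u f))
      - scale (ir \<kappa>) (dun b x (mul b u f)) + dun b x (dun (\<not> b) u f)"
    using ir_kk by (simp add: T_def op_simps scale_simps)
  show ?thesis
    unfolding 1 2 * dun_mul[of "\<not> b"]
    by (simp add: mul_mul[of b] dun_dun[OF f, of b] scale_simps sum_subtractf)
qed

lemma T_dl:
  assumes w: "w \<in> W"
  shows "T b u (dl w F) = dl w (lin b (u - \<kappa> *\<^sub>R tw (\<not> b) w u) * F - Cst (ir \<kappa>) * pd (dir (\<not> b) u) F)
     - scale (s * ir \<kappa>) (\<Sum>v\<in>R. scale (c0 v * ir (u \<bullet> v)) (dl (trn (\<not> b) (reflection v) w) (DD (\<not> b) v F)))"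
  by (simp add: T_def mul_apply_dl dun_dl lin_simps dl_simps scale_simps scale_sum cc_eq left_diff_distrib mult.assoc
      mult.left_commute[of "ir \<kappa>" s])

end

section \<open>The eigenspace projection, the partial inverse and the contraction\<close>

context calogero_twist
begin

abbreviation e :: "'n \<Rightarrow> real^'n" where "e j \<equiv> axis j 1"

definition p where "p w = proj (Fix \<kappa> w)"

text \<open>\<open>T b\<close> multiplies by the linear form of
  \<open>u - \<kappa> *\<^sub>R tw (\<not> b) w u\<close> (\<open>T_dl\<close>). The map
  \<open>q\<close> inverts that operator off the eigenspace, so that \<open>T b (q b w u)\<close>
  multiplies by the linear form of \<open>u - p w u\<close>.\<close>

definition q where "q b w = untwist \<kappa> (tw (\<not> b) w)"

definition E :: "(real^'n \<Rightarrow> real^'n) \<Rightarrow> nat" where "E w = dim (Fix \<kappa> w)"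

lemma tw_orth: "w \<in> W \<Longrightarrow> orthogonal_transformation (tw b w)"
  by (cases b) (auto simp: tw_def[abs_def] W_orth W_inv)

lemma Fix_tw:
  assumes w: "w \<in> W"
  shows "Fix \<kappa> (tw b w) = Fix \<kappa> w"
proof (cases b)
  case True
  have "u \<in> Fix \<kappa> (inv_into UNIV w) \<longleftrightarrow> u \<in> Fix \<kappa> w" for u
    unfolding Fix_iff[OF \<kappa> W_orth[OF w]] Fix_iff[OF \<kappa> W_orth[OF W_inv[OF w]]]
    using W_inv_apply[OF w] linear_scale[OF W_linear[OF w]] linear_scale[OF W_linear[OF W_inv[OF w]]] \<kappa>
    by (metis (no_types, opaque_lifting) insertE mult_minus_left mult_minus_right mult_1 scaleR_one
      scaleR_scaleR minus_minus singletonD)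
  then show ?thesis using True by (auto simp: tw_def[abs_def])
qed (simp add: tw_def[abs_def])

context
  fixes w assumes w: "w \<in> W"
begin

lemma subspace_Fix_w: "subspace (Fix \<kappa> w)"
  by (rule subspace_Fix[OF \<kappa> W_orth[OF w]])

lemma linear_p: "linear (p w)" and linear_q: "linear (q b w)"
  unfolding p_def q_def
  by (rule linear_proj[OF subspace_Fix_w], rule linear_untwist[OF \<kappa> tw_orth[OF w]])

lemma p_tw: "p w u - \<kappa> *\<^sub>R tw b w (p w u) = 0"
  using proj_Fix[OF \<kappa> tw_orth[OF w], of b u] by (simp add: p_def Fix_tw[OF w])

lemma p_p: "p w (p w u) = p w u"
  unfolding p_def by (rule proj_proj[OF \<kappa> W_orth[OF w]])

lemma p_in: "p w u \<in> Fix \<kappa> w"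
  unfolding p_def by (rule proj_in[OF subspace_Fix_w])

lemma p_symmetric: "p w (e i) $ j = p w (e j) $ i"
  using proj_symmetric[OF subspace_Fix_w, of "e i" "e j"] by (simp add: p_def inner_axis inner_axis')

lemma p_trace: "(\<Sum>j\<in>UNIV. p w (e j) $ j) = real (E w)"
proof -
  have "real (E w) = (\<Sum>b\<in>Basis. p w b \<bullet> b)"
    using trace_proj[OF subspace_Fix_w] by (simp add: E_def p_def)
  also have "(Basis :: (real^'n) set) = range e" by (auto simp: Basis_vec_def)
  also have "(\<Sum>b\<in>range e. p w b \<bullet> b) = (\<Sum>j\<in>UNIV. p w (e j) \<bullet> e j)"
    by (subst sum.reindex) (auto simp: inj_on_def axis_eq_axis)
  finally show ?thesis by (simp add: inner_axis)
qed

lemma q_tw: "q b w u - \<kappa> *\<^sub>R tw (\<not> b) w (q b w u) = u - p w u"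
  unfolding q_def p_def using twist_untwist[OF \<kappa> tw_orth[OF w], of "\<not> b" u] by (simp add: Fix_tw[OF w])

lemma tw_q: "q b w (u - \<kappa> *\<^sub>R tw (\<not> b) w u) = u - p w u"
  unfolding q_def p_def using untwist_twist[OF \<kappa> tw_orth[OF w], of "\<not> b" u] by (simp add: Fix_tw[OF w])

lemma E_pos: "p w u \<noteq> 0 \<Longrightarrow> E w \<ge> 1"
proof -
  assume "p w u \<noteq> 0"
  then have "\<not> Fix \<kappa> w \<subseteq> {0}" using p_in by blast
  then show "E w \<ge> 1" unfolding E_def using dim_eq_0 by (metis less_one not_le)
qed

lemma E_zero: "E w = 0 \<Longrightarrow> p w u = 0"
  using E_pos by fastforce

end

context
  fixes w g assumes w: "w \<in> W" and g: "g \<in> W"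
begin

abbreviation cj where "cj \<equiv> g \<circ> w \<circ> inv_into UNIV g"

lemma cj_W: "cj \<in> W"
  by (intro W_comp W_inv w g)

lemma E_conj: "E cj = E w"
  unfolding E_def by (rule dim_Fix_conj[OF \<kappa> W_orth[OF w] W_orth[OF g]])

lemma p_conj: "p cj (g u) = g (p w u)"
  unfolding p_def by (rule proj_conj[OF \<kappa> W_orth[OF w] W_orth[OF g]])

lemma q_conj: "q b cj (g u) = g (q b w u)"
proof -
  have "tw (\<not> b) cj = g \<circ> tw (\<not> b) w \<circ> inv_into UNIV g"
    using w g by (auto simp: tw_def[abs_def] W_inv_comp W_comp W_inv W_inv_inv fun_eq_iff)
  then show ?thesis
    unfolding q_def using untwist_conj[OF \<kappa> tw_orth[OF w, of "\<not> b"] W_orth[OF g]] by metis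
qed

end

lemma E_trn:
  assumes w: "w \<in> W" and v: "v \<in> R"
  shows "E (trn b (reflection v) w) = E (reflection v \<circ> w)"
proof (cases b)
  case False
  have "reflection v \<circ> (reflection v \<circ> w) \<circ> inv_into UNIV (reflection v) = w \<circ> reflection v"
    by (auto simp: fun_eq_iff reflection_reflection inv_reflection)
  then show ?thesis
    using E_conj[OF W_comp[OF W_refl[OF v] w] W_refl[OF v]] False by (simp add: trn_def)
qed (simp add: trn_def inv_reflection)

lemma E_trn_le: "w \<in> W \<Longrightarrow> v \<in> R \<Longrightarrow> E (trn b (reflection v) w) \<le> E w + 1"
  unfolding E_trn using Fix_reflection_le[OF \<kappa> W_orth] by (simp add: E_def)

lemma E_trn_less: "w \<in> W \<Longrightarrow> v \<in> R \<Longrightarrow> p w u \<bullet> v \<noteq> 0 \<Longrightarrow> E (trn b (reflection v) w) < E w"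
  unfolding E_trn using Fix_reflection_strict[OF \<kappa> W_orth p_in] by (simp add: E_def)

lemma sum_bool_prod: "(\<Sum>a\<in>UNIV. f a) = (\<Sum>b\<in>UNIV. \<Sum>j\<in>UNIV. f (b :: bool, j :: 'n))"
  by (simp add: UNIV_Times_UNIV[symmetric] sum.cartesian_product del: UNIV_Times_UNIV)

lemma del_eq: "del (b, j) = pd (dir b (e j))"
proof -
  have "(\<lambda>a. if a = (b, j) then 1 else 0) = dir b (e j)"
    by (auto simp: dir_def fun_eq_iff axis_def ir_simps)
  then show ?thesis by (simp add: del_def)
qed

lemma pd_dir: "pd (dir b u) F = (\<Sum>j\<in>UNIV. Cst (ir (u $ j)) * del (b, j) F)"
proof -
  have "pd (dir b u) F = (\<Sum>c\<in>UNIV. \<Sum>j\<in>UNIV. Cst (dir b u (c, j)) * del (c, j) F)"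
    by (simp add: pd_eq_sum_del sum_bool_prod)
  then show ?thesis by (cases b) (simp_all add: UNIV_bool dir_apply Cst_simps)
qed

definition J :: "(real^'n \<Rightarrow> real^'n) \<Rightarrow> (bool \<times> 'n, 'k) mpol \<Rightarrow> (bool \<times> 'n, 'k) mpol" where
  "J w F = eul F + Cst (of_nat (2 * E w)) * F"

definition R0 where
  "R0 w F = - Cst (ir \<kappa>) * (\<Sum>b\<in>UNIV. \<Sum>j\<in>UNIV. pd (dir (\<not> b) (q b w (e j))) (del (b, j) F))"

text \<open>The reflection part of \<open>T b u (dl w F)\<close> with its factor - s \<kappa> taken
  out, see \<open>T_dl\<close>.\<close>

definition Qt where
  "Qt b w u F = (\<Sum>v\<in>R. scale (c0 v * ir (u \<bullet> v)) (dl (trn (\<not> b) (reflection v) w) (DD (\<not> b) v F)))"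

definition Q where
  "Q w F = scale (ir \<kappa>) (\<Sum>b\<in>UNIV. \<Sum>j\<in>UNIV. Qt b w (q b w (e j)) (del (b, j) F))
     - (\<Sum>b\<in>UNIV. \<Sum>j\<in>UNIV. Qt b w (p w (e j)) (X (\<not> b, j) * F))"

text \<open>The operators \<open>J\<close>, \<open>R0\<close> and \<open>Q\<close> give the expansion of \<open>GG1\<close>: \<open>J\<close> is diagonal, \<open>R0\<close> lowers the
  degree by two, and \<open>Q\<close> lowers the sum of the degree and of the dimension \<open>E\<close> of the eigenspace.\<close>

definition GG1 where
  "GG1 w F = (\<Sum>b\<in>UNIV. \<Sum>j\<in>UNIV. T b (q b w (e j)) (dl w (del (b, j) F))
     - scale (ir \<kappa>) (T b (p w (e j)) (dl w (X (\<not> b, j) * F))))"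

lemma ir_of_nat: "ir (real n) = of_nat n"
  by (induction n) (auto simp: ir_simps)

text \<open>Since p is symmetric, it can be moved from the linear form to the derivative. The first
  sum is thus the Euler operator minus its part along the eigenspace; the second restores that part,
  and its Leibniz term adds the trace of p.\<close>

lemma Euler_identity:
  assumes w: "w \<in> W"
  shows "(\<Sum>j\<in>UNIV. lin b (e j - p w (e j)) * del (b, j) F) + (\<Sum>j\<in>UNIV. pd (dir b (p w (e j))) (X (b, j) * F))
    = (\<Sum>j\<in>UNIV. X (b, j) * del (b, j) F) + Cst (of_nat (E w)) * F"
proof -
  have "(\<Sum>j\<in>UNIV. lin b (p w (e j)) * del (b, j) F) =
      (\<Sum>j\<in>UNIV. \<Sum>i\<in>UNIV. Cst (ir (p w (e i) $ j)) * X (b, i) * del (b, j) F)"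
    by (simp add: lin_def sum_distrib_right p_symmetric[OF w])
  also have "\<dots> = (\<Sum>i\<in>UNIV. X (b, i) * pd (dir b (p w (e i))) F)"
    by (subst sum.swap) (simp add: pd_dir sum_distrib_left mult_ac)
  finally have 1: "(\<Sum>j\<in>UNIV. lin b (p w (e j)) * del (b, j) F) = (\<Sum>i\<in>UNIV. X (b, i) * pd (dir b (p w (e i))) F)" .
  have "(\<Sum>j\<in>UNIV. pd (dir b (p w (e j))) (X (b, j) * F)) =
      (\<Sum>j\<in>UNIV. X (b, j) * pd (dir b (p w (e j))) F) + (\<Sum>j\<in>UNIV. Cst (ir (p w (e j) $ j)) * F)"
    by (simp add: dd_X_mult dir_apply sum.distrib)
  also have "(\<Sum>j\<in>UNIV. Cst (ir (p w (e j) $ j)) * F) = Cst (of_nat (E w)) * F"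
    by (simp only: p_trace[OF w, symmetric] ir_of_nat[symmetric] ir_sum Cst_sum sum_distrib_right)
  finally show ?thesis
    by (simp add: lin_simps lin_axis left_diff_distrib sum_subtractf 1)
qed

lemma eul_eq:
  fixes F :: "(bool \<times> 'n, 'k) mpol"
  shows "eul F = (\<Sum>b\<in>UNIV. \<Sum>j\<in>UNIV. X (b, j) * del (b, j) F)"
  unfolding eul_def by (rule sum_bool_prod)

lemma GG1_eq:
  assumes w: "w \<in> W"
  shows "GG1 w F = dl w (J w F + R0 w F) - scale s (Q w F)"
proof -
  have kk: "ir \<kappa> * (s * ir \<kappa>) = s"
    using ir_kk by (simp add: mult.left_commute)
  have t: "T b (q b w (e j)) (dl w (del (b, j) F)) - scale (ir \<kappa>) (T b (p w (e j)) (dl w (X (\<not> b, j) * F)))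
    = dl w (lin b (e j - p w (e j)) * del (b, j) F) + dl w (pd (dir (\<not> b) (p w (e j))) (X (\<not> b, j) * F))
      + dl w (- Cst (ir \<kappa>) * pd (dir (\<not> b) (q b w (e j))) (del (b, j) F))
      - scale s (scale (ir \<kappa>) (Qt b w (q b w (e j)) (del (b, j) F)) - Qt b w (p w (e j)) (X (\<not> b, j) * F))" for b j
    unfolding T_dl[OF w] q_tw[OF w] p_tw[OF w] Qt_def[symmetric]
    by (simp add: lin_simps(3) dl_simps scale_simps kk ir_kk)
  have "GG1 w F = dl w ((\<Sum>b\<in>UNIV. \<Sum>j\<in>UNIV. lin b (e j - p w (e j)) * del (b, j) F)
      + (\<Sum>b\<in>UNIV. \<Sum>j\<in>UNIV. pd (dir (\<not> b) (p w (e j))) (X (\<not> b, j) * F)) + R0 w F) - scale s (Q w F)"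
    unfolding GG1_def t R0_def Q_def
    by (simp add: sum.distrib sum_subtractf dl_simps(1) dl_sum scale_sum scale_simps sum_distrib_left)
  \<comment> \<open>Exchanging the two copies in the second sum pairs the terms as
    \<open>Euler_identity\<close> needs them; each copy then contributes one
    \<open>E w\<close>.\<close>
  also have "(\<Sum>b\<in>UNIV. \<Sum>j\<in>UNIV. pd (dir (\<not> b) (p w (e j))) (X (\<not> b, j) * F)) =
      (\<Sum>b\<in>UNIV. \<Sum>j\<in>UNIV. pd (dir b (p w (e j))) (X (b, j) * F))"
    by (simp add: UNIV_bool)
  also have "(\<Sum>b\<in>UNIV. \<Sum>j\<in>UNIV. lin b (e j - p w (e j)) * del (b, j) F) + \<dots> =
      (\<Sum>b\<in>UNIV. (\<Sum>j\<in>UNIV. X (b, j) * del (b, j) F) + Cst (of_nat (E w)) * F)"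
    by (subst sum.distrib[symmetric]) (simp only: Euler_identity[OF w])
  also have "\<dots> = J w F"
    unfolding J_def eul_eq sum.distrib mult_2 of_nat_add Cst_simps distrib_right by (simp add: UNIV_bool)
  finally show ?thesis by simp
qed

text \<open>A contraction with the metric does not depend on the orthonormal basis: the columns of
  g, expanded in the standard basis, contribute the orthonormality of its rows.\<close>

lemma sum_orthogonal_invariant:
  fixes B :: "real^'n \<Rightarrow> real^'n \<Rightarrow> 'w \<Rightarrow> ('a, 'k) mpol"
  assumes g: "orthogonal_transformation g"
    and B1: "\<And>u v x. B (u + v) x = B u x + B v x" "\<And>c u x. B (c *\<^sub>R u) x = scale (ir c) (B u x)"
    and B2: "\<And>u x y. B u (x + y) = B u x + B u y" "\<And>c u x. B u (c *\<^sub>R x) = scale (ir c) (B u x)"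
  shows "(\<Sum>j\<in>UNIV. B (g (e j)) (g (e j))) = (\<Sum>j\<in>UNIV. B (e j) (e j))"
proof -
  have B1s: "B (sum u I) x = (\<Sum>i\<in>I. B (u i) x)" for u x and I :: "'n set"
    using sum_comp_morphism[of "\<lambda>u. B u x" u I] B1(2)[of 0 0 x] by (simp add: B1 o_def scale_simps ir_simps)
  have B2s: "B x (sum u I) = (\<Sum>i\<in>I. B x (u i))" for u x and I :: "'n set"
    using sum_comp_morphism[of "B x" u I] B2(2)[of x 0 0] by (simp add: B2 o_def scale_simps ir_simps)
  have orth: "(\<Sum>j\<in>UNIV. g (e j) $ k * g (e j) $ l) = (if k = l then 1 else 0)" for k l
  proof -
    have gi: "orthogonal_transformation (inv_into UNIV g)" by (rule orthogonal_transformation_inv[OF g])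
    have "g (e j) $ k = inv_into UNIV g (e k) $ j" for j k
    proof -
      have "g (e j) \<bullet> g (inv_into UNIV g (e k)) = e j \<bullet> inv_into UNIV g (e k)"
        using g by (simp add: orthogonal_transformation_def)
      then show ?thesis by (simp add: inv_g[OF g] inner_axis inner_axis')
    qed
    then have "(\<Sum>j\<in>UNIV. g (e j) $ k * g (e j) $ l) = inv_into UNIV g (e k) \<bullet> inv_into UNIV g (e l)"
      by (simp add: inner_vec_def)
    also have "\<dots> = e k \<bullet> e l" using gi by (simp add: orthogonal_transformation_def)
    finally show ?thesis by (simp add: inner_axis_axis)
  qed
  have "(\<Sum>j\<in>UNIV. B (g (e j)) (g (e j))) =
     (\<Sum>j\<in>UNIV. B (\<Sum>k\<in>UNIV. g (e j) $ k *\<^sub>R e k) (\<Sum>l\<in>UNIV. g (e j) $ l *\<^sub>R e l))"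
    by (simp only: vec_expand[symmetric])
  also have "\<dots> = (\<Sum>j\<in>UNIV. \<Sum>k\<in>UNIV. \<Sum>l\<in>UNIV. scale (ir (g (e j) $ k * g (e j) $ l)) (B (e k) (e l)))"
    by (simp only: B1s B1) (simp only: B2s B2 scale_sum scale_simps ir_simps)
  also have "\<dots> = (\<Sum>k\<in>UNIV. \<Sum>j\<in>UNIV. \<Sum>l\<in>UNIV. scale (ir (g (e j) $ k * g (e j) $ l)) (B (e k) (e l)))"
    by (rule sum.swap)
  also have "\<dots> = (\<Sum>k\<in>UNIV. \<Sum>l\<in>UNIV. \<Sum>j\<in>UNIV. scale (ir (g (e j) $ k * g (e j) $ l)) (B (e k) (e l)))"
    by (rule sum.cong[OF refl sum.swap])
  also have "\<dots> = (\<Sum>k\<in>UNIV. \<Sum>l\<in>UNIV. scale (ir (if k = l then 1 else 0)) (B (e k) (e l)))"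
    by (simp only: scale_sum_left[symmetric] ir_sum[symmetric] orth)
  also have "\<dots> = (\<Sum>k\<in>UNIV. \<Sum>l\<in>UNIV. if l = k then B (e k) (e l) else 0)"
    by (intro sum.cong refl) (auto simp: ir_simps scale_simps)
  finally show ?thesis by simp
qed

definition act2 where "act2 g F = act True g (act False g F)"

lemma act2_simps: "act2 g (f + f') = act2 g f + act2 g f'" "act2 g 0 = 0" "act2 g (f * f') = act2 g f * act2 g f'"
  "act2 g (Cst c) = Cst c" "act2 g (f - f') = act2 g f - act2 g f'" "act2 g (- f) = - act2 g f"
  by (simp_all add: act2_def act_simps)

lemma act2_lin: "g \<in> W \<Longrightarrow> act2 g (lin b u) = lin b (g u)"
  by (cases b) (simp_all add: act2_def act_lin W_linear)

lemma act2_pd: "g \<in> W \<Longrightarrow> act2 g (pd (dir b u) F) = pd (dir b (g u)) (act2 g F)"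
  using act_pd_other[of True g] act_pd_other[of False g]
  by (cases b) (simp_all add: act2_def act_pd W_orth)

lemma Ad_dl2: "g \<in> W \<Longrightarrow> Ad g (dl w F) = dl (g \<circ> w \<circ> inv_into UNIV g) (act2 g F)"
  by (simp add: Ad_dl act2_def)

text \<open>Conjugation by \<open>g\<close> carries the maps p and q and the variables along. What
  remains is a change from the basis g e_j to the basis e_j in two contractions.\<close>

lemma Ad_GG1:
  assumes w: "w \<in> W" and g: "g \<in> W"
  shows "Ad g (GG1 w F) = GG1 (g \<circ> w \<circ> inv_into UNIV g) (act2 g F)"
proof -
  define w' where "w' = g \<circ> w \<circ> inv_into UNIV g"
  let ?F = "act2 g F"
  have w': "w' \<in> W" unfolding w'_def by (rule cj_W[OF w g])
  note lp = linear_p[OF w'] and lq = linear_q[OF w']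
  have dlM: "dl w' G \<in> Ms" for G by (rule Ms_simps(6)[OF w'])
  let ?A = "\<lambda>b u x. T b (q b w' u) (dl w' (pd (dir b x) ?F))"
  let ?B = "\<lambda>b u x. T b (p w' u) (dl w' (lin (\<not> b) x * ?F))"
  have 1: "(\<Sum>j\<in>UNIV. ?A b (g (e j)) (g (e j))) = (\<Sum>j\<in>UNIV. ?A b (e j) (e j))" for b
    by (rule sum_orthogonal_invariant[OF W_orth[OF g], where B = "?A b"])
      (simp_all add: linear_add[OF lq] linear_scale[OF lq] T_dir_add[OF dlM] T_dir_scale[OF dlM]
        dir_simps pd_dir_add pd_dir_scale dl_simps T_simps)
  have 2: "(\<Sum>j\<in>UNIV. ?B b (g (e j)) (g (e j))) = (\<Sum>j\<in>UNIV. ?B b (e j) (e j))" for b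
    by (rule sum_orthogonal_invariant[OF W_orth[OF g], where B = "?B b"])
      (simp_all add: linear_add[OF lp] linear_scale[OF lp] T_dir_add[OF dlM] T_dir_scale[OF dlM]
        lin_simps distrib_right mult.assoc dl_simps T_simps)
  note Ad = linear_opD[OF linear_Ad] Ad_T[OF g Ms_simps(6)[OF w]] Ad_dl2[OF g, of w, folded w'_def]
      q_conj[OF w g, folded w'_def, symmetric] p_conj[OF w g, folded w'_def, symmetric]
  have "Ad g (GG1 w F) = (\<Sum>b\<in>UNIV. (\<Sum>j\<in>UNIV. ?A b (g (e j)) (g (e j)))
     - scale (ir \<kappa>) (\<Sum>j\<in>UNIV. ?B b (g (e j)) (g (e j))))"
    unfolding GG1_def
    by (simp add: Ad del_eq act2_pd[OF g] lin_axis[symmetric] act2_simps act2_lin[OF g] sum_subtractf scale_sum)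
  also have "\<dots> = GG1 w' (act2 g F)" unfolding 1 2 GG1_def
    by (simp add: del_eq lin_axis scale_sum sum_subtractf)
  finally show ?thesis unfolding w'_def .
qed

end

lemma Graded_neg: "f \<in> Graded {j} \<Longrightarrow> j < 0 \<Longrightarrow> f = 0"
  and Graded_atMost_neg: "f \<in> Graded {..j} \<Longrightarrow> j < 0 \<Longrightarrow> f = 0"
proof -
  have *: "Poly_Mapping.keys f = {} \<Longrightarrow> f = 0" by (simp add: keys_eq_empty)
  show "f \<in> Graded {j} \<Longrightarrow> j < 0 \<Longrightarrow> f = 0" by (rule *) (auto simp: Graded_def)
  show "f \<in> Graded {..j} \<Longrightarrow> j < 0 \<Longrightarrow> f = 0" by (rule *) (auto simp: Graded_def)
qed

definition ct :: "('a, 'k::comm_ring_1) mpol \<Rightarrow> 'k" where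
  "ct = ev (\<lambda>c. c) (\<lambda>_. 0)"

lemma ring_map_ct: "ring_map ct"
  unfolding ct_def by (rule ring_map_ev[OF ring_map_ident])

lemmas ct_simps = ring_mapD[OF ring_map_ct]

lemma ct_Cst [simp]: "ct (Cst c) = c" and ct_X [simp]: "ct (X a) = 0"
  by (simp_all add: ct_def ev_Cst ev_X ring_map_ident)

lemma ct_single: "ct (Poly_Mapping.single m c) = (if m = {#} then c else 0)"
  by (cases m) (simp_all add: ct_def ev_single ring_map_ident)

lemma ct_Graded: "f \<in> Graded {int m} \<Longrightarrow> if m = 0 then f = Cst (ct f) else ct f = 0"
  by (induction rule: Graded_induct)
    (auto simp: ct_simps Cst_simps ct_single Cst_def[symmetric] split: if_splits)

section \<open>The remainder operator \<open>Gam\<close> and its local nilpotence\<close>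

context calogero_twist
begin

definition GG where "GG f = (\<Sum>w\<in>W. GG1 w (f w))"

text \<open>Projection onto the kernel of \<open>J\<close>: the eigenvalue m + 2 E w in degree m
  vanishes only for m = 0 and E w = 0.\<close>

definition cpart :: "(real^'n \<Rightarrow> real^'n) \<Rightarrow> (bool \<times> 'n, 'k) mpol \<Rightarrow> (bool \<times> 'n, 'k) mpol" where
  "cpart w F = (if E w = 0 then Cst (ct F) else 0)"

text \<open>A pseudo-inverse of \<open>J\<close>. On the kernel of \<open>J\<close> the factor is
  \<open>1 / 0\<close>, which is 0, so that \<open>rho\<close> vanishes there.\<close>

definition rho :: "(real^'n \<Rightarrow> real^'n) \<Rightarrow> (bool \<times> 'n, 'k) mpol \<Rightarrow> (bool \<times> 'n, 'k) mpol" where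
  "rho w F = degree_scale (\<lambda>m. ir (1 / real (m + 2 * E w))) F"

text \<open>What is left after correcting by the contraction: \<open>GG\<close> of
  \<open>rho\<close> reproduces everything outside the kernel of \<open>J\<close> up to lower terms.
  Since \<open>GG\<close> is built from twisted commutators, a functional killing these satisfies
  the recursion with \<open>Gam\<close>.\<close>

definition Gam where
  "Gam f = (\<lambda>w. f w - cpart w (f w)) - GG (\<lambda>w. rho w (f w))"

lemma linear_GG1: "GG1 w (F + G) = GG1 w F + GG1 w G" "GG1 w (Cst c * F) = scale c (GG1 w F)"
proof -
  have X: "X a * (Cst c * F) = Cst c * (X a * F)" for a by (rule mult.left_commute)
  show "GG1 w (F + G) = GG1 w F + GG1 w G"
    unfolding GG1_def del_def dd_add distrib_left dl_simps T_simps scale_simps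
    by (simp add: sum.distrib sum_subtractf)
  show "GG1 w (Cst c * F) = scale c (GG1 w F)"
    unfolding GG1_def del_def dd_Cst_mult X dl_simps T_simps scale_sum scale_simps
    by (simp add: mult.commute)
qed

lemma GG1_0: "GG1 w 0 = 0"
  using linear_GG1(2)[of w 0 0] by (simp add: Cst_simps scale_simps)

lemma GG1_Ms: "w \<in> W \<Longrightarrow> GG1 w F \<in> Ms"
  unfolding GG1_def by (intro Ms_sum Ms_simps T_Ms)

lemma GG_Ms: "GG f \<in> Ms"
  unfolding GG_def by (intro Ms_sum GG1_Ms)

lemma linear_GG: "linear_op GG"
  by (rule linear_opI) (simp_all add: GG_def fun_apply scale_def[of _ "_ :: _ \<Rightarrow> _ \<Rightarrow>\<^sub>0 _"] linear_GG1 sum.distrib scale_sum[unfolded scale_def])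

lemma GG_dl: "w \<in> W \<Longrightarrow> GG (dl w F) = GG1 w F"
proof -
  assume w: "w \<in> W"
  have "GG (dl w F) = (\<Sum>w'\<in>W. if w' = w then GG1 w F else 0)"
    unfolding GG_def by (rule sum.cong) (auto simp: dl_def GG1_0)
  then show ?thesis using w finite_W by simp
qed

lemma cpart_simps: "cpart w (F + G) = cpart w F + cpart w G" "cpart w (Cst c * F) = Cst c * cpart w F" "cpart w 0 = 0"
  "cpart w (cpart w F) = cpart w F"
  by (auto simp: cpart_def ct_simps Cst_simps)

lemma rho_simps: "rho w (F + G) = rho w F + rho w G" "rho w (Cst c * F) = Cst c * rho w F"
  by (auto simp: rho_def degree_scale_add degree_scale_Cst_mult)

lemma rho_0: "rho w 0 = 0"
  using rho_simps(2)[of w 0 0] by (simp add: Cst_simps)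

lemma rho_Graded: "F \<in> Graded {int m} \<Longrightarrow> rho w F = Cst (ir (1 / real (m + 2 * E w))) * F"
  unfolding rho_def by (rule degree_scale_Graded)

lemma J_Graded: "F \<in> Graded {int m} \<Longrightarrow> J w F = Cst (ir (real (m + 2 * E w))) * F"
  unfolding J_def by (simp add: eul_Graded ir_of_nat[symmetric] ir_simps Cst_simps algebra_simps)

lemma J_simps: "J w (F + G) = J w F + J w G"
  by (simp add: J_def eul_add algebra_simps)

lemma ir_inverse: "x \<noteq> 0 \<Longrightarrow> Cst (ir x) * (Cst (ir (1 / x)) * F) = F"
  "x \<noteq> 0 \<Longrightarrow> Cst (ir (1 / x)) * (Cst (ir x) * F) = F"
  by (simp_all add: mult.assoc[symmetric] Cst_simps(4)[symmetric] ir_simps(4)[symmetric] ir_simps(2) Cst_simps(2))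

lemma cpart_Graded:
  assumes "F \<in> Graded {int m}"
  shows "cpart w F = (if m + 2 * E w = 0 then F else 0)"
  using ct_Graded[OF assms] by (auto simp: cpart_def Cst_simps split: if_splits)

lemma J_rho: "J w (rho w F) = F - cpart w F" and rho_J: "rho w (J w F) = F - cpart w F"
proof (induction F rule: homogeneous_decomposition)
  case (homogeneous m F)
  have F: "rho w F \<in> Graded {int m}" "J w F \<in> Graded {int m}"
    using homogeneous by (simp_all only: rho_Graded J_Graded Graded_Cst_mult)
  have r: "Cst (ir (real (m + 2 * E w))) * (Cst (ir (1 / real (m + 2 * E w))) * F) = (if m + 2 * E w = 0 then 0 else F)"
    "Cst (ir (1 / real (m + 2 * E w))) * (Cst (ir (real (m + 2 * E w))) * F) = (if m + 2 * E w = 0 then 0 else F)"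
    by (cases "m + 2 * E w = 0", simp add: ir_simps Cst_simps, metis ir_inverse of_nat_eq_0_iff)+
  {
    case 1
    show ?case unfolding J_Graded[OF F(1)] unfolding rho_Graded[OF homogeneous] cpart_Graded[OF homogeneous] r
      by simp
  next
    case 2
    show ?case unfolding rho_Graded[OF F(2)] unfolding J_Graded[OF homogeneous] cpart_Graded[OF homogeneous] r
      by simp
  }
next
  case (add F G)
  {
    case 1
    then show ?case using add by (simp add: J_simps rho_simps cpart_simps)
  next
    case 2
    then show ?case using add by (simp add: J_simps rho_simps cpart_simps)
  }
qed

lemma cpart_J: "cpart w (J w F) = 0"
proof (induction F rule: homogeneous_decomposition)
  case (homogeneous m F)
  show ?case unfolding J_Graded[OF homogeneous] cpart_simps cpart_Graded[OF homogeneous]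
    by (auto simp: ir_simps Cst_simps)
qed (simp add: J_simps cpart_simps)

lemma GG1_cpart: "w \<in> W \<Longrightarrow> GG1 w (cpart w F) = 0"
proof (cases "E w = 0")
  case True
  assume w: "w \<in> W"
  have "del a (Cst c) = 0" for a :: "bool \<times> 'n" and c :: 'k by (simp add: del_def)
  then show ?thesis using True
    by (simp add: GG1_def cpart_def E_zero[OF w True] T_dir_0[OF Ms_simps(6)[OF w]] dl_simps T_simps scale_simps)
qed (simp add: cpart_def GG1_0)

lemma linear_Gam: "linear_op Gam"
proof -
  have 1: "linear_op (\<lambda>f w. f w - cpart w (f w))"
    by (rule linear_opI) (auto simp: fun_eq_iff fun_apply scale_def cpart_simps right_diff_distrib)
  have "linear_op (\<lambda>f w. rho w (f w))"
    by (rule linear_opI) (auto simp: fun_eq_iff fun_apply scale_def rho_simps)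
  then have 2: "linear_op (\<lambda>f. GG (\<lambda>w. rho w (f w)))" by (rule linear_op_compose[OF linear_GG])
  show ?thesis unfolding Gam_def[abs_def] by (rule linear_op_diff[OF 1 2])
qed

lemma Gam_Ms: "f \<in> Ms \<Longrightarrow> Gam f \<in> Ms"
  unfolding Gam_def by (intro Ms_simps GG_Ms) (simp add: Ms_def cpart_simps)

lemma Gam_dl: "w \<in> W \<Longrightarrow> Gam (dl w F) = dl w (F - cpart w F) - GG1 w (rho w F)"
proof -
  assume w: "w \<in> W"
  have "(\<lambda>w'. rho w' (dl w F w')) = dl w (rho w F)" "(\<lambda>w'. dl w F w' - cpart w' (dl w F w')) = dl w (F - cpart w F)"
    by (rule ext, auto simp: dl_def rho_0 cpart_simps)+
  then show ?thesis unfolding Gam_def by (simp add: GG_dl[OF w])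
qed

lemma Gam_dl': "w \<in> W \<Longrightarrow> Gam (dl w F) = scale s (Q w (rho w F)) - dl w (R0 w (rho w F))"
  by (simp add: Gam_dl GG1_eq J_rho dl_simps)

text \<open>The filtration by degree + E. Integer levels allow the descent to end below 0, where the
  filtration is trivial (\<open>Lev_neg\<close>).\<close>

definition Lev :: "int \<Rightarrow> ((real^'n \<Rightarrow> real^'n) \<Rightarrow> (bool \<times> 'n, 'k) mpol) set" where
  "Lev L = {f \<in> Ms. \<forall>w\<in>W. f w \<in> Graded {..L - int (E w)}}"

lemma Lev_simps: "0 \<in> Lev L" "f \<in> Lev L \<Longrightarrow> g \<in> Lev L \<Longrightarrow> f + g \<in> Lev L" "f \<in> Lev L \<Longrightarrow> scale c f \<in> Lev L"
  "f \<in> Lev L \<Longrightarrow> g \<in> Lev L \<Longrightarrow> f - g \<in> Lev L"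
  by (simp_all add: Lev_def Ms_simps fun_apply Graded_add Graded_diff) (simp add: scale_def Graded_Cst_mult)

lemma Lev_sum: "(\<And>i. i \<in> I \<Longrightarrow> f i \<in> Lev L) \<Longrightarrow> sum f I \<in> Lev L"
  by (auto simp: Lev_def sum_fun_apply intro!: Ms_sum Graded_sum)

lemma dl_Lev: "w \<in> W \<Longrightarrow> F \<in> Graded {..L - int (E w)} \<Longrightarrow> dl w F \<in> Lev L"
  by (auto simp: Lev_def Ms_simps) (simp add: dl_def)

lemma trn_refl_W: "w \<in> W \<Longrightarrow> v \<in> R \<Longrightarrow> trn b (reflection v) w \<in> W"
  by (simp add: trn_W W_refl)

lemma DD_Graded: "F \<in> Graded A \<Longrightarrow> DD b v F \<in> Graded ((\<lambda>j. j - 1) ` A)"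
  unfolding DD_def by (intro Graded_dd linear_form_simps linear_form_lin)

lemma pd_Graded: "F \<in> Graded A \<Longrightarrow> pd z F \<in> Graded ((\<lambda>j. j - 1) ` A)"
  by (intro Graded_dd linear_form_simps)

lemma del_Graded: "F \<in> Graded A \<Longrightarrow> del a F \<in> Graded ((\<lambda>j. j - 1) ` A)"
  unfolding del_def by (rule pd_Graded)

lemma R0_Graded: "F \<in> Graded A \<Longrightarrow> R0 w F \<in> Graded ((\<lambda>j. j - 2) ` A)"
proof -
  assume F: "F \<in> Graded A"
  have "pd z (del a F) \<in> Graded ((\<lambda>j. j - 2) ` A)" for z a
    by (rule Graded_mono[OF pd_Graded[OF del_Graded[OF F]]]) auto
  then show ?thesis unfolding R0_def mult_minus_left
    by (intro Graded_uminus Graded_Cst_mult Graded_sum)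
qed

text \<open>The difference quotient lowers the degree by one, while the reflection raises
  \<open>E\<close> by at most one. If the vector lies in the eigenspace, the roots orthogonal to it
  drop out and every other reflection lowers \<open>E\<close>, which gains two levels.\<close>

lemma Qt_Lev:
  assumes w: "w \<in> W" and F: "F \<in> Graded {..j}"
  shows "Qt b w u F \<in> Lev (j + int (E w))" "Qt b w (p w u) F \<in> Lev (j - 2 + int (E w))"
proof -
  have D: "DD c v F \<in> Graded {..j - 1}" for c v
    by (rule Graded_mono[OF DD_Graded[OF F]]) auto
  show "Qt b w u F \<in> Lev (j + int (E w))"
    unfolding Qt_def
  proof (intro Lev_sum Lev_simps(3) dl_Lev trn_refl_W w)
    fix v assume v: "v \<in> R"
    show "DD (\<not> b) v F \<in> Graded {..j + int (E w) - int (E (trn (\<not> b) (reflection v) w))}"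
      using E_trn_le[OF w v, of "\<not> b"] by (intro Graded_mono[OF D]) auto
  qed
  show "Qt b w (p w u) F \<in> Lev (j - 2 + int (E w))"
    unfolding Qt_def
  proof (intro Lev_sum)
    fix v assume v: "v \<in> R"
    show "scale (c0 v * ir (p w u \<bullet> v)) (dl (trn (\<not> b) (reflection v) w) (DD (\<not> b) v F)) \<in> Lev (j - 2 + int (E w))"
    proof (cases "p w u \<bullet> v = 0")
      case False
      show ?thesis using E_trn_less[OF w v False, of "\<not> b"]
        by (intro Lev_simps(3) dl_Lev trn_refl_W w v Graded_mono[OF D]) auto
    qed (simp add: ir_simps scale_simps Lev_simps)
  qed
qed

text \<open>In the Koszul half of \<open>Q\<close> the derivative lowers the level by one before
  \<open>Qt\<close> acts. In the de Rham half the multiplication raises it by one, but there the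
  vectors are projected and the sharper bound of \<open>Qt_Lev\<close> takes off two.\<close>

lemma Gam_Lev: "f \<in> Lev L \<Longrightarrow> Gam f \<in> Lev (L - 1)"
proof -
  assume f: "f \<in> Lev L"
  have "Gam (dl w (f w)) \<in> Lev (L - 1)" if w: "w \<in> W" for w
  proof -
    let ?F = "rho w (f w)"
    have F: "?F \<in> Graded {..L - int (E w)}"
      using f w by (auto simp: Lev_def rho_def intro: degree_scale_in_Graded)
    have d: "del a ?F \<in> Graded {..L - 1 - int (E w)}" for a
      by (rule Graded_mono[OF del_Graded[OF F]]) auto
    have x: "X a * ?F \<in> Graded {..L + 1 - int (E w)}" for a
      by (rule Graded_mono[OF Graded_X_mult[OF F]]) auto
    have "Qt b w u (del a ?F) \<in> Lev (L - 1)" for a b u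
      using Qt_Lev(1)[OF w d] by simp
    moreover have "Qt b w (p w u) (X a * ?F) \<in> Lev (L - 1)" for a b u
      using Qt_Lev(2)[OF w x] by simp
    moreover have "R0 w ?F \<in> Graded {..L - 1 - int (E w)}"
      by (rule Graded_mono[OF R0_Graded[OF F]]) auto
    ultimately show ?thesis unfolding Gam_dl'[OF w] Q_def
      by (intro Lev_simps Lev_sum dl_Lev w)
  qed
  moreover have "Gam f = (\<Sum>w\<in>W. Gam (dl w (f w)))"
  proof -
    have "f \<in> Ms" using f by (simp add: Lev_def)
    then have "Gam f = Gam (\<Sum>w\<in>W. dl w (f w))" by (simp only: Ms_expand[symmetric])
    then show ?thesis by (simp only: linear_opD(6)[OF linear_Gam])
  qed
  ultimately show ?thesis by (simp add: Lev_sum)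
qed

lemma Lev_neg:
  assumes "f \<in> Lev L" "L < 0"
  shows "f = 0"
proof (rule Ms_eqI)
  fix w assume "w \<in> W"
  then show "f w = 0 w"
    using assms Graded_atMost_neg[of "f w" "L - int (E w)"] by (simp add: Lev_def fun_apply)
qed (use assms in \<open>simp_all add: Lev_def Ms_simps\<close>)

lemma Graded_ex: "\<exists>n. F \<in> Graded {..int n}"
proof (induction F rule: poly_mapping_single_induct)
  case (single m c)
  show ?case by (rule exI[of _ "size m"]) (simp add: Graded_single)
next
  case (add f g)
  then obtain m n where "f \<in> Graded {..int m}" "g \<in> Graded {..int n}" by blast
  then have "f \<in> Graded {..int (max m n)}" "g \<in> Graded {..int (max m n)}"
    using Graded_mono[of f "{..int m}" "{..int (max m n)}"] Graded_mono[of g "{..int n}" "{..int (max m n)}"]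
    by simp_all
  then have "f + g \<in> Graded {..int (max m n)}" by (rule Graded_add)
  then show ?case by blast
qed simp

lemma Lev_mono:
  assumes "f \<in> Lev L" "L \<le> L'"
  shows "f \<in> Lev L'"
proof -
  have "f w \<in> Graded {..L' - int (E w)}" if "w \<in> W" for w
    by (rule Graded_mono[of _ "{..L - int (E w)}"]) (use assms that in \<open>auto simp: Lev_def\<close>)
  then show ?thesis using assms by (simp add: Lev_def)
qed

lemma Lev_ex: "f \<in> Ms \<Longrightarrow> \<exists>n. f \<in> Lev (int n)"
proof (induction rule: Ms_induct)
  case zero
  then show ?case using Lev_simps(1) by blast
next
  case (dl w F)
  obtain n where "F \<in> Graded {..int n}" using Graded_ex by blast
  then have "dl w F \<in> Lev (int (n + E w))" using dl by (intro dl_Lev) auto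
  then show ?case by blast
next
  case (add f g)
  then obtain m n where "f \<in> Lev (int m)" "g \<in> Lev (int n)" by blast
  then have "f \<in> Lev (int (max m n))" "g \<in> Lev (int (max m n))"
    using Lev_mono[of f "int m" "int (max m n)"] Lev_mono[of g "int n" "int (max m n)"] by simp_all
  then have "f + g \<in> Lev (int (max m n))" by (rule Lev_simps)
  then show ?case by blast
qed

lemma Gam_pow_Ms: "f \<in> Ms \<Longrightarrow> (Gam ^^ n) f \<in> Ms"
  by (induction n) (auto intro: Gam_Ms)

lemma Gam_nilpotent: "f \<in> Ms \<Longrightarrow> \<exists>N. (Gam ^^ N) f = 0"
proof -
  assume "f \<in> Ms"
  then obtain n where f: "f \<in> Lev (int n)" using Lev_ex by blast
  have "(Gam ^^ k) f \<in> Lev (int n - int k)" for k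
  proof (induction k)
    case (Suc k)
    have eq: "int n - int (Suc k) = int n - int k - 1" by simp
    show ?case unfolding eq using Gam_Lev[OF Suc] by simp
  qed (use f in simp)
  from Lev_neg[OF this[of "n + 1"]] have "(Gam ^^ (n + 1)) f = 0" by simp
  then show ?thesis by (rule exI)
qed

lemma act2_Graded: "F \<in> Graded A \<Longrightarrow> act2 g F \<in> Graded A"
proof -
  have "linear_form (act_var b g a)" for a b
    by (cases a) (auto simp: act_var_apply intro: linear_form_lin linear_form_simps)
  then show "F \<in> Graded A \<Longrightarrow> act2 g F \<in> Graded A"
    unfolding act2_def act_def by (intro Graded_sub)
qed

lemma ct_act2: "ct (act2 g F) = ct F"
proof -
  have lin: "ct (lin b u) = 0" for b u by (simp add: lin_def ct_simps)
  have "ct (act b g F) = ct F" for b F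
    unfolding act_def
    by (rule ring_map_eqI[where F = "\<lambda>F. ct (sub (act_var b g) F)"])
      (auto intro!: ring_map_compose[OF ring_map_ct] ring_map_sub ring_map_ct simp: act_var_def lin split: prod.split)
  then show ?thesis by (simp add: act2_def)
qed

lemma rho_conj: "w \<in> W \<Longrightarrow> g \<in> W \<Longrightarrow> rho (g \<circ> w \<circ> inv_into UNIV g) (act2 g F) = act2 g (rho w F)"
  by (induction F rule: homogeneous_decomposition)
    (simp_all add: rho_Graded rho_Graded[OF act2_Graded] act2_simps E_conj rho_simps)

lemma cpart_conj: "w \<in> W \<Longrightarrow> g \<in> W \<Longrightarrow> cpart (g \<circ> w \<circ> inv_into UNIV g) (act2 g F) = act2 g (cpart w F)"
  by (simp add: cpart_def E_conj ct_act2 act2_simps)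

lemma Ad_Gam: "g \<in> W \<Longrightarrow> f \<in> Ms \<Longrightarrow> Gam (Ad g f) = Ad g (Gam f)"
proof (rotate_tac 1, induction rule: Ms_induct)
  case zero
  then show ?case by (simp add: linear_opD[OF linear_Gam] linear_opD[OF linear_Ad])
next
  case (dl w F)
  then show ?case
    by (simp only: Ad_dl2 Gam_dl cj_W linear_opD[OF linear_Ad] Ad_GG1 rho_conj cpart_conj act2_simps)
next
  case (add f g)
  then show ?case by (simp add: linear_opD[OF linear_Gam] linear_opD[OF linear_Ad])
qed

end

section \<open>Construction of the functionals\<close>

context calogero_twist
begin

text \<open>The initial data of the recursion: values are prescribed on the kernel of
  \<open>J\<close>, which \<open>cpart\<close> picks out.\<close>

definition phi :: "((real^'n \<Rightarrow> real^'n) \<Rightarrow> 'k) \<Rightarrow> ((real^'n \<Rightarrow> real^'n) \<Rightarrow> (bool \<times> 'n, 'k) mpol) \<Rightarrow> 'k" where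
  "phi a f = (\<Sum>w\<in>W. a w * ct (cpart w (f w)))"

text \<open>Since \<open>Gam\<close> is locally nilpotent, the recursion \<open>sp f = phi f + sp (Gam f)\<close> has a unique solution.\<close>

definition sp where
  "sp a f = (\<Sum>n<(LEAST N. (Gam ^^ N) f = 0). phi a ((Gam ^^ n) f))"

lemma phi_simps: "phi a (f + g) = phi a f + phi a g" "phi a (scale c f) = c * phi a f" "phi a 0 = 0"
  by (simp_all add: phi_def fun_apply scale_def cpart_simps ct_simps distrib_left sum.distrib sum_distrib_left mult.left_commute)

lemma Gam_pow_0: "(Gam ^^ n) 0 = 0"
  by (induction n) (simp_all add: linear_opD[OF linear_Gam])

lemma Gam_pow_add: "(Gam ^^ n) (f + g) = (Gam ^^ n) f + (Gam ^^ n) g"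
  and Gam_pow_scale: "(Gam ^^ n) (scale c f) = scale c ((Gam ^^ n) f)"
  by (induction n) (simp_all add: linear_opD[OF linear_Gam])

lemma sp_eq:
  assumes N: "(Gam ^^ N) f = 0"
  shows "sp a f = (\<Sum>n<N. phi a ((Gam ^^ n) f))"
proof -
  let ?M = "LEAST N. (Gam ^^ N) f = 0"
  have M: "(Gam ^^ ?M) f = 0" "?M \<le> N"
    using N by (rule LeastI, intro Least_le)
  have "(Gam ^^ n) f = 0" if "?M \<le> n" for n
  proof -
    have "(Gam ^^ n) f = (Gam ^^ (n - ?M)) ((Gam ^^ ?M) f)"
      using that by (simp add: funpow_add[symmetric, THEN fun_cong, simplified])
    then show ?thesis by (simp add: M(1) Gam_pow_0)
  qed
  then show ?thesis unfolding sp_def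
    by (intro sum.mono_neutral_left) (use M(2) in \<open>auto simp: phi_simps not_less\<close>)
qed

lemma common_N:
  assumes "f \<in> Ms" "g \<in> Ms"
  obtains N where "(Gam ^^ N) f = 0" "(Gam ^^ N) g = 0"
proof -
  obtain M N where "(Gam ^^ M) f = 0" "(Gam ^^ N) g = 0" using Gam_nilpotent assms by metis
  then have "(Gam ^^ (N + M)) f = 0" "(Gam ^^ (M + N)) g = 0"
    by (simp_all only: funpow_add comp_apply Gam_pow_0)
  then show ?thesis using that[of "M + N"] by (simp only: add.commute)
qed

lemma sp_add:
  assumes "f \<in> Ms" "g \<in> Ms"
  shows "sp a (f + g) = sp a f + sp a g"
proof -
  obtain N where N: "(Gam ^^ N) f = 0" "(Gam ^^ N) g = 0" using common_N[OF assms] by metis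
  then have "(Gam ^^ N) (f + g) = 0" by (simp add: Gam_pow_add)
  then show ?thesis
    unfolding sp_eq[OF N(1)] sp_eq[OF N(2)] by (simp only: sp_eq Gam_pow_add phi_simps sum.distrib)
qed

lemma sp_scale:
  assumes "f \<in> Ms"
  shows "sp a (scale c f) = c * sp a f"
proof -
  obtain N where N: "(Gam ^^ N) f = 0" using Gam_nilpotent[OF assms] by metis
  then have "(Gam ^^ N) (scale c f) = 0" by (simp add: Gam_pow_scale scale_simps)
  then show ?thesis
    unfolding sp_eq[OF N] by (simp only: sp_eq Gam_pow_scale phi_simps sum_distrib_left)
qed

lemma sp_0: "sp a 0 = 0"
  using sp_eq[of 0 0 a] by simp

lemma sp_uminus: "f \<in> Ms \<Longrightarrow> sp a (- f) = - sp a f"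
  using sp_scale[of f a "- 1"] by (simp add: scale_simps)

lemma sp_diff: "f \<in> Ms \<Longrightarrow> g \<in> Ms \<Longrightarrow> sp a (f - g) = sp a f - sp a g"
  using sp_add[of f "- g" a] by (simp add: sp_uminus Ms_simps)

lemma sp_sum:
  assumes "finite I" "\<And>i. i \<in> I \<Longrightarrow> f i \<in> Ms"
  shows "sp a (sum f I) = (\<Sum>i\<in>I. sp a (f i))"
  using assms
proof (induction I rule: finite_induct)
  case (insert i I)
  then have "sum f I \<in> Ms" by (intro Ms_sum) auto
  then show ?case unfolding sum.insert[OF insert(1,2)] using insert by (simp add: sp_add)
qed (simp only: sum.empty sp_0)

lemma sp_rec:
  assumes "f \<in> Ms"
  shows "sp a f = phi a f + sp a (Gam f)"
proof -
  obtain N where N: "(Gam ^^ N) f = 0" using Gam_nilpotent[OF assms] by metis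
  then have N': "(Gam ^^ N) (Gam f) = 0" "(Gam ^^ Suc N) f = 0"
    by (metis funpow_swap1 linear_opD(3)[OF linear_Gam], simp add: linear_opD[OF linear_Gam])
  have "sp a f = (\<Sum>n<Suc N. phi a ((Gam ^^ n) f))" by (rule sp_eq[OF N'(2)])
  also have "\<dots> = phi a f + (\<Sum>n<N. phi a ((Gam ^^ n) (Gam f)))"
    by (subst sum.lessThan_Suc_shift) (simp add: funpow_swap1)
  finally show ?thesis by (simp add: sp_eq[OF N'(1)])
qed

text \<open>Applied to \<open>J\<close> of f, the recursion has no initial term, because
  \<open>cpart\<close> kills the image of \<open>J\<close>. Since \<open>rho\<close> undoes
  \<open>J\<close> up to constants annihilated by \<open>GG1\<close>, its remainder is J f - GG
  f.\<close>

lemma sp_GG: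
  assumes f: "f \<in> Ms"
  shows "sp a (GG f) = 0"
proof -
  let ?f = "\<lambda>w. J w (f w)"
  have J0: "J w 0 = 0" for w by (simp add: J_def eul_def del_def)
  have fM: "?f \<in> Ms" using f by (auto simp: Ms_def J0)
  have "GG (\<lambda>w. rho w (?f w)) = GG f"
    unfolding GG_def rho_J
  proof (rule sum.cong[OF refl])
    fix w assume "w \<in> W"
    then show "GG1 w (f w - cpart w (f w)) = GG1 w (f w)"
      using linear_GG1(1)[of w "f w - cpart w (f w)" "cpart w (f w)"] GG1_cpart by simp
  qed
  then have "Gam ?f = ?f - GG f" unfolding Gam_def by (simp add: cpart_J)
  then have "sp a (GG f) = sp a ?f - sp a (Gam ?f)"
    using sp_diff[OF fM GG_Ms, of a f] by simp
  also have "\<dots> = phi a ?f" by (subst sp_rec[OF fM]) simp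
  finally show ?thesis by (simp add: phi_def cpart_J ct_simps)
qed

lemma sp_dl_one: "w \<in> W \<Longrightarrow> E w = 0 \<Longrightarrow> sp a (dl w 1) = a w"
proof -
  assume w: "w \<in> W" "E w = 0"
  have 1: "cpart w 1 = 1" using w by (simp add: cpart_def ct_simps Cst_simps)
  have "rho w 1 = rho w (cpart w 1)" by (simp add: 1)
  \<comment> \<open>For degree 0 and \<open>E w = 0\<close> the factor in \<open>rho\<close> is
    \<open>1 / 0\<close>, which is 0.\<close>
  also have "rho w (cpart w 1) = 0"
    using rho_Graded[of 1 0 w] w by (simp add: 1 Graded_def ir_simps Cst_simps)
  finally have "Gam (dl w 1) = 0" by (simp add: Gam_dl w 1 dl_simps GG1_0)
  moreover have "phi a (dl w 1) = (\<Sum>w'\<in>W. if w' = w then a w else 0)"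
    unfolding phi_def by (rule sum.cong) (auto simp: dl_def 1 cpart_simps ct_simps)
  ultimately show ?thesis using w sp_rec[OF Ms_simps(6)[OF w(1)], of a 1] finite_W by (simp add: sp_0)
qed

definition class_function :: "((real^'n \<Rightarrow> real^'n) \<Rightarrow> 'k) \<Rightarrow> bool" where
  "class_function a \<longleftrightarrow> (\<forall>w\<in>W. \<forall>g\<in>W. a (g \<circ> w \<circ> inv_into UNIV g) = a w)"

context
  fixes a :: "(real^'n \<Rightarrow> real^'n) \<Rightarrow> 'k"
  assumes class_function: "class_function a"
begin

lemma class_function_conj: "w \<in> W \<Longrightarrow> g \<in> W \<Longrightarrow> a (g \<circ> w \<circ> inv_into UNIV g) = a w"
  using class_function by (simp add: class_function_def)

lemma phi_dl: "w \<in> W \<Longrightarrow> phi a (dl w F) = a w * ct (cpart w F)"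
proof -
  assume w: "w \<in> W"
  have "phi a (dl w F) = (\<Sum>w'\<in>W. if w' = w then a w * ct (cpart w F) else 0)"
    unfolding phi_def by (rule sum.cong) (auto simp: dl_def cpart_simps ct_simps)
  then show ?thesis using w finite_W by simp
qed

lemma phi_Ad: "f \<in> Ms \<Longrightarrow> g \<in> W \<Longrightarrow> phi a (Ad g f) = phi a f"
proof (induction rule: Ms_induct)
  case (dl w F)
  then show ?case by (simp only: Ad_dl2 phi_dl cj_W class_function_conj cpart_conj ct_act2)
qed (simp_all add: linear_opD[OF linear_Ad] phi_simps)

lemma sp_Ad:
  assumes f: "f \<in> Ms" and g: "g \<in> W"
  shows "sp a (Ad g f) = sp a f"
proof -
  obtain N where N: "(Gam ^^ N) f = 0" using Gam_nilpotent[OF f] by metis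
  have pow: "(Gam ^^ n) (Ad g f) = Ad g ((Gam ^^ n) f)" for n
    by (induction n) (simp_all add: Ad_Gam g Gam_pow_Ms f)
  then have "(Gam ^^ N) (Ad g f) = 0" by (simp add: N linear_opD[OF linear_Ad])
  then show ?thesis
    unfolding sp_eq[OF N] by (simp only: sp_eq pow phi_Ad Gam_pow_Ms f g)
qed

lemma refl_refl_id: "reflection v \<circ> reflection v = id"
  by (auto simp: fun_eq_iff reflection_reflection)

text \<open>For a reflection r, conjugating f r by r gives r f, because r is an involution.\<close>

lemma sp_sh_refl:
  assumes f: "f \<in> Ms" and v: "v \<in> R"
  shows "sp a (sh b (reflection v) f) = sp a (sh (\<not> b) (reflection v) f)"
proof -
  note W_refl[OF v, simp]
  have "sh True (reflection v) (sh False (reflection v) (sh (\<not> b) (reflection v) f)) = sh b (reflection v) f"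
    using sh_sh(2)[of "reflection v" "reflection v" True]
    by (cases b) (simp_all add: sh_sh(1) refl_refl_id sh_id)
  then show ?thesis using sp_Ad[of "sh (\<not> b) (reflection v) f" "reflection v"]
    by (simp add: Ad_def sh_Ms f)
qed

text \<open>The reflection terms of \<open>T_T_other\<close> are differences of left and right
  multiplication and cancel under \<open>sp\<close>. Only this makes it possible to move
  \<open>T c u\<close> into the contraction.\<close>

lemma sp_T_T:
  assumes f: "f \<in> Ms"
  shows "sp a (T b u (T c x f)) = sp a (T c x (T b u f))"
proof (cases "b = c")
  case False
  then have c: "c = (\<not> b)" by simp
  have M: "sh c (reflection v) f \<in> Ms" if "v \<in> R" for v c by (intro sh_Ms W_refl that f)
  let ?S = "\<Sum>v\<in>R. scale (cc v * ir (u \<bullet> v) * ir (v \<bullet> x)) (sh b (reflection v) f - sh (\<not> b) (reflection v) f)"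
  have SM: "?S \<in> Ms" by (intro Ms_sum Ms_simps M)
  have "sp a ?S =
    (\<Sum>v\<in>R. (cc v * ir (u \<bullet> v) * ir (v \<bullet> x)) * (sp a (sh b (reflection v) f) - sp a (sh (\<not> b) (reflection v) f)))"
    by (subst sp_sum) (auto simp: R_props M Ms_simps sp_scale sp_diff)
  also have "\<dots> = 0" using sp_sh_refl[OF f, of _ b] by simp
  finally have "sp a (scale (ir \<kappa>) ?S) = 0" by (simp only: sp_scale[OF SM] mult_zero_right)
  then show ?thesis unfolding c T_T_other[OF f]
    using sp_add[OF T_Ms[OF T_Ms[OF f]] Ms_simps(3)[OF SM]] by simp
qed (simp add: T_T_same[OF f])

section \<open>Moving \<open>T c u\<close> past the contraction; divisibility by powers of
  \<open>s\<close>\<close>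

abbreviation ny where "ny b w u \<equiv> u - \<kappa> *\<^sub>R tw (\<not> b) w u"

text \<open>The part of \<open>T b u\<close> without reflections, as an operator on the component at
  w (\<open>T_dl_Eg\<close>).\<close>

definition Eg where
  "Eg b w u F = lin b (ny b w u) * F - Cst (ir \<kappa>) * pd (dir (\<not> b) u) F"

lemma T_dl_Eg: "w \<in> W \<Longrightarrow> T b u (dl w F) = dl w (Eg b w u F) - scale s (scale (ir \<kappa>) (Qt b w u F))"
  unfolding T_dl Eg_def Qt_def by (simp add: scale_simps)

text \<open>As \<open>Eg\<close> is a linear form plus a derivative, moving it past a partial
  derivative or a variable (\<open>Eg_X\<close>) leaves only a scalar multiple of F. These scalars
  add up to the extra term of \<open>commuted_homotopy\<close>.\<close>

lemma Eg_del: "Eg c w u (del (b, j) F) = del (b, j) (Eg c w u F) - (if b = c then Cst (ir (ny c w u $ j)) * F else 0)"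
  by (auto simp: Eg_def del_eq dd_diff dd_Cst_mult pd_mult dd_lin inner_axis' pd_pd_commute[of _ "dir _ (e j)"])

lemma Eg_X: "Eg c w u (X (\<not> b, j) * F) = X (\<not> b, j) * Eg c w u F - (if b = c then Cst (ir \<kappa>) * (Cst (ir (u $ j)) * F) else 0)"
  by (cases b; cases c; simp add: Eg_def dd_X_mult dir_apply Cst_simps; simp add: algebra_simps)

lemma Qt_Ms: "w \<in> W \<Longrightarrow> Qt b w u F \<in> Ms"
  unfolding Qt_def by (intro Ms_sum Ms_simps trn_refl_W)

text \<open>The scalar terms of \<open>Eg_X\<close> sum to \<open>T c (p w u)\<close> and those of
  \<open>Eg_del\<close> to - \<open>T c (q c w (ny c w u))\<close>; the vector in the latter is u -
  p u, whence 2 p u - u. \<open>H\<close> collects the reflection parts. As a combination of values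
  of \<open>T\<close> it inherits any divisibility known for them, and nothing else about it is
  exported.\<close>

lemma commuted_homotopy:
  assumes w: "w \<in> W"
  shows "\<exists>H\<in>Ms. (\<forall>k. (\<forall>b u f. f \<in> Ms \<longrightarrow> s ^ k dvd sp a (T b u f)) \<longrightarrow> s ^ k dvd sp a H) \<and>
    (\<Sum>b\<in>UNIV. \<Sum>j\<in>UNIV. T b (q b w (e j)) (T c u (dl w (del (b, j) F)))
     - scale (ir \<kappa>) (T b (p w (e j)) (T c u (dl w (X (\<not> b, j) * F)))))
    = GG1 w (Eg c w u F) + T c (2 *\<^sub>R p w u - u) (dl w F) - scale s H"
proof -
  define H where "H = (\<Sum>b\<in>UNIV. \<Sum>j\<in>UNIV. T b (q b w (e j)) (scale (ir \<kappa>) (Qt c w u (del (b, j) F)))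
     - scale (ir \<kappa>) (T b (p w (e j)) (scale (ir \<kappa>) (Qt c w u (X (\<not> b, j) * F)))))"
  let ?d = "\<lambda>G. dl w G"
  note dM = Ms_simps(6)[OF w]
  have M: "T b x (scale (ir \<kappa>) (Qt c w u G)) \<in> Ms" for b x G
    by (intro T_Ms Ms_simps Qt_Ms w)
  have HM: "H \<in> Ms" unfolding H_def by (intro Ms_sum Ms_simps M)
  moreover have "s ^ k dvd sp a H" if "\<And>b u f. f \<in> Ms \<Longrightarrow> s ^ k dvd sp a (T b u f)" for k
  proof -
    have "sp a H = (\<Sum>b\<in>UNIV. \<Sum>j\<in>UNIV. sp a (T b (q b w (e j)) (scale (ir \<kappa>) (Qt c w u (del (b, j) F))))
     - ir \<kappa> * sp a (T b (p w (e j)) (scale (ir \<kappa>) (Qt c w u (X (\<not> b, j) * F)))))"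
      unfolding H_def by (simp add: sp_sum sp_diff sp_scale M Ms_simps Ms_sum)
    then show ?thesis using w
      by (auto intro!: dvd_sum dvd_diff dvd_mult that Ms_simps Qt_Ms)
  qed
  moreover have "(\<Sum>b\<in>UNIV. \<Sum>j\<in>UNIV. T b (q b w (e j)) (T c u (?d (del (b, j) F)))
     - scale (ir \<kappa>) (T b (p w (e j)) (T c u (?d (X (\<not> b, j) * F)))))
    = GG1 w (Eg c w u F) + T c (2 *\<^sub>R p w u - u) (dl w F) - scale s H"
  proof -
    have t: "T b (q b w (e j)) (T c u (?d (del (b, j) F))) - scale (ir \<kappa>) (T b (p w (e j)) (T c u (?d (X (\<not> b, j) * F))))
      = (T b (q b w (e j)) (?d (del (b, j) (Eg c w u F))) - scale (ir \<kappa>) (T b (p w (e j)) (?d (X (\<not> b, j) * Eg c w u F))))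
       + (if b = c then scale (ir (u $ j)) (T b (p w (e j)) (?d F)) - scale (ir (ny c w u $ j)) (T b (q b w (e j)) (?d F)) else 0)
       - scale s (T b (q b w (e j)) (scale (ir \<kappa>) (Qt c w u (del (b, j) F)))
         - scale (ir \<kappa>) (T b (p w (e j)) (scale (ir \<kappa>) (Qt c w u (X (\<not> b, j) * F)))))" for b j
    proof -
      have kk: "scale (ir \<kappa>) (scale (ir \<kappa>) f) = f" for f :: "(real^'n \<Rightarrow> real^'n) \<Rightarrow> (bool \<times> 'n, 'k) mpol"
        by (simp add: scale_simps ir_kk)
      have ss: "scale (ir \<kappa>) (scale s f) = scale s (scale (ir \<kappa>) f)" for f :: "(real^'n \<Rightarrow> real^'n) \<Rightarrow> (bool \<times> 'n, 'k) mpol"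
        by (simp add: scale_simps mult.commute)
      show ?thesis
        unfolding T_dl_Eg[OF w, of c u] Eg_del Eg_X
        by (cases "b = c") (simp_all only: simp_thms if_True if_False diff_zero dl_simps T_simps scale_simps(5,6) kk ss,
          simp_all add: algebra_simps)
    qed
    have qs: "(\<Sum>j\<in>UNIV. scale (ir (x $ j)) (T c (L (e j)) (?d F))) = T c (L x) (?d F)" if "linear L" for L x
    proof -
      have "(\<Sum>j\<in>UNIV. scale (ir (x $ j)) (T c (L (e j)) (?d F))) = T c (\<Sum>j\<in>UNIV. x $ j *\<^sub>R L (e j)) (?d F)"
        by (simp add: T_dir_sum dM T_dir_scale)
      then show ?thesis using linear_expand[OF that, of x] by simp
    qed
    have "(\<Sum>b\<in>UNIV. \<Sum>j\<in>UNIV. if b = c then scale (ir (u $ j)) (T b (p w (e j)) (?d F)) - scale (ir (ny c w u $ j)) (T b (q b w (e j)) (?d F)) else 0)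
       = (\<Sum>j\<in>UNIV. scale (ir (u $ j)) (T c (p w (e j)) (?d F)) - scale (ir (ny c w u $ j)) (T c (q c w (e j)) (?d F)))"
      by (cases c) (simp_all add: UNIV_bool)
    also have "\<dots> = T c (p w u) (?d F) - T c (q c w (ny c w u)) (?d F)"
      unfolding sum_subtractf qs[OF linear_p[OF w]] qs[OF linear_q[OF w]] ..
    also have "\<dots> = T c (2 *\<^sub>R p w u - u) (?d F)"
      unfolding tw_q[OF w] T_dir_diff[OF dM, symmetric] by (rule arg_cong[where f = "\<lambda>u. T c u (?d F)"]) (simp add: scaleR_2)
    finally have S: "(\<Sum>b\<in>UNIV. \<Sum>j\<in>UNIV. if b = c then scale (ir (u $ j)) (T b (p w (e j)) (?d F)) - scale (ir (ny c w u $ j)) (T b (q b w (e j)) (?d F)) else 0)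
       = T c (2 *\<^sub>R p w u - u) (?d F)" .
    show ?thesis unfolding t sum.distrib sum_subtractf S scale_sum[symmetric] scale_simps(6)[symmetric]
      unfolding GG1_def H_def sum_subtractf scale_sum scale_simps(6) ..
  qed
  ultimately show ?thesis by blast
qed

text \<open>Two evaluations of \<open>sp\<close> on \<open>T c u (GG1 w F)\<close> are compared.
  Expanding the contraction gives the factor m + 2 E w; commuting \<open>T c u\<close> into it gives
  the vector 2 p u - u, because \<open>sp\<close> kills \<open>GG\<close>. The reflection terms on
  both sides carry a factor s in front of values divisible by \<open>s ^ k\<close>.\<close>

lemma T_dvd_step:
  assumes IH: "\<And>b u f. f \<in> Ms \<Longrightarrow> s ^ k dvd sp a (T b u f)"
    and w: "w \<in> W" and u: "p w u = u \<or> p w u = 0" and F: "F \<in> Graded {int m}"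
  shows "s ^ Suc k dvd sp a (T c u (dl w F))"
  using F
proof (induction m arbitrary: F rule: less_induct)
  case (less m)
  note F = less.prems
  note dM = Ms_simps(6)[OF w]
  obtain H where H: "H \<in> Ms" "s ^ k dvd sp a H" and
    eq: "(\<Sum>b\<in>UNIV. \<Sum>j\<in>UNIV. T b (q b w (e j)) (T c u (dl w (del (b, j) F)))
     - scale (ir \<kappa>) (T b (p w (e j)) (T c u (dl w (X (\<not> b, j) * F)))))
    = GG1 w (Eg c w u F) + T c (2 *\<^sub>R p w u - u) (dl w F) - scale s H"
    using commuted_homotopy[OF w, of c u F] IH by blast
  have TM: "T b x (T b' y (dl w G)) \<in> Ms" for b x b' y G by (intro T_Ms dM)
  have "sp a (T c u (GG1 w F)) = (\<Sum>b\<in>UNIV. \<Sum>j\<in>UNIV. sp a (T c u (T b (q b w (e j)) (dl w (del (b, j) F))))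
     - ir \<kappa> * sp a (T c u (T b (p w (e j)) (dl w (X (\<not> b, j) * F)))))"
    unfolding GG1_def by (simp add: T_simps sp_sum sp_diff sp_scale TM Ms_simps Ms_sum)
  also have "\<dots> = (\<Sum>b\<in>UNIV. \<Sum>j\<in>UNIV. sp a (T b (q b w (e j)) (T c u (dl w (del (b, j) F))))
     - ir \<kappa> * sp a (T b (p w (e j)) (T c u (dl w (X (\<not> b, j) * F)))))"
    by (simp add: sp_T_T[OF dM, of c u])
  also have "\<dots> = sp a (GG1 w (Eg c w u F) + T c (2 *\<^sub>R p w u - u) (dl w F) - scale s H)"
    unfolding eq[symmetric] by (simp add: sp_sum sp_diff sp_scale TM Ms_simps Ms_sum)
  also have "\<dots> = sp a (T c (2 *\<^sub>R p w u - u) (dl w F)) - s * sp a H"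
    using sp_GG[OF dM, of a "Eg c w u F"]
    by (simp add: sp_diff sp_add sp_scale Ms_simps GG1_Ms w T_Ms dM H GG_dl)
  finally have 1: "sp a (T c u (GG1 w F)) = sp a (T c (2 *\<^sub>R p w u - u) (dl w F)) - s * sp a H" .
  have QM: "Q w F \<in> Ms" unfolding Q_def by (intro Ms_simps Ms_sum Qt_Ms w)
  have "T c u (GG1 w F) = scale (ir (real (m + 2 * E w))) (T c u (dl w F)) + T c u (dl w (R0 w F)) - scale s (T c u (Q w F))"
    unfolding GG1_eq[OF w] J_Graded[OF F] dl_simps T_simps ..
  then have 2: "sp a (T c u (GG1 w F)) = ir (real (m + 2 * E w)) * sp a (T c u (dl w F)) + sp a (T c u (dl w (R0 w F)))
     - s * sp a (T c u (Q w F))"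
    by (simp add: sp_diff sp_add sp_scale Ms_simps T_Ms dM QM)
  \<comment> \<open>\<open>R0\<close> lowers the degree by two, so the induction on \<open>m\<close>
    applies; below degree two it is zero.\<close>
  have R0: "s ^ Suc k dvd sp a (T c u (dl w (R0 w F)))"
  proof (cases "m < 2")
    case True
    have "R0 w F = 0" using R0_Graded[OF F] True by (intro Graded_neg[of _ "int m - 2"]) auto
    then show ?thesis by (simp add: dl_simps T_simps sp_0)
  next
    case False
    have "R0 w F \<in> Graded {int (m - 2)}" using R0_Graded[OF F] False by (simp add: of_nat_diff)
    then show ?thesis using False by (intro less.IH[of "m - 2"]) auto
  qed
  have "s ^ Suc k dvd s * (sp a (T c u (Q w F)) - sp a H)"
    using IH[OF QM] H(2) by (auto intro!: mult_dvd_mono dvd_diff)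
  then have 3: "s ^ Suc k dvd ir (real (m + 2 * E w)) * sp a (T c u (dl w F)) - sp a (T c (2 *\<^sub>R p w u - u) (dl w F))"
  proof -
    have "ir (real (m + 2 * E w)) * sp a (T c u (dl w F)) - sp a (T c (2 *\<^sub>R p w u - u) (dl w F))
      = s * (sp a (T c u (Q w F)) - sp a H) - sp a (T c u (dl w (R0 w F)))"
      using trans[OF 2[symmetric] 1] by (simp add: algebra_simps)
    then show ?thesis using R0 \<open>s ^ Suc k dvd s * _\<close> by (simp only: dvd_diff)
  qed
  \<comment> \<open>For p u = 0 the difference has the factor m + 2 E w + 1. For p u = u it is m + 2
    E w - 1, nonzero because u \<noteq> 0 forces E w \<ge> 1.\<close>
  have "\<exists>r. r \<noteq> 0 \<and> ir (real (m + 2 * E w)) * sp a (T c u (dl w F)) - sp a (T c (2 *\<^sub>R p w u - u) (dl w F)) = ir r * sp a (T c u (dl w F))"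
    if "u \<noteq> 0"
  proof (cases "p w u = 0")
    case True
    have "sp a (T c (2 *\<^sub>R p w u - u) (dl w F)) = - sp a (T c u (dl w F))"
      using T_dir_scale[OF dM, of c "- 1" u F]
      by (simp add: True scale_simps ir_simps sp_uminus T_Ms dM)
    then show ?thesis by (intro exI[of _ "real (m + 2 * E w) + 1"]) (simp add: ir_simps algebra_simps)
  next
    case False
    then have pu: "p w u = u" using u by blast
    then have "2 *\<^sub>R p w u - u = u" by (simp add: scaleR_2)
    moreover have "E w \<ge> 1" using E_pos[OF w] False by blast
    ultimately show ?thesis by (intro exI[of _ "real (m + 2 * E w) - 1"]) (simp add: ir_simps algebra_simps)
  qed
  then show ?case
  proof (cases "u = 0")
    case True
    then show ?thesis by (simp add: T_dir_0[OF dM] sp_0)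
  next
    case False
    then obtain r where r: "r \<noteq> 0" "s ^ Suc k dvd ir r * sp a (T c u (dl w F))"
      using \<open>u \<noteq> 0 \<Longrightarrow> _\<close> 3 by metis
    have "ir (1 / r) * (ir r * sp a (T c u (dl w F))) = sp a (T c u (dl w F))"
      using r(1) by (simp add: mult.assoc[symmetric] ir_simps(4)[symmetric] ir_simps(2))
    then show ?thesis using r(2) by (metis dvd_mult)
  qed
qed

text \<open>Any \<open>u\<close> is the sum of p u and u - p u, and \<open>T_dvd_step\<close>
  applies to each of them on homogeneous polynomials.\<close>

lemma T_dvd: "f \<in> Ms \<Longrightarrow> s ^ k dvd sp a (T c u f)"
proof (induction k arbitrary: c u f)
  case (Suc k)
  from Suc.prems show ?case
  proof (induction rule: Ms_induct)
    case zero
    then show ?case by (simp add: T_simps sp_0)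
  next
    case (dl w F)
    note dM = Ms_simps(6)[OF dl] and lp = linear_p[OF dl]
    show ?case
    proof (induction F rule: homogeneous_decomposition)
      case (homogeneous m F)
      have "T c u (dl w F) = T c (p w u) (dl w F) + T c (u - p w u) (dl w F)"
        using T_dir_add[OF dM, of c "p w u" "u - p w u"] by simp
      moreover have "s ^ Suc k dvd sp a (T c (p w u) (dl w F))"
        using p_p[OF dl] by (intro T_dvd_step[OF Suc.IH dl _ homogeneous]) auto
      moreover have "s ^ Suc k dvd sp a (T c (u - p w u) (dl w F))"
        using p_p[OF dl] linear_diff[OF lp] by (intro T_dvd_step[OF Suc.IH dl _ homogeneous]) auto
      ultimately show ?case by (simp add: sp_add T_Ms dM del: power_Suc)
    next
      case (add F G)
      then show ?case by (simp add: dl_simps T_simps sp_add T_Ms dM del: power_Suc)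
    qed
  next
    case (add f g)
    then show ?case by (simp add: T_simps sp_add T_Ms del: power_Suc)
  qed
qed simp

end

end

section \<open>The action of the free superalgebra\<close>

type_synonym 'n gen = "('n, real^'n \<Rightarrow> real^'n) generator"

lemma two_cases: "(x :: 2) = 0 \<or> x = 1"
  using exhaust_2[of x] by auto

context calogero
begin

definition unit1 :: "(real^'n \<Rightarrow> real^'n) \<Rightarrow> (bool \<times> 'n, 'k) mpol" where
  "unit1 = dl id 1"

fun lop where
  "lop (Gen \<alpha> i) = (if \<alpha> = 0 then dun True (axis i 1) else mul True (axis i 1))"
| "lop (Grp g) = sh True g"

text \<open>Right multiplication by a letter. The inverse compensates that \<open>sh False g\<close>
  multiplies from the right by the inverse of g.\<close>

fun rop where
  "rop (Gen \<alpha> i) = (if \<alpha> = 0 then mul False (axis i 1) else dun False (axis i 1))"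
| "rop (Grp g) = sh False (inv_into UNIV g)"

definition wact :: "'n gen list \<Rightarrow> _" where
  "wact l m = foldr lop l m"

definition act_nc :: "'n observable \<Rightarrow> _" where
  "act_nc f m = (\<Sum>w\<in>Poly_Mapping.keys f. scale (\<iota> (Poly_Mapping.lookup f w)) (wact (letters w) m))"

lemma wact_simps: "wact [] m = m" "wact (a # l) m = lop a (wact l m)" "wact (l @ l') m = wact l (wact l' m)"
  by (simp_all add: wact_def)

lemma linear_lop: "linear_op (lop a)" and linear_rop: "linear_op (rop a)"
  by (cases a; simp add: linear_dun linear_mul linear_sh)+

lemma linear_wact: "linear_op (wact l)"
proof (induction l)
  case Nil
  show ?case by (simp add: wact_simps[abs_def] linear_op_id)
next
  case (Cons a l)
  then show ?case using linear_op_compose[OF linear_lop Cons] by (simp add: wact_simps[abs_def])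
qed

lemma letter_W: "a \<in> generators R \<Longrightarrow> (\<And>\<alpha> i. a = Gen \<alpha> i \<Longrightarrow> P) \<Longrightarrow> (\<And>g. a = Grp g \<Longrightarrow> g \<in> W \<Longrightarrow> P) \<Longrightarrow> P"
  by (auto simp: generators_def)

lemma lop_Ms: "a \<in> generators R \<Longrightarrow> m \<in> Ms \<Longrightarrow> lop a m \<in> Ms"
  by (auto elim!: letter_W simp: dun_Ms mul_Ms sh_Ms W_inv)

lemma wact_Ms: "set l \<subseteq> generators R \<Longrightarrow> m \<in> Ms \<Longrightarrow> wact l m \<in> Ms"
  by (induction l) (auto simp: wact_simps lop_Ms)

lemma act_nc_superset:
  assumes "finite A" "Poly_Mapping.keys f \<subseteq> A"
  shows "act_nc f m = (\<Sum>w\<in>A. scale (\<iota> (Poly_Mapping.lookup f w)) (wact (letters w) m))"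
  unfolding act_nc_def
  by (rule sum.mono_neutral_left) (use assms in \<open>auto simp: in_keys_iff ring_mapD[OF \<iota>] scale_simps\<close>)

lemma act_nc_add: "act_nc (f + g) m = act_nc f m + act_nc g m"
proof -
  let ?A = "Poly_Mapping.keys f \<union> Poly_Mapping.keys g"
  have "Poly_Mapping.keys (f + g) \<subseteq> ?A" by (rule Poly_Mapping.keys_add)
  then show ?thesis
    by (simp add: act_nc_superset[of ?A] lookup_add ring_mapD[OF \<iota>] scale_simps sum.distrib)
qed

lemma act_nc_single: "act_nc (Poly_Mapping.single w c) m = scale (\<iota> c) (wact (letters w) m)"
  by (cases "c = 0") (auto simp: act_nc_def ring_mapD[OF \<iota>] scale_simps)

lemma act_nc_0: "act_nc 0 m = 0"
  by (simp add: act_nc_def)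

lemma linear_act_nc: "linear_op (act_nc f)"
  unfolding act_nc_def[abs_def] by (intro linear_op_sum linear_op_scale linear_wact)

lemma act_nc_mult: "act_nc (f * g) m = act_nc f (act_nc g m)"
proof (rule poly_mapping_single_induct[where f = f and P = "\<lambda>f. act_nc (f * g) m = act_nc f (act_nc g m)"])
  fix w :: "'n gen fword" and c :: complex
  show "act_nc (Poly_Mapping.single w c * g) m = act_nc (Poly_Mapping.single w c) (act_nc g m)"
  proof (rule poly_mapping_single_induct[where f = g and P = "\<lambda>g. act_nc (Poly_Mapping.single w c * g) m = act_nc (Poly_Mapping.single w c) (act_nc g m)"])
    show "act_nc (Poly_Mapping.single w c * Poly_Mapping.single v d) m =
      act_nc (Poly_Mapping.single w c) (act_nc (Poly_Mapping.single v d) m)" for v d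
      by (simp add: mult_single act_nc_single plus_fword_def wact_simps linear_opD[OF linear_wact] ring_mapD[OF \<iota>] scale_simps)
  qed (simp_all add: act_nc_0 act_nc_add distrib_left linear_opD[OF linear_act_nc])
qed (simp_all add: act_nc_0 act_nc_add distrib_right)

lemma act_nc_scalar: "act_nc (scalar c) m = scale (\<iota> c) m"
  by (simp add: scalar_def act_nc_single zero_fword_def wact_simps)

lemma act_nc_letter: "act_nc (letter a) m = lop a m"
  by (simp add: letter_def act_nc_single wact_simps ring_mapD[OF \<iota>] scale_simps)

lemma act_nc_1: "act_nc 1 m = m"
  using act_nc_scalar[of 1 m] by (simp add: scalar_def ring_mapD[OF \<iota>] scale_simps)

lemma act_nc_uminus: "act_nc (- f) m = - act_nc f m"
  using act_nc_add[of f "- f" m] by (simp add: act_nc_0 eq_neg_iff_add_eq_0 add.commute)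

lemma act_nc_diff: "act_nc (f - g) m = act_nc f m - act_nc g m"
  using act_nc_add[of f "- g" m] by (simp add: act_nc_uminus)

lemma act_nc_sum: "act_nc (sum f I) m = (\<Sum>i\<in>I. act_nc (f i) m)"
  using sum_comp_morphism[of "\<lambda>f. act_nc f m" f I] by (simp add: act_nc_0 act_nc_add o_def)

abbreviation F where "F \<equiv> free_superalgebra (generators R) is_gen :: 'n observable superalgebra"

lemma carrier_F: "f \<in> carrier F \<longleftrightarrow> (\<forall>w\<in>Poly_Mapping.keys f. set (letters w) \<subseteq> generators R)"
  by (simp add: free_superalgebra_def)

lemma act_nc_Ms: "f \<in> carrier F \<Longrightarrow> m \<in> Ms \<Longrightarrow> act_nc f m \<in> Ms"
  unfolding act_nc_def by (intro Ms_sum Ms_simps wact_Ms) (auto simp: carrier_F)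

lemma vec_elem_act:
  assumes "m \<in> Ms"
  shows "act_nc (vec_elem \<alpha> x) m = (if \<alpha> = 0 then dun True x m else mul True x m)"
proof -
  have *: "act_nc (vec_elem \<alpha> x) m = (\<Sum>i\<in>UNIV. scale (ir (x $ i)) (lop (Gen \<alpha> i) m))"
    by (simp add: vec_elem_def act_nc_sum act_nc_mult act_nc_scalar act_nc_letter ir_def)
  have d0: "dun True 0 m = 0" using dun_dir_scale[OF assms, of True 0 0] by (simp add: scale_simps ir_simps)
  have m0: "mul True 0 m = 0" using mul_dir(2)[of True 0 0 m] by (simp add: scale_simps ir_simps)
  have "dun True x m = (\<Sum>i\<in>UNIV. scale (ir (x $ i)) (dun True (axis i 1) m))"
    using sum_comp_morphism[of "\<lambda>u. dun True u m" "\<lambda>i. x $ i *\<^sub>R axis i 1" UNIV]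
    by (simp add: d0 dun_dir_add[OF assms] dun_dir_scale[OF assms] o_def vec_expand[symmetric])
  moreover have "mul True x m = (\<Sum>i\<in>UNIV. scale (ir (x $ i)) (mul True (axis i 1) m))"
    using sum_comp_morphism[of "\<lambda>u. mul True u m" "\<lambda>i. x $ i *\<^sub>R axis i 1" UNIV]
    by (simp add: m0 mul_dir o_def vec_expand[symmetric])
  ultimately show ?thesis unfolding * by simp
qed

lemma grp_elem_act: "act_nc (grp_elem g) m = sh True g m"
  by (simp add: grp_elem_def act_nc_letter)

lemma commutator_rhs_act:
  "act_nc (commutator_rhs R \<nu> x y) m = scale (ir (x \<bullet> y)) m
     + (\<Sum>v\<in>R. scale (c0 v * ir (x \<bullet> v) * ir (v \<bullet> y)) (sh True (reflection v) m))"
proof -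
  have "\<iota> (\<nu> v * complex_of_real ((x \<bullet> v) * (y \<bullet> v) / (v \<bullet> v))) = c0 v * ir (x \<bullet> v) * ir (v \<bullet> y)" for v
  proof -
    have "\<nu> v * complex_of_real ((x \<bullet> v) * (y \<bullet> v) / (v \<bullet> v)) =
      \<nu> v / complex_of_real (v \<bullet> v) * complex_of_real (x \<bullet> v) * complex_of_real (v \<bullet> y)"
      by (simp add: inner_commute)
    then show ?thesis by (simp only: c0_def ir_def ring_mapD(4)[OF \<iota>])
  qed
  then show ?thesis
    unfolding commutator_rhs_def act_nc_add act_nc_sum act_nc_mult act_nc_scalar grp_elem_act
    by (simp add: ir_def)
qed

text \<open>The bimodule carries the constants s \<nu> and the relation the constants \<nu>, so the
  relation acts as a multiple of s - 1: as zero for s = 1, and as something that vanishes after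
  setting s = 1 in the deformed case.\<close>

lemma dun_mul_commutator:
  assumes "m \<in> Ms"
  shows "\<exists>m'\<in>Ms. dun True x (mul True y m) - mul True y (dun True x m) - act_nc (commutator_rhs R \<nu> x y) m
     = scale (s - 1) m'"
proof
  let ?m = "\<Sum>v\<in>R. scale (c0 v * ir (x \<bullet> v) * ir (v \<bullet> y)) (sh True (reflection v) m)"
  show "?m \<in> Ms" by (intro Ms_sum Ms_simps sh_Ms W_refl assms)
  have "(\<Sum>v\<in>R. scale (cc v * ir (x \<bullet> v) * ir (v \<bullet> y)) (sh True (reflection v) m)) = scale s ?m"
    by (simp add: scale_sum scale_simps cc_eq mult.assoc)
  moreover have "scale (s - 1) ?m = scale s ?m - ?m"
    using scale_simps(7)[of s "- 1" ?m] by (simp add: scale_simps(2,4))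
  ultimately show "dun True x (mul True y m) - mul True y (dun True x m) - act_nc (commutator_rhs R \<nu> x y) m
     = scale (s - 1) ?m"
    by (simp add: dun_mul commutator_rhs_act)
qed

lemma relation_act:
  assumes r: "r \<in> calogero_relations R \<nu>" and m: "m \<in> Ms"
  shows "\<exists>m'\<in>Ms. act_nc r m = scale (s - 1) m'"
proof -
  have 0: "\<exists>m'\<in>Ms. act_nc r m = scale (s - 1) m'" if "act_nc r m = 0"
    by (rule bexI[of _ 0]) (simp_all add: that scale_simps Ms_simps)
  have eps: "eps 0 0 = 0" "eps 1 1 = 0" "eps 0 1 = 1" "eps 1 0 = - 1" by (simp_all add: eps_def)
  have v: "act_nc (vec_elem 0 x) m' = dun True x m'" "act_nc (vec_elem 1 x) m' = mul True x m'" if "m' \<in> Ms" for m' x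
    by (simp_all add: vec_elem_act[OF that])
  from r consider "r = grp_elem id - 1"
    | g h where "g \<in> W" "h \<in> W" "r = grp_elem g * grp_elem h - grp_elem (g \<circ> h)"
    | g \<alpha> x where "g \<in> W" "r = grp_elem g * vec_elem \<alpha> x - vec_elem \<alpha> (g x) * grp_elem g"
    | \<alpha> \<beta> x y where "r = vec_elem \<alpha> x * vec_elem \<beta> y - vec_elem \<beta> y * vec_elem \<alpha> x
        - scalar (eps \<alpha> \<beta>) * commutator_rhs R \<nu> x y"
    unfolding calogero_relations_def W_ops by blast
  then show ?thesis
  proof cases
    case 1
    show ?thesis by (rule 0) (simp add: 1 act_nc_diff grp_elem_act sh_id act_nc_1)
  next
    case 2
    show ?thesis by (rule 0) (simp add: 2 act_nc_diff act_nc_mult grp_elem_act sh_sh)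
  next
    case 3
    then show ?thesis
      by (intro 0) (simp add: 3(2) act_nc_diff act_nc_mult grp_elem_act vec_elem_act m sh_Ms sh_dun sh_mul)
  next
    case 4
    have sc: "act_nc (scalar c * f) m = scale (\<iota> c) (act_nc f m)" for c f
      by (simp add: act_nc_mult act_nc_scalar)
    have \<iota>1: "\<iota> 0 = 0" "\<iota> 1 = 1" "\<iota> (- 1) = - 1" by (simp_all add: ring_mapD[OF \<iota>])
    have rhs: "act_nc (commutator_rhs R \<nu> x y) m = act_nc (commutator_rhs R \<nu> y x) m"
      unfolding commutator_rhs_act by (simp add: inner_commute mult_ac)
    consider "\<alpha> = 0" "\<beta> = 0" | "\<alpha> = 0" "\<beta> = 1" | "\<alpha> = 1" "\<beta> = 0" | "\<alpha> = 1" "\<beta> = 1"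
      using two_cases[of \<alpha>] two_cases[of \<beta>] by blast
    then show ?thesis
    proof cases
      case 1
      show ?thesis by (rule 0) (simp add: 4 1 act_nc_diff act_nc_scalar eps \<iota>1 scale_simps act_nc_mult v m dun_Ms dun_dun[of m True x])
    next
      case 2
      have "act_nc r m = dun True x (mul True y m) - mul True y (dun True x m) - act_nc (commutator_rhs R \<nu> x y) m"
        by (simp add: 4 2 act_nc_diff sc eps \<iota>1 scale_simps) (simp add: act_nc_mult v m dun_Ms mul_Ms)
      then show ?thesis using dun_mul_commutator[OF m, of x y] by simp
    next
      case 3
      obtain m' where m': "m' \<in> Ms" "dun True y (mul True x m) - mul True x (dun True y m) - act_nc (commutator_rhs R \<nu> y x) m
        = scale (s - 1) m'" using dun_mul_commutator[OF m, of y x] by blast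
      have "act_nc r m = - (dun True y (mul True x m) - mul True x (dun True y m) - act_nc (commutator_rhs R \<nu> y x) m)"
        by (simp add: 4 3 act_nc_diff sc eps \<iota>1 scale_simps rhs) (simp add: act_nc_mult v m dun_Ms mul_Ms)
      also have "\<dots> = scale (s - 1) (- m')" unfolding m'(2) by (simp add: scale_simps)
      finally show ?thesis using Ms_simps(5)[OF m'(1)] by blast
    next
      case 4
      show ?thesis
        by (rule 0) (simp add: \<open>r = _\<close> 4 act_nc_diff act_nc_scalar eps \<iota>1 scale_simps act_nc_mult v m mul_Ms mul_mul[of True x])
    qed
  qed
qed

lemma unit1_Ms: "unit1 \<in> Ms"
  unfolding unit1_def by (rule Ms_simps(6)[OF W_id])

text \<open>\<open>unit1\<close> represents the unit of the superalgebra. With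
  \<open>lop_rop\<close> this turns right multiplication in the free superalgebra into
  \<open>rop\<close>.\<close>

lemma lop_unit1: "a \<in> generators R \<Longrightarrow> lop a unit1 = rop a unit1"
proof (erule letter_W)
  fix \<alpha> i assume "a = Gen \<alpha> i"
  then show ?thesis
    using dun_dl_one[OF W_id, of True "axis i 1"] dun_dl_one[OF W_id, of False "axis i 1"]
    by (simp add: unit1_def tw_def)
next
  fix g assume g: "a = Grp g" "g \<in> W"
  then show ?thesis by (simp add: unit1_def sh_dl W_inv act_1 trn_def W_inv_inv)
qed

lemma lop_rop: "a \<in> generators R \<Longrightarrow> b \<in> generators R \<Longrightarrow> m \<in> Ms \<Longrightarrow> lop a (rop b m) = rop b (lop a m)"
  using dun_mul_other[of m True] dun_mul_other[of m False] dun_dun[of m True _ False]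
    sh_dun_other[of _ m True] sh_dun_other[of _ m False] sh_mul(2)[of _ True] sh_mul(2)[of _ False]
    sh_sh(2)[of _ _ True] mul_mul[of True _ False]
  by (elim letter_W) (auto simp: W_inv)

lemma act_nc_rop:
  assumes "f \<in> carrier F" "a \<in> generators R" "m \<in> Ms"
  shows "act_nc f (rop a m) = rop a (act_nc f m)"
proof -
  have "wact l (rop a m) = rop a (wact l m)" if "set l \<subseteq> generators R" for l
    using that by (induction l) (simp_all add: wact_simps lop_rop assms wact_Ms)
  then show ?thesis
    using assms(1) unfolding act_nc_def carrier_F
    by (simp add: linear_opD[OF linear_rop])
qed

lemma act_nc_letter_right:
  assumes "f \<in> carrier F" "a \<in> generators R"
  shows "act_nc (f * letter a) unit1 = rop a (act_nc f unit1)"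
  by (simp add: act_nc_mult act_nc_letter lop_unit1 assms act_nc_rop unit1_Ms)

section \<open>Parity on the bimodule\<close>

definition Par :: "bool \<Rightarrow> ((real^'n \<Rightarrow> real^'n) \<Rightarrow> (bool \<times> 'n, 'k) mpol) set" where
  "Par c = {f \<in> Ms. \<forall>w. f w \<in> Graded {j. even j = c}}"

lemma Par_simps: "0 \<in> Par c" "f \<in> Par c \<Longrightarrow> g \<in> Par c \<Longrightarrow> f + g \<in> Par c" "f \<in> Par c \<Longrightarrow> scale d f \<in> Par c"
  "f \<in> Par c \<Longrightarrow> g \<in> Par c \<Longrightarrow> f - g \<in> Par c"
  by (simp_all add: Par_def Ms_simps fun_apply Graded_add Graded_diff) (simp add: scale_def Graded_Cst_mult)

lemma Par_sum: "(\<And>i. i \<in> I \<Longrightarrow> f i \<in> Par c) \<Longrightarrow> sum f I \<in> Par c"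
  by (auto simp: Par_def sum_fun_apply intro!: Ms_sum Graded_sum)

lemma dl_Par: "w \<in> W \<Longrightarrow> G \<in> Graded {j. even j = c} \<Longrightarrow> dl w G \<in> Par c"
  by (simp add: Par_def Ms_simps) (simp add: dl_def)

lemma Graded_parity:
  assumes "G \<in> Graded {j. even j = c}"
  shows "lin b u * G \<in> Graded {j. even j = (\<not> c)}" "X a * G \<in> Graded {j. even j = (\<not> c)}"
    "pd z G \<in> Graded {j. even j = (\<not> c)}" "DD b v G \<in> Graded {j. even j = (\<not> c)}"
  unfolding DD_def
  by (rule Graded_mono, rule Graded_linear_mult[OF linear_form_lin assms], force)
    (rule Graded_mono, rule Graded_X_mult[OF assms], force,
     rule Graded_mono, rule Graded_dd[OF linear_form_simps(1) assms], force,
     rule Graded_mono, rule Graded_dd[OF linear_form_simps(3)[OF linear_form_lin] assms], force)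

lemma mul_Par: "f \<in> Par c \<Longrightarrow> mul b u f \<in> Par (\<not> c)"
  by (auto simp: Par_def mul_Ms) (auto simp: mul_def intro: Graded_parity)

lemma sh_Par: "g \<in> W \<Longrightarrow> f \<in> Par c \<Longrightarrow> sh b g f \<in> Par c"
proof -
  have "linear_form (act_var b g a)" for a
    by (cases a) (auto simp: act_var_apply intro: linear_form_lin linear_form_simps)
  then show "g \<in> W \<Longrightarrow> f \<in> Par c \<Longrightarrow> sh b g f \<in> Par c"
    by (auto simp: Par_def sh_Ms) (auto simp: sh_def act_def intro: Graded_sub)
qed

lemma dun_Par: "f \<in> Par c \<Longrightarrow> dun b u f \<in> Par (\<not> c)"
  by (auto simp: Par_def dun_Ms)
    (auto simp: dun_def intro!: Graded_add Graded_sum Graded_Cst_mult Graded_parity)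

lemma wact_Par: "set l \<subseteq> generators R \<Longrightarrow> wact l unit1 \<in> Par (even (length (filter is_gen l)))"
proof (induction l)
  case Nil
  have "1 \<in> Graded {j. even j = True}" by (simp add: Graded_def)
  then show ?case unfolding wact_simps unit1_def using dl_Par[OF W_id, of 1 True] by simp
next
  case (Cons a l)
  then have a: "a \<in> generators R" and IH: "wact l unit1 \<in> Par (even (length (filter is_gen l)))" by auto
  show ?case unfolding wact_simps
    using a by (rule letter_W) (use IH in \<open>auto simp: mul_Par dun_Par sh_Par dest: mul_Par dun_Par\<close>)
qed

end

context calogero_twist
begin

text \<open>Each summand composes two odd operations, a derivative or multiplication followed by
  \<open>T\<close>.\<close>

lemma GG_Par:
  assumes "f \<in> Par c"
  shows "GG f \<in> Par c"
proof -
  have f: "f w \<in> Graded {j. even j = c}" for w using assms by (simp add: Par_def)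
  have T: "T b u (dl w G) \<in> Par c" if "w \<in> W" "G \<in> Graded {j. even j = (\<not> c)}" for b u w G
    using mul_Par[OF dl_Par[OF that]] dun_Par[OF dl_Par[OF that]] by (simp add: T_def Par_simps)
  show ?thesis unfolding GG_def GG1_def
    by (intro Par_sum Par_simps T) (auto simp: del_def intro!: Graded_parity f)
qed

text \<open>\<open>Gam\<close> preserves parity, and the initial data read off only constant terms,
  which have even degree.\<close>

lemma sp_odd:
  assumes f: "f \<in> Par False"
  shows "sp a f = 0"
proof -
  have ct0: "ct G = 0" if "G \<in> Graded {j. even j = False}" for G :: "(bool \<times> 'n, 'k) mpol"
    using that
  proof (induction rule: Graded_induct)
    case (single m c)
    then show ?case by (auto simp: ct_single)
  qed (simp_all add: ct_simps)
  have cp: "cpart w (g w) = 0" if "g \<in> Par False" for g w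
    using that ct0 by (simp add: cpart_def Par_def Cst_simps)
  have "Gam g \<in> Par False" if "g \<in> Par False" for g
  proof -
    have "(\<lambda>w. rho w (g w)) \<in> Par False"
      using that by (auto simp: Par_def Ms_def rho_0) (simp add: rho_def degree_scale_in_Graded)
    then show ?thesis unfolding Gam_def using that
      by (simp add: cp Par_simps GG_Par)
  qed
  then have "(Gam ^^ n) f \<in> Par False" for n by (induction n) (simp_all add: f)
  then have "phi a ((Gam ^^ n) f) = 0" for n by (simp add: phi_def cp ct_simps)
  then show ?thesis by (simp add: sp_def)
qed

end

section \<open>The relation ideal and ordered words\<close>

lemma scalar_mult: "scalar c * scalar d = scalar (c * d)" "scalar 1 = 1" "scalar 0 = 0"
  "scalar (c + d) = scalar c + scalar d" "scalar (- c) = - scalar c"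
  by (simp_all add: scalar_def mult_single single_add single_uminus)

lemma scalar_commute: "f * scalar c = scalar c * f"
proof (induction f rule: poly_mapping_single_induct)
  case (single w d)
  then show ?case by (simp add: scalar_def mult_single mult.commute)
qed (simp_all add: distrib_left distrib_right)

lemma scalar_left_commute: "f * (scalar c * g) = scalar c * (f * g)"
  by (metis scalar_commute mult.assoc)

lemma vec_elem_axis: "vec_elem \<alpha> (axis i 1) = letter (Gen \<alpha> i)"
proof -
  have "vec_elem \<alpha> (axis i 1) = (\<Sum>j\<in>UNIV. if j = i then letter (Gen \<alpha> i) else 0)"
    unfolding vec_elem_def by (rule sum.cong) (auto simp: axis_def scalar_mult)
  then show ?thesis by simp
qed

context calogero
begin

abbreviation Id :: "'n observable set" where
  "Id \<equiv> Idl\<^bsub>F\<^esub> (calogero_relations R \<nu>)"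

lemma F_ops: "f \<oplus>\<^bsub>F\<^esub> g = f + g" "f \<otimes>\<^bsub>F\<^esub> g = f * g" "\<one>\<^bsub>F\<^esub> = 1" "\<zero>\<^bsub>F\<^esub> = 0"
  by (simp_all add: free_superalgebra_def)

lemma ideal_Id: "ideal Id F"
  by (rule ring.genideal_ideal[OF free_superalgebra_ring calogero_relations_carrier])

lemma F_closed: "f \<in> carrier F \<Longrightarrow> g \<in> carrier F \<Longrightarrow> f + g \<in> carrier F"
  "f \<in> carrier F \<Longrightarrow> g \<in> carrier F \<Longrightarrow> f * g \<in> carrier F"
  "f \<in> carrier F \<Longrightarrow> - f \<in> carrier F" "0 \<in> carrier F" "1 \<in> carrier F" "scalar c \<in> carrier F"
proof -
  interpret F: ring F by (rule free_superalgebra_ring)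
  show "f \<in> carrier F \<Longrightarrow> g \<in> carrier F \<Longrightarrow> f + g \<in> carrier F"
    "f \<in> carrier F \<Longrightarrow> g \<in> carrier F \<Longrightarrow> f * g \<in> carrier F"
    "0 \<in> carrier F" "1 \<in> carrier F"
    using F.a_closed F.m_closed F.zero_closed F.one_closed unfolding F_ops by auto
  show "f \<in> carrier F \<Longrightarrow> - f \<in> carrier F" "scalar c \<in> carrier F"
    by (auto simp: carrier_F scalar_def zero_fword_def)
qed

lemma F_sum: "(\<And>i. i \<in> I \<Longrightarrow> f i \<in> carrier F) \<Longrightarrow> sum f I \<in> carrier F"
  by (induction I rule: infinite_finite_induct) (auto intro: F_closed)

lemma F_letter: "a \<in> generators R \<Longrightarrow> letter a \<in> carrier F"
  by (auto simp: carrier_F letter_def)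

lemma Gen_generators: "Gen \<alpha> i \<in> generators R" and Grp_generators: "g \<in> W \<Longrightarrow> Grp g \<in> generators R"
  by (auto simp: generators_def)

lemma F_elem: "vec_elem \<alpha> x \<in> carrier F" "g \<in> W \<Longrightarrow> grp_elem g \<in> carrier F" "letter (Gen \<alpha> i) \<in> carrier F"
  "commutator_rhs R \<nu> x y \<in> carrier F"
  unfolding vec_elem_def grp_elem_def commutator_rhs_def
  by (intro F_sum F_closed F_letter Gen_generators Grp_generators W_refl; assumption)+

lemma Id_closed: "f \<in> Id \<Longrightarrow> g \<in> Id \<Longrightarrow> f + g \<in> Id" "f \<in> Id \<Longrightarrow> g \<in> carrier F \<Longrightarrow> f * g \<in> Id"
  "f \<in> Id \<Longrightarrow> g \<in> carrier F \<Longrightarrow> g * f \<in> Id" "0 \<in> Id" "f \<in> Id \<Longrightarrow> - f \<in> Id" "f \<in> Id \<Longrightarrow> f \<in> carrier F"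
proof -
  interpret Id: ideal Id F by (rule ideal_Id)
  show "f \<in> Id \<Longrightarrow> g \<in> Id \<Longrightarrow> f + g \<in> Id" "0 \<in> Id" "f \<in> Id \<Longrightarrow> f \<in> carrier F"
    using additive_subgroup.a_closed[OF ideal.axioms(1)[OF ideal_Id]]
      additive_subgroup.zero_closed[OF ideal.axioms(1)[OF ideal_Id]] Id.Icarr unfolding F_ops by auto
  show l: "f \<in> Id \<Longrightarrow> g \<in> carrier F \<Longrightarrow> g * f \<in> Id" and "f \<in> Id \<Longrightarrow> g \<in> carrier F \<Longrightarrow> f * g \<in> Id" for f g
    using Id.I_l_closed Id.I_r_closed unfolding F_ops by auto
  show "f \<in> Id \<Longrightarrow> - f \<in> Id"
    using l[of f "scalar (- 1)"] F_closed(6)[of "- 1"] by (simp add: scalar_mult)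
qed

text \<open>Congruence modulo the relation ideal. Recording both memberships in the carrier lets
  congruences be chained and multiplied without side conditions or cosets.\<close>

definition cg :: "'n observable \<Rightarrow> 'n observable \<Rightarrow> bool" where
  "cg f g \<longleftrightarrow> f \<in> carrier F \<and> g \<in> carrier F \<and> f - g \<in> Id"

lemma cg_refl: "f \<in> carrier F \<Longrightarrow> cg f f"
  by (simp add: cg_def Id_closed)

lemma cg_sym: "cg f g \<Longrightarrow> cg g f"
  using Id_closed(5)[of "f - g"] by (simp add: cg_def)

lemma cg_trans [trans]: "cg f g \<Longrightarrow> cg g h \<Longrightarrow> cg f h"
  using Id_closed(1)[of "f - g" "g - h"] by (simp add: cg_def)

lemma cg_add: "cg f g \<Longrightarrow> cg f' g' \<Longrightarrow> cg (f + f') (g + g')"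
  using Id_closed(1)[of "f - g" "f' - g'"] by (simp add: cg_def F_closed algebra_simps)

lemma cg_mult: "cg f g \<Longrightarrow> cg f' g' \<Longrightarrow> cg (f * f') (g * g')"
  using Id_closed(1)[OF Id_closed(2)[of "f - g" f'] Id_closed(3)[of "f' - g'" g]]
  by (simp add: cg_def F_closed algebra_simps)

lemma cg_sum: "(\<And>i. i \<in> I \<Longrightarrow> cg (f i) (g i)) \<Longrightarrow> cg (sum f I) (sum g I)"
  by (induction I rule: infinite_finite_induct) (auto intro: cg_add cg_refl F_closed)

lemma relation_Id: "r \<in> calogero_relations R \<nu> \<Longrightarrow> r \<in> Id"
  using ring.genideal_self[OF free_superalgebra_ring calogero_relations_carrier] by blast

lemma cg_grp_id: "cg (grp_elem id) 1"
  unfolding cg_def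
  by (intro conjI F_closed F_elem W_id; rule relation_Id) (unfold calogero_relations_def W_ops, blast)

lemma cg_grp_grp: "g \<in> W \<Longrightarrow> h \<in> W \<Longrightarrow> cg (grp_elem g * grp_elem h) (grp_elem (g \<circ> h))"
  unfolding cg_def
  by (intro conjI F_closed F_elem W_comp; (rule relation_Id)?) (unfold calogero_relations_def W_ops, blast+)

lemma cg_grp_vec: "g \<in> W \<Longrightarrow> cg (grp_elem g * vec_elem \<alpha> x) (vec_elem \<alpha> (g x) * grp_elem g)"
  unfolding cg_def
  by (intro conjI F_closed F_elem; (rule relation_Id)?) (unfold calogero_relations_def, blast+)

lemma cg_vec_vec: "cg (vec_elem \<alpha> x * vec_elem \<beta> y)
    (vec_elem \<beta> y * vec_elem \<alpha> x + scalar (eps \<alpha> \<beta>) * commutator_rhs R \<nu> x y)"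
proof -
  have "vec_elem \<alpha> x * vec_elem \<beta> y - vec_elem \<beta> y * vec_elem \<alpha> x - scalar (eps \<alpha> \<beta>) * commutator_rhs R \<nu> x y \<in> Id"
    by (rule relation_Id) (unfold calogero_relations_def, blast)
  then show ?thesis unfolding cg_def by (simp add: F_closed F_elem diff_diff_eq)
qed

lemma eps_same: "eps \<alpha> \<alpha> = 0"
  by (auto simp: eps_def)

lemma cg_letter_letter: "cg (letter (Gen \<alpha> i) * letter (Gen \<alpha> j)) (letter (Gen \<alpha> j) * letter (Gen \<alpha> i))"
  using cg_vec_vec[of \<alpha> "axis i 1" \<alpha> "axis j 1"] by (simp add: vec_elem_axis eps_same scalar_mult)

section \<open>Ordered words\<close>

definition gw :: "2 \<Rightarrow> 'n list \<Rightarrow> 'n observable" where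
  "gw \<alpha> l = prod_list (map (\<lambda>i. letter (Gen \<alpha> i)) l)"

lemma gw_simps: "gw \<alpha> [] = 1" "gw \<alpha> (i # l) = letter (Gen \<alpha> i) * gw \<alpha> l" "gw \<alpha> (l @ l') = gw \<alpha> l * gw \<alpha> l'"
  by (simp_all add: gw_def)

lemma gw_carrier: "gw \<alpha> l \<in> carrier F"
  by (induction l) (auto simp: gw_simps intro: F_closed F_elem)

lemma gw_front: "cg (gw \<alpha> (l @ i # l')) (letter (Gen \<alpha> i) * gw \<alpha> (l @ l'))"
proof (induction l)
  case Nil
  show ?case by (simp add: gw_simps cg_refl F_closed F_elem gw_carrier)
next
  case (Cons j l)
  have "cg (gw \<alpha> ((j # l) @ i # l')) (letter (Gen \<alpha> j) * (letter (Gen \<alpha> i) * gw \<alpha> (l @ l')))"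
    using cg_mult[OF cg_refl[OF F_elem(3)] Cons] by (simp add: gw_simps)
  also have "cg \<dots> (letter (Gen \<alpha> i) * letter (Gen \<alpha> j) * gw \<alpha> (l @ l'))"
    using cg_mult[OF cg_letter_letter cg_refl[OF gw_carrier]] by (simp add: mult.assoc)
  finally show ?case by (simp add: gw_simps mult.assoc)
qed

lemma gw_perm: "mset l = mset l' \<Longrightarrow> cg (gw \<alpha> l) (gw \<alpha> l')"
proof (induction l arbitrary: l')
  case Nil
  then show ?case by (simp add: cg_refl gw_carrier)
next
  case (Cons i l)
  then have "i \<in> set l'" by (metis list.set_intros(1) set_mset_mset)
  then obtain a b where l': "l' = a @ i # b" by (meson split_list)
  then have "cg (gw \<alpha> l) (gw \<alpha> (a @ b))" using Cons by (intro Cons.IH) simp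
  then have "cg (gw \<alpha> (i # l)) (letter (Gen \<alpha> i) * gw \<alpha> (a @ b))"
    unfolding gw_simps by (intro cg_mult cg_refl F_elem)
  then show ?case unfolding l' using cg_trans cg_sym[OF gw_front] by blast
qed

text \<open>An arbitrary order of the factors from one copy; by \<open>gw_perm\<close> its choice is
  immaterial modulo the ideal, since generators of the same copy commute.\<close>

definition part :: "bool \<Rightarrow> (bool \<times> 'n) multiset \<Rightarrow> 'n list" where
  "part b m = (SOME l. mset l = image_mset snd (filter_mset (\<lambda>a. fst a = b) m))"

lemma mset_part: "mset (part b m) = image_mset snd (filter_mset (\<lambda>a. fst a = b) m)"
  unfolding part_def by (rule someI_ex) (rule ex_mset)

definition oword :: "(real^'n \<Rightarrow> real^'n) \<Rightarrow> (bool \<times> 'n) multiset \<Rightarrow> 'n observable" where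
  "oword w m = gw 1 (part True m) * grp_elem w * gw 0 (part False m)"

lemma oword_carrier: "w \<in> W \<Longrightarrow> oword w m \<in> carrier F"
  unfolding oword_def by (intro F_closed gw_carrier F_elem)

lemma oword_add:
  assumes w: "w \<in> W"
  shows "cg (oword w (add_mset (True, i) m)) (letter (Gen 1 i) * oword w m)"
    "cg (oword w (add_mset (False, i) m)) (oword w m * letter (Gen 0 i))"
proof -
  have c: "cg (gw \<alpha> l) (gw \<alpha> l)" "cg (grp_elem w) (grp_elem w)" for \<alpha> l
    using w by (auto intro: cg_refl gw_carrier F_elem)
  have "cg (gw 1 (part True (add_mset (True, i) m))) (gw 1 (i # part True m))"
    by (rule gw_perm) (simp add: mset_part)
  moreover have "cg (gw 0 (part False (add_mset (True, i) m))) (gw 0 (part False m))"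
    by (rule gw_perm) (simp add: mset_part)
  ultimately have "cg (oword w (add_mset (True, i) m)) (gw 1 (i # part True m) * grp_elem w * gw 0 (part False m))"
    unfolding oword_def by (intro cg_mult c)
  then show "cg (oword w (add_mset (True, i) m)) (letter (Gen 1 i) * oword w m)"
    by (simp add: oword_def gw_simps mult.assoc)
  have "cg (gw 0 (part False (add_mset (False, i) m))) (gw 0 (part False m @ [i]))"
    by (rule gw_perm) (simp add: mset_part)
  moreover have "cg (gw 1 (part True (add_mset (False, i) m))) (gw 1 (part True m))"
    by (rule gw_perm) (simp add: mset_part)
  ultimately have "cg (oword w (add_mset (False, i) m)) (gw 1 (part True m) * grp_elem w * gw 0 (part False m @ [i]))"
    unfolding oword_def by (intro cg_mult c)
  then show "cg (oword w (add_mset (False, i) m)) (oword w m * letter (Gen 0 i))"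
    by (simp add: oword_def gw_simps mult.assoc)
qed

end

section \<open>The bimodule at \<open>s = 1\<close> as a model of the quotient\<close>

locale calogero_complex = calogero R \<nu> "\<lambda>c. c :: complex" 1
  for R :: "(real^'n) set" and \<nu>
begin

lemma ir_complex: "ir c = complex_of_real c"
  by (simp add: ir_def)

definition sig1 :: "(real^'n \<Rightarrow> real^'n) \<Rightarrow> (bool \<times> 'n, complex) mpol \<Rightarrow> 'n observable" where
  "sig1 w G = (\<Sum>m\<in>Poly_Mapping.keys G. scalar (Poly_Mapping.lookup G m) * oword w m)"

text \<open>Writes an element of the bimodule as a noncommutative polynomial in ordered words.
  Modulo the ideal it is inverse to letting a polynomial act on \<open>unit1\<close>
  (\<open>sig_act_nc\<close>, \<open>act_nc_sig\<close>); together these are a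
  Poincare-Birkhoff-Witt theorem for the superalgebra.\<close>

definition sig where
  "sig m = (\<Sum>w\<in>W. sig1 w (m w))"

lemma sig1_superset:
  assumes "finite A" "Poly_Mapping.keys G \<subseteq> A"
  shows "sig1 w G = (\<Sum>m\<in>A. scalar (Poly_Mapping.lookup G m) * oword w m)"
  unfolding sig1_def
  by (rule sum.mono_neutral_left) (use assms in \<open>auto simp: in_keys_iff scalar_mult\<close>)

lemma sig1_add: "sig1 w (G + H) = sig1 w G + sig1 w H"
proof -
  let ?A = "Poly_Mapping.keys G \<union> Poly_Mapping.keys H"
  have "Poly_Mapping.keys (G + H) \<subseteq> ?A" by (rule Poly_Mapping.keys_add)
  then show ?thesis
    by (simp add: sig1_superset[of ?A] lookup_add scalar_mult distrib_right sum.distrib)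
qed

lemma sig1_single: "sig1 w (Poly_Mapping.single m c) = scalar c * oword w m"
  by (cases "c = 0") (auto simp: sig1_def scalar_mult)

lemma sig1_0: "sig1 w 0 = 0"
  by (simp add: sig1_def)

lemma sig1_Cst_mult: "sig1 w (Cst c * G) = scalar c * sig1 w G"
proof (induction G rule: poly_mapping_single_induct)
  case (single m d)
  then show ?case by (simp add: Cst_single sig1_single scalar_mult mult.assoc[symmetric])
qed (simp_all add: sig1_0 sig1_add distrib_left)

lemma sig1_Cst: "sig1 w (Cst c) = scalar c * grp_elem w"
proof -
  have "part b {#} = []" for b using mset_part[of b "{#}"] by simp
  then show ?thesis by (simp add: Cst_def sig1_single oword_def gw_simps)
qed

lemma sig1_carrier: "w \<in> W \<Longrightarrow> sig1 w G \<in> carrier F"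
  unfolding sig1_def by (intro F_sum F_closed oword_carrier)

lemma sig1_X:
  assumes w: "w \<in> W"
  shows "cg (sig1 w (X (True, i) * G)) (letter (Gen 1 i) * sig1 w G)"
    "cg (sig1 w (X (False, i) * G)) (sig1 w G * letter (Gen 0 i))"
proof (induction G rule: poly_mapping_single_induct)
  case zero
  { case 1 show ?case by (simp add: sig1_0 cg_refl F_closed)
  next case 2 show ?case by (simp add: sig1_0 cg_refl F_closed) }
next
  case (single m c)
  { case 1
    show ?case
      using cg_mult[OF cg_refl[OF F_closed(6), of c] oword_add(1)[OF w, of i m]]
      by (simp add: single_mset_add[symmetric] sig1_single scalar_left_commute)
  next case 2
    show ?case
      using cg_mult[OF cg_refl[OF F_closed(6), of c] oword_add(2)[OF w, of i m]]
      by (simp add: single_mset_add[symmetric] sig1_single mult.assoc) }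
next
  case (add f g)
  { case 1 show ?case using cg_add[OF add(1) add(3)] by (simp add: distrib_left sig1_add)
  next case 2 show ?case using cg_add[OF add(2) add(4)] by (simp add: distrib_left distrib_right sig1_add) }
qed

lemma sig1_sum: "sig1 w (sum G I) = (\<Sum>i\<in>I. sig1 w (G i))"
  using sum_comp_morphism[of "sig1 w" G I] by (simp add: sig1_0 sig1_add o_def)

lemma sig1_lin:
  assumes w: "w \<in> W"
  shows "cg (sig1 w (lin True u * G)) (vec_elem 1 u * sig1 w G)"
    "cg (sig1 w (lin False u * G)) (sig1 w G * vec_elem 0 u)"
proof -
  have "cg (\<Sum>i\<in>UNIV. scalar (complex_of_real (u $ i)) * sig1 w (X (True, i) * G))
    (\<Sum>i\<in>UNIV. scalar (complex_of_real (u $ i)) * (letter (Gen 1 i) * sig1 w G))"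
    by (intro cg_sum cg_mult cg_refl F_closed sig1_X w)
  then show "cg (sig1 w (lin True u * G)) (vec_elem 1 u * sig1 w G)"
    by (simp add: lin_def vec_elem_def sum_distrib_right sig1_sum sig1_Cst_mult ir_complex mult.assoc)
  have "cg (\<Sum>i\<in>UNIV. scalar (complex_of_real (u $ i)) * sig1 w (X (False, i) * G))
    (\<Sum>i\<in>UNIV. scalar (complex_of_real (u $ i)) * (sig1 w G * letter (Gen 0 i)))"
    by (intro cg_sum cg_mult cg_refl F_closed sig1_X w)
  then show "cg (sig1 w (lin False u * G)) (sig1 w G * vec_elem 0 u)"
    by (simp add: lin_def vec_elem_def sum_distrib_right sum_distrib_left sig1_sum sig1_Cst_mult ir_complex
      mult.assoc scalar_left_commute)
qed

lemma sig_add: "sig (f + g) = sig f + sig g"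
  by (simp add: sig_def fun_apply sig1_add sum.distrib)

lemma sig_scale: "sig (scale c f) = scalar c * sig f"
  by (simp add: sig_def scale_def sig1_Cst_mult sum_distrib_left)

lemma sig_0: "sig 0 = 0"
  by (simp add: sig_def fun_apply sig1_0)

lemma sig_sum: "sig (sum f I) = (\<Sum>i\<in>I. sig (f i))"
  using sum_comp_morphism[of sig f I] by (simp add: sig_0 sig_add o_def)

lemma sig_dl: "w \<in> W \<Longrightarrow> sig (dl w G) = sig1 w G"
proof -
  assume w: "w \<in> W"
  have "sig (dl w G) = (\<Sum>w'\<in>W. if w' = w then sig1 w G else 0)"
    unfolding sig_def by (rule sum.cong) (auto simp: dl_def sig1_0)
  then show ?thesis using w finite_W by simp
qed

lemma sig_carrier: "sig m \<in> carrier F"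
  unfolding sig_def by (intro F_sum sig1_carrier)

lemma cg_Ms_induct:
  assumes m: "m \<in> Ms" and K: "linear_op K"
    and dl: "\<And>w G. w \<in> W \<Longrightarrow> cg (sig (K (dl w G))) (A * sig1 w G * B)"
    and A: "A \<in> carrier F" and B: "B \<in> carrier F"
  shows "cg (sig (K m)) (A * sig m * B)"
  using m
proof (induction rule: Ms_induct)
  case zero
  show ?case by (simp add: linear_opD[OF K] sig_0 cg_refl F_closed)
next
  case (dl w G)
  then show ?case using assms(3) by (simp add: sig_dl)
next
  case (add f g)
  then show ?case using cg_add[OF add(3,4)] by (simp add: linear_opD[OF K] sig_add distrib_left distrib_right)
qed

lemma sig_mul:
  assumes "m \<in> Ms"
  shows "cg (sig (mul True u m)) (vec_elem 1 u * sig m)" "cg (sig (mul False u m)) (sig m * vec_elem 0 u)"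
proof -
  have "cg (sig (mul True u m)) (vec_elem 1 u * sig m * 1)"
    by (rule cg_Ms_induct[OF assms linear_mul]) (simp_all add: mul_apply_dl sig_dl sig1_lin F_elem F_closed)
  then show "cg (sig (mul True u m)) (vec_elem 1 u * sig m)" by simp
  have "cg (sig (mul False u m)) (1 * sig m * vec_elem 0 u)"
    by (rule cg_Ms_induct[OF assms linear_mul]) (simp_all add: mul_apply_dl sig_dl sig1_lin F_elem F_closed)
  then show "cg (sig (mul False u m)) (sig m * vec_elem 0 u)" by simp
qed

text \<open>By induction on the polynomial: a variable on the left of w is passed by g with the
  cross relation, one on the right is not met by g at all.\<close>

lemma sig_sh:
  assumes "m \<in> Ms" and g: "g \<in> W"
  shows "cg (sig (sh True g m)) (grp_elem g * sig m)"
proof -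
  note gC = cg_refl[OF F_elem(2)[OF g]]
  have "cg (sig (sh True g (dl w G))) (grp_elem g * sig1 w G * 1)" if w: "w \<in> W" for w G
  proof -
    have gw: "g \<circ> w \<in> W" by (rule W_comp[OF g w])
    have sC: "cg (sig1 w G) (sig1 w G)" if "w \<in> W" for w G by (rule cg_refl[OF sig1_carrier[OF that]])
    have "cg (sig1 (g \<circ> w) (act True g G)) (grp_elem g * sig1 w G)"
    proof (induction G rule: mpol_induct)
      case (const c)
      show ?case
        using cg_mult[OF cg_refl[OF F_closed(6), of c] cg_sym[OF cg_grp_grp[OF g w]]]
        by (simp only: act_Cst sig1_Cst scalar_left_commute)
    next
      case (var a G)
      obtain b i where a: "a = (b, i)" by (cases a)
      show ?case
      proof (cases b)
        case True
        have "cg (sig1 (g \<circ> w) (act True g (X a * G))) (vec_elem 1 (g (axis i 1)) * sig1 (g \<circ> w) (act True g G))"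
          using sig1_lin(1)[OF gw] by (simp add: a True act_simps act_X)
        also have "cg \<dots> (vec_elem 1 (g (axis i 1)) * (grp_elem g * sig1 w G))"
          by (intro cg_mult cg_refl F_elem var)
        also have "cg \<dots> (grp_elem g * vec_elem 1 (axis i 1) * sig1 w G)"
          using cg_mult[OF cg_sym[OF cg_grp_vec[OF g]] sC[OF w]] by (simp add: mult.assoc)
        also have "cg \<dots> (grp_elem g * sig1 w (X a * G))"
          using cg_mult[OF gC cg_sym[OF sig1_X(1)[OF w]]] by (simp add: a True vec_elem_axis mult.assoc)
        finally show ?thesis .
      next
        case False
        have "cg (sig1 (g \<circ> w) (act True g (X a * G))) (sig1 (g \<circ> w) (act True g G) * letter (Gen 0 i))"
          using sig1_X(2)[OF gw] by (simp add: a False act_simps act_X)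
        also have "cg \<dots> (grp_elem g * sig1 w G * letter (Gen 0 i))"
          by (intro cg_mult cg_refl F_elem var)
        also have "cg \<dots> (grp_elem g * sig1 w (X a * G))"
          using cg_mult[OF gC cg_sym[OF sig1_X(2)[OF w]]] by (simp add: a False mult.assoc)
        finally show ?thesis .
      qed
    next
      case (add G H)
      then show ?case using cg_add by (simp add: act_simps sig1_add distrib_left)
    qed
    then show ?thesis using gw by (simp add: sh_dl g w trn_def W_inv_inv sig_dl)
  qed
  then have "cg (sig (sh True g m)) (grp_elem g * sig m * 1)"
    by (rule cg_Ms_induct[OF assms(1) linear_sh]) (simp_all add: F_elem F_closed g)
  then show ?thesis by simp
qed

text \<open>Moving \<open>u\<^sub>0\<close> past a variable on the left of w uses the commutation
  relation, and \<open>dun_mul\<close> produces exactly the same terms. On a bare group element it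
  passes w by the cross relation.\<close>

lemma sig_dun:
  assumes "m \<in> Ms"
  shows "cg (sig (dun True u m)) (vec_elem 0 u * sig m)"
proof -
  note vC = cg_refl[OF F_elem(1)]
  have "cg (sig (dun True u (dl w G))) (vec_elem 0 u * sig1 w G * 1)" if w: "w \<in> W" for w G
  proof -
    note dM = Ms_simps(6)[OF w]
    have sC: "cg (sig m) (sig m)" for m by (rule cg_refl[OF sig_carrier])
    have "cg (sig (dun True u (dl w G))) (vec_elem 0 u * sig (dl w G))"
    proof (rule mpol_induct[where f = G and P = "\<lambda>G. cg (sig (dun True u (dl w G))) (vec_elem 0 u * sig (dl w G))"])
      fix c :: complex
      let ?u = "inv_into UNIV w u"
      have dC: "dl w (Cst c) = scale c (dl w 1)" using dl_simps(2)[of w c 1] by simp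
      have "cg (sig (mul False ?u (dl w 1))) (grp_elem w * vec_elem 0 ?u)"
        using sig_mul(2)[OF dM, of ?u 1] sig1_Cst[of w 1] by (simp add: sig_dl w Cst_simps scalar_mult)
      also have "cg \<dots> (vec_elem 0 u * grp_elem w)"
        using cg_grp_vec[OF w, of 0 ?u] by (simp add: W_inv_apply[OF w])
      finally have "cg (sig (dun True u (dl w 1))) (vec_elem 0 u * sig (dl w 1))"
        using dun_dl_one[OF w, of True u] sig1_Cst[of w 1] by (simp add: tw_def sig_dl w Cst_simps scalar_mult)
      then have "cg (scalar c * sig (dun True u (dl w 1))) (scalar c * (vec_elem 0 u * sig (dl w 1)))"
        by (intro cg_mult cg_refl F_closed)
      then show "cg (sig (dun True u (dl w (Cst c)))) (vec_elem 0 u * sig (dl w (Cst c)))"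
        unfolding dC by (simp add: linear_op_dunD sig_scale scalar_left_commute)
    next
      fix a :: "bool \<times> 'n" and G :: "(bool \<times> 'n, complex) mpol"
      assume IH: "cg (sig (dun True u (dl w G))) (vec_elem 0 u * sig (dl w G))"
      obtain b i where a: "a = (b, i)" by (cases a)
      have X: "dl w (X a * G) = mul b (axis i 1) (dl w G)" by (simp add: a mul_apply_dl lin_axis)
      show "cg (sig (dun True u (dl w (X a * G)))) (vec_elem 0 u * sig (dl w (X a * G)))"
      proof (cases b)
        case True
        let ?e = "axis i 1 :: real^'n" and ?m = "dl w G"
        have "cg (sig (dun True u (mul True ?e ?m))) (vec_elem 1 ?e * (vec_elem 0 u * sig ?m) + scalar (ir (u \<bullet> ?e)) * sig ?m
          + (\<Sum>v\<in>R. scalar (c0 v * ir (u \<bullet> v) * ir (v \<bullet> ?e)) * (grp_elem (reflection v) * sig ?m)))"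
        proof -
          have "cg (sig (mul True ?e (dun True u ?m))) (vec_elem 1 ?e * (vec_elem 0 u * sig ?m))"
            by (rule cg_trans[OF sig_mul(1)[OF dun_Ms[OF dM]] cg_mult[OF vC IH]])
          then show ?thesis
            unfolding dun_mul sig_add sig_sum sig_scale cc_eq mult_1_left
            by (intro cg_add cg_sum cg_mult cg_refl F_closed sC sig_sh W_refl dM)
        qed
        also have "\<dots> = (vec_elem 1 ?e * vec_elem 0 u + commutator_rhs R \<nu> u ?e) * sig ?m"
        proof -
          have "\<nu> v * complex_of_real ((u \<bullet> v) * (?e \<bullet> v) / (v \<bullet> v)) = c0 v * ir (u \<bullet> v) * ir (v \<bullet> ?e)" for v
            by (simp add: c0_def ir_complex inner_commute mult.assoc)
          then show ?thesis
            unfolding commutator_rhs_def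
            by (simp only: distrib_right sum_distrib_right mult.assoc ir_complex add.assoc)
        qed
        also have "cg \<dots> (vec_elem 0 u * vec_elem 1 ?e * sig ?m)"
          using cg_mult[OF cg_sym[OF cg_vec_vec[of 0 u 1 ?e]] sC] by (simp add: eps_def scalar_mult)
        also have "cg \<dots> (vec_elem 0 u * sig (mul True ?e ?m))"
          using cg_mult[OF vC cg_sym[OF sig_mul(1)[OF dM]]] by (simp add: mult.assoc)
        finally show ?thesis unfolding X using True by simp
      next
        case False
        have "cg (sig (mul False (axis i 1) (dun True u (dl w G)))) (vec_elem 0 u * sig (dl w G) * vec_elem 0 (axis i 1))"
          by (rule cg_trans[OF sig_mul(2)[OF dun_Ms[OF dM]] cg_mult[OF IH vC]])
        also have "cg \<dots> (vec_elem 0 u * sig (mul False (axis i 1) (dl w G)))"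
          using cg_mult[OF vC cg_sym[OF sig_mul(2)[OF dM]]] by (simp add: mult.assoc)
        finally show ?thesis unfolding X using False dun_mul_other[OF dM, of True u] by simp
      qed
    next
      fix G H :: "(bool \<times> 'n, complex) mpol"
      assume "cg (sig (dun True u (dl w G))) (vec_elem 0 u * sig (dl w G))"
        "cg (sig (dun True u (dl w H))) (vec_elem 0 u * sig (dl w H))"
      then show "cg (sig (dun True u (dl w (G + H)))) (vec_elem 0 u * sig (dl w (G + H)))"
        using cg_add by (simp add: dl_simps linear_op_dunD sig_add distrib_left)
    qed
    then show ?thesis by (simp add: sig_dl w)
  qed
  then have "cg (sig (dun True u m)) (vec_elem 0 u * sig m * 1)"
    by (rule cg_Ms_induct[OF assms(1) linear_dun]) (simp_all add: F_elem F_closed)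
  then show ?thesis by simp
qed

lemma sig_lop: "a \<in> generators R \<Longrightarrow> m \<in> Ms \<Longrightarrow> cg (sig (lop a m)) (letter a * sig m)"
proof (erule letter_W)
  fix \<alpha> i assume "a = Gen \<alpha> i" "m \<in> Ms"
  then show ?thesis
    using two_cases[of \<alpha>] sig_dun sig_mul(1) by (auto simp: vec_elem_axis[symmetric])
next
  fix g assume "a = Grp g" "g \<in> W" "m \<in> Ms"
  then show ?thesis using sig_sh by (simp add: grp_elem_def[symmetric])
qed

lemma single_Cons: "Poly_Mapping.single (FWord (a # l)) c = letter a * Poly_Mapping.single (FWord l) c"
  by (simp add: letter_def mult_single plus_fword_def)

lemma sig_wact: "set l \<subseteq> generators R \<Longrightarrow> cg (sig (wact l unit1)) (Poly_Mapping.single (FWord l) 1)"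
proof (induction l)
  case Nil
  have "sig (wact [] unit1) = grp_elem id"
    using sig1_Cst[of id 1] by (simp add: wact_simps unit1_def sig_dl W_id Cst_simps scalar_mult)
  moreover have "(Poly_Mapping.single (FWord []) 1 :: 'n observable) = 1"
    by (metis single_one zero_fword_def)
  ultimately show ?case using cg_grp_id by simp
next
  case (Cons a l)
  then have a: "a \<in> generators R" and l: "set l \<subseteq> generators R" by auto
  have "cg (sig (lop a (wact l unit1))) (letter a * sig (wact l unit1))"
    by (rule sig_lop[OF a wact_Ms[OF l unit1_Ms]])
  also have "cg \<dots> (letter a * Poly_Mapping.single (FWord l) 1)"
    by (intro cg_mult cg_refl F_letter a Cons.IH l)
  finally show ?case by (simp add: wact_simps single_Cons)
qed

lemma sig_act_nc:
  assumes "f \<in> carrier F"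
  shows "cg (sig (act_nc f unit1)) f"
proof -
  have "cg (\<Sum>w\<in>Poly_Mapping.keys f. scalar (Poly_Mapping.lookup f w) * sig (wact (letters w) unit1))
    (\<Sum>w\<in>Poly_Mapping.keys f. scalar (Poly_Mapping.lookup f w) * Poly_Mapping.single (FWord (letters w)) 1)"
    using assms by (intro cg_sum cg_mult cg_refl F_closed sig_wact) (simp add: carrier_F)
  moreover have "(\<Sum>w\<in>Poly_Mapping.keys f. scalar (Poly_Mapping.lookup f w) * Poly_Mapping.single (FWord (letters w)) 1) = f"
    by (subst (3) poly_mapping_expand[of f]) (simp add: scalar_def mult_single)
  ultimately show ?thesis unfolding act_nc_def by (simp add: sig_sum sig_scale)
qed

text \<open>The annihilator of the bimodule is an ideal. At s = 1 it contains the relations, hence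
  the ideal they generate.\<close>

lemma act_nc_Id: "f \<in> Id \<Longrightarrow> m \<in> Ms \<Longrightarrow> act_nc f m = 0"
proof -
  assume f: "f \<in> Id" and m: "m \<in> Ms"
  let ?K = "{f \<in> carrier F. \<forall>m\<in>Ms. act_nc f m = 0}"
  interpret F: ring F by (rule free_superalgebra_ring)
  have "subgroup ?K (add_monoid F)"
  proof (rule F.add.subgroupI)
    show "?K \<noteq> {}" using F_closed(4) act_nc_0 by auto
    fix f assume f: "f \<in> ?K"
    have "\<ominus>\<^bsub>F\<^esub> f = - f" using F.minus_equality[of "- f" f] f F_closed(3) by (simp add: F_ops)
    then show "\<ominus>\<^bsub>F\<^esub> f \<in> ?K" using f F_closed(3) act_nc_uminus[of f] by simp
  qed (auto simp: act_nc_add F_closed F_ops)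
  then have "ideal ?K F"
    by (rule idealI[OF free_superalgebra_ring])
      (auto simp: F_ops act_nc_mult F_closed act_nc_Ms linear_opD[OF linear_act_nc])
  moreover have "calogero_relations R \<nu> \<subseteq> ?K"
    using relation_act calogero_relations_carrier by (fastforce simp: scale_simps)
  ultimately have "Id \<subseteq> ?K" by (rule F.genideal_minimal)
  then show ?thesis using f m by blast
qed

lemma act_nc_cg: "cg f g \<Longrightarrow> m \<in> Ms \<Longrightarrow> act_nc f m = act_nc g m"
  using act_nc_Id[of "f - g" m] by (simp add: cg_def act_nc_diff)

lemma act_nc_sig:
  assumes "m \<in> Ms"
  shows "act_nc (sig m) unit1 = m"
  using assms
proof (induction rule: Ms_induct)
  case zero
  show ?case by (simp add: sig_0 act_nc_0)
next
  case (dl w G)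
  note U = unit1_Ms
  show ?case
  proof (rule mpol_induct[where f = G and P = "\<lambda>G. act_nc (sig (dl w G)) unit1 = dl w G"])
    fix c :: complex
    have c: "dl w (Cst c) = scale c (dl w (1 :: (bool \<times> 'n, complex) mpol))"
      using dl_simps(2)[of w c "1 :: (bool \<times> 'n, complex) mpol"] by simp
    show "act_nc (sig (dl w (Cst c))) unit1 = dl w (Cst c)"
      unfolding sig_dl[OF dl] sig1_Cst act_nc_mult act_nc_scalar grp_elem_act unit1_def
      unfolding c by (simp add: sh_dl dl act_1 trn_def W_inv_inv)
  next
    fix a :: "bool \<times> 'n" and G :: "(bool \<times> 'n, complex) mpol"
    assume IH: "act_nc (sig (dl w G)) unit1 = dl w G"
    obtain b i where a: "a = (b, i)" by (cases a)
    have X: "dl w (X a * G) = mul b (axis i 1) (dl w G)" by (simp add: a mul_apply_dl lin_axis)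
    have "act_nc (sig1 w (X a * G)) unit1 = mul b (axis i 1) (dl w G)"
    proof (cases b)
      case True
      then show ?thesis
        using act_nc_cg[OF sig1_X(1)[OF dl, of i G] U] IH a
        by (simp add: sig_dl dl act_nc_mult act_nc_letter)
    next
      case False
      have "act_nc (sig1 w G * letter (Gen 0 i)) unit1 = rop (Gen 0 i) (act_nc (sig1 w G) unit1)"
        by (rule act_nc_letter_right[OF sig1_carrier[OF dl] Gen_generators])
      then show ?thesis
        using act_nc_cg[OF sig1_X(2)[OF dl, of i G] U] IH False a by (simp add: sig_dl dl)
    qed
    then show "act_nc (sig (dl w (X a * G))) unit1 = dl w (X a * G)"
      using sig_dl[OF dl, of "X a * G"] X by simp
  next
    fix G H :: "(bool \<times> 'n, complex) mpol"
    assume "act_nc (sig (dl w G)) unit1 = dl w G" "act_nc (sig (dl w H)) unit1 = dl w H"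
    then show "act_nc (sig (dl w (G + H))) unit1 = dl w (G + H)" by (simp add: dl_simps sig_add act_nc_add)
  qed
next
  case (add f g)
  then show ?case by (simp add: sig_add act_nc_add)
qed

text \<open>Right multiplication needs no computation of its own: on the unit it is given by
  appending the letter, and every element is obtained from the unit.\<close>

lemma sig_rop:
  assumes a: "a \<in> generators R" and m: "m \<in> Ms"
  shows "cg (sig (rop a m)) (sig m * letter a)"
proof -
  have "rop a m = act_nc (sig m * letter a) unit1"
    by (simp add: act_nc_letter_right[OF sig_carrier a] act_nc_sig[OF m])
  then show ?thesis using sig_act_nc[OF F_closed(2)[OF sig_carrier F_letter[OF a]]] by metis
qed

end

section \<open>Functionals on the quotient\<close>

context calogero
begin

abbreviation H where "H \<equiv> calogero_superalgebra R \<nu>"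

abbreviation cl where "cl f \<equiv> Id +>\<^bsub>F\<^esub> f"

lemma cl_def: "cl f = {h + f |h. h \<in> Id}"
  by (auto simp: a_r_coset_def' F_ops)

lemma cl_eq:
  assumes "f \<in> carrier F" "g \<in> carrier F"
  shows "cl f = cl g \<longleftrightarrow> f - g \<in> Id"
proof
  assume "cl f = cl g"
  moreover have "f \<in> cl f" unfolding cl_def using Id_closed(4) by force
  ultimately obtain h where "f = h + g" "h \<in> Id" unfolding cl_def by blast
  then show "f - g \<in> Id" by simp
next
  assume d: "f - g \<in> Id"
  have "h + f = (h + (f - g)) + g" "h + g = (h + - (f - g)) + f" for h by simp_all
  then show "cl f = cl g" unfolding cl_def using Id_closed(1) d Id_closed(5)[OF d]
    by (metis (no_types, opaque_lifting))
qed

lemma H_carrier: "carrier H = cl ` carrier F"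
  by (auto simp: calogero_superalgebra_def Let_def quotient_superalgebra_def FactRing_def A_RCOSETS_def')

lemma H_ops:
  assumes f: "f \<in> carrier F" and g: "g \<in> carrier F"
  shows "cl f \<oplus>\<^bsub>H\<^esub> cl g = cl (f + g)" "cl f \<otimes>\<^bsub>H\<^esub> cl g = cl (f * g)"
    "c \<odot>\<^bsub>H\<^esub> cl f = cl (scalar c * f)"
proof -
  have mult: "cl f \<otimes>\<^bsub>F Quot Id\<^esub> cl g = cl (f * g)" if "f \<in> carrier F" "g \<in> carrier F" for f g
    using ideal.rcoset_mult_add[OF ideal_Id that] by (simp add: FactRing_def F_ops)
  have "cl f <+>\<^bsub>F\<^esub> cl g = cl (f + g)"
  proof (intro equalityI subsetI)
    fix x assume "x \<in> cl f <+>\<^bsub>F\<^esub> cl g"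
    then obtain h h' where "h \<in> Id" "h' \<in> Id" "x = (h + f) + (h' + g)"
      unfolding set_add_def' F_ops cl_def by blast
    then have "h + h' \<in> Id" "x = (h + h') + (f + g)" using Id_closed(1) by simp_all
    then show "x \<in> cl (f + g)" unfolding cl_def by blast
  next
    fix x assume "x \<in> cl (f + g)"
    then obtain h where "h \<in> Id" "x = h + (f + g)" unfolding cl_def by blast
    then have "h \<in> Id" "x = (h + f) + (0 + g)" by (simp_all add: add.assoc)
    then show "x \<in> cl f <+>\<^bsub>F\<^esub> cl g"
      unfolding set_add_def' F_ops cl_def using Id_closed(4) by blast
  qed
  then show "cl f \<oplus>\<^bsub>H\<^esub> cl g = cl (f + g)"
    by (simp add: calogero_superalgebra_def Let_def quotient_superalgebra_def FactRing_def)
  show "cl f \<otimes>\<^bsub>H\<^esub> cl g = cl (f * g)"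
    using mult[OF f g] by (simp add: calogero_superalgebra_def Let_def quotient_superalgebra_def)
  have "c \<odot>\<^bsub>F\<^esub> \<one>\<^bsub>F\<^esub> = scalar c" by (simp add: free_superalgebra_def)
  then show "c \<odot>\<^bsub>H\<^esub> cl f = cl (scalar c * f)"
    using mult[OF F_closed(6) f] by (simp add: calogero_superalgebra_def Let_def quotient_superalgebra_def)
qed

lemmas H_smult = H_ops(3)[OF _ F_closed(4)]

lemma H_homog: "homog H n = cl ` homog F n"
  by (simp add: calogero_superalgebra_def Let_def quotient_superalgebra_def)

lemma homog_iff: "f \<in> homog F n \<longleftrightarrow> (\<forall>w\<in>Poly_Mapping.keys f. set (letters w) \<subseteq> generators R \<and>
    length (filter is_gen (letters w)) mod 2 = n)"
  by (simp add: free_superalgebra_def)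

lemma homog_carrier: "f \<in> homog F n \<Longrightarrow> f \<in> carrier F"
  by (simp add: homog_iff carrier_F)

lemma homog_add: "f \<in> homog F n \<Longrightarrow> g \<in> homog F n \<Longrightarrow> f + g \<in> homog F n"
  using Poly_Mapping.keys_add[of f g] unfolding homog_iff by blast

lemma homog_0: "0 \<in> homog F n"
  by (simp add: homog_iff)

lemma homog_mult:
  assumes "f \<in> homog F m" "g \<in> homog F n"
  shows "f * g \<in> homog F ((m + n) mod 2)"
  unfolding homog_iff
proof
  fix w assume "w \<in> Poly_Mapping.keys (f * g)"
  then obtain u v where "w = u + v" "u \<in> Poly_Mapping.keys f" "v \<in> Poly_Mapping.keys g"
    using Poly_Mapping.keys_mult[of f g] by blast
  then show "set (letters w) \<subseteq> generators R \<and> length (filter is_gen (letters w)) mod 2 = (m + n) mod 2"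
    using assms mod_add_eq[of "length (filter is_gen (letters u))" 2 "length (filter is_gen (letters v))"]
    unfolding homog_iff by (simp add: plus_fword_def)
qed

lemma homog_scalar: "scalar c \<in> homog F 0"
  by (auto simp: homog_iff scalar_def zero_fword_def)

lemma homog_scalar_mult: "f \<in> homog F n \<Longrightarrow> n < 2 \<Longrightarrow> scalar c * f \<in> homog F n"
  using homog_mult[OF homog_scalar] by fastforce

lemma homog_letter: "letter (Gen \<alpha> i) \<in> homog F 1" "g \<in> W \<Longrightarrow> grp_elem g \<in> homog F 0"
  by (auto simp: homog_iff letter_def grp_elem_def Gen_generators Grp_generators)

lemma homog_sum: "(\<And>i. i \<in> I \<Longrightarrow> f i \<in> homog F n) \<Longrightarrow> sum f I \<in> homog F n"
  by (induction I rule: infinite_finite_induct) (auto intro: homog_add homog_0)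

lemma homog_gw: "gw \<alpha> l \<in> homog F (length l mod 2)"
proof (induction l)
  case Nil
  show ?case using homog_scalar[of 1] by (simp add: gw_simps scalar_mult)
next
  case (Cons i l)
  show ?case using homog_mult[OF homog_letter(1) Cons, of \<alpha> i] by (simp add: gw_simps mod_Suc_eq)
qed

lemma homog_oword:
  assumes w: "w \<in> W"
  shows "oword w m \<in> homog F (size m mod 2)"
proof -
  have "length (part b m) = size (filter_mset (\<lambda>a. fst a = b) m)" for b
    by (metis mset_part size_image_mset size_mset)
  moreover have "size m = size (filter_mset (\<lambda>a. fst a = True) m) + size (filter_mset (\<lambda>a. fst a = False) m)"
    using multiset_partition[of m fst] by (metis (mono_tags, lifting) filter_mset_cong size_union)
  ultimately have "size m = length (part True m) + length (part False m)" by simp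
  then show ?thesis
    using homog_mult[OF homog_mult[OF homog_gw homog_letter(2)[OF w]] homog_gw, of 1 "part True m" 0 "part False m"]
    by (simp add: oword_def mod_add_eq)
qed

text \<open>A trace pulled back to the free superalgebra, where representatives replace cosets and
  vanishing on the ideal becomes an explicit condition.\<close>

definition nc_trace :: "real \<Rightarrow> ('n observable \<Rightarrow> complex) \<Rightarrow> bool" where
  "nc_trace k t \<longleftrightarrow> (\<forall>f\<in>Id. t f = 0) \<and> (\<forall>f\<in>carrier F. \<forall>g\<in>carrier F. t (f + g) = t f + t g) \<and>
     (\<forall>c. \<forall>f\<in>carrier F. t (scalar c * f) = c * t f) \<and>
     (\<forall>n\<in>{0, 1}. \<forall>m\<in>{0, 1}. \<forall>f\<in>homog F n. \<forall>g\<in>homog F m.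
        t (f * g) = complex_of_real k ^ (n * m) * t (g * f))"

lemma nc_traceD:
  assumes "nc_trace k t"
  shows "f \<in> Id \<Longrightarrow> t f = 0" "f \<in> carrier F \<Longrightarrow> g \<in> carrier F \<Longrightarrow> t (f + g) = t f + t g"
    "f \<in> carrier F \<Longrightarrow> t (scalar c * f) = c * t f"
    "n \<in> {0, 1} \<Longrightarrow> m \<in> {0, 1} \<Longrightarrow> f \<in> homog F n \<Longrightarrow> g \<in> homog F m \<Longrightarrow>
      t (f * g) = complex_of_real k ^ (n * m) * t (g * f)"
  using assms unfolding nc_trace_def by blast+

lemma nc_trace_of_trace:
  assumes "\<tau> \<in> kappa_traces k H"
  shows "nc_trace k (\<lambda>f. \<tau> (cl f))"
proof -
  have add: "\<tau> (cl f \<oplus>\<^bsub>H\<^esub> cl g) = \<tau> (cl f) + \<tau> (cl g)" if "f \<in> carrier F" "g \<in> carrier F" for f g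
    using assms that by (auto simp: kappa_traces_def H_carrier)
  have sc: "\<tau> (c \<odot>\<^bsub>H\<^esub> cl f) = c * \<tau> (cl f)" if "f \<in> carrier F" for c f
    using assms that by (auto simp: kappa_traces_def H_carrier)
  have tr: "\<tau> (cl f \<otimes>\<^bsub>H\<^esub> cl g) = complex_of_real k ^ (n * m) * \<tau> (cl g \<otimes>\<^bsub>H\<^esub> cl f)"
    if "n \<in> {0, 1}" "m \<in> {0, 1}" "f \<in> homog F n" "g \<in> homog F m" for n m f g
    using assms that unfolding kappa_traces_def H_homog by blast
  have 0: "\<tau> (cl 0) = 0" using sc[OF F_closed(4), of 0] by (simp add: H_smult F_closed)
  show ?thesis
    unfolding nc_trace_def
  proof (intro conjI ballI allI)
    fix f assume f: "f \<in> Id"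
    have "cl f = cl 0" using f cl_eq[OF Id_closed(6)[OF f] F_closed(4)] by simp
    then show "\<tau> (cl f) = 0" using 0 by simp
  next
    fix f g assume fg: "f \<in> carrier F" "g \<in> carrier F"
    show "\<tau> (cl (f + g)) = \<tau> (cl f) + \<tau> (cl g)" using add[OF fg] H_ops(1)[OF fg] by simp
  next
    fix c f assume f: "f \<in> carrier F"
    show "\<tau> (cl (scalar c * f)) = c * \<tau> (cl f)" using sc[OF f, of c] H_smult[OF f, of c] by simp
  next
    fix n m :: nat and f g
    assume nm: "n \<in> {0, 1}" "m \<in> {0, 1}" and fg: "f \<in> homog F n" "g \<in> homog F m"
    note f = homog_carrier[OF fg(1)] and g = homog_carrier[OF fg(2)]
    show "\<tau> (cl (f * g)) = complex_of_real k ^ (n * m) * \<tau> (cl (g * f))"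
      using tr[OF nm fg] H_ops(2)[OF f g] H_ops(2)[OF g f] by simp
  qed
qed

definition trace_of :: "('n observable \<Rightarrow> complex) \<Rightarrow> 'n observable set \<Rightarrow> complex" where
  "trace_of t Y = (if Y \<in> carrier H then t (SOME f. f \<in> carrier F \<and> Y = cl f) else 0)"

text \<open>Two representatives of a coset differ by an element of the ideal, on which
  \<open>t\<close> vanishes, so the choice in \<open>trace_of\<close> is harmless.\<close>

lemma trace_of_cl:
  assumes t: "nc_trace k t" and f: "f \<in> carrier F"
  shows "trace_of t (cl f) = t f"
proof -
  let ?g = "SOME g. g \<in> carrier F \<and> cl f = cl g"
  have g: "?g \<in> carrier F \<and> cl f = cl ?g" by (rule someI[of _ f]) (simp add: f)
  then have d: "f - ?g \<in> Id" using cl_eq f by blast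
  have "t f = t (?g + (f - ?g))" by simp
  also have "\<dots> = t ?g + t (f - ?g)" using g by (intro nc_traceD(2)[OF t] Id_closed(6)[OF d]) simp
  also have "t (f - ?g) = 0" by (rule nc_traceD(1)[OF t d])
  finally show ?thesis unfolding trace_of_def H_carrier using f by simp
qed

lemma trace_of_trace:
  assumes t: "nc_trace k t"
  shows "trace_of t \<in> kappa_traces k H"
  unfolding kappa_traces_def H_homog
proof (intro CollectI conjI ballI allI impI)
  show "trace_of t Y = 0" if "Y \<notin> carrier H" for Y using that by (simp add: trace_of_def)
next
  fix Y Z assume "Y \<in> carrier H" "Z \<in> carrier H"
  then obtain f g where fg: "f \<in> carrier F" "g \<in> carrier F" "Y = cl f" "Z = cl g" unfolding H_carrier by blast
  then show "trace_of t (Y \<oplus>\<^bsub>H\<^esub> Z) = trace_of t Y + trace_of t Z"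
    using t by (simp add: H_ops trace_of_cl[OF t] F_closed) (simp add: nc_trace_def)
next
  fix c Y assume "Y \<in> carrier H"
  then obtain f where f: "f \<in> carrier F" "Y = cl f" unfolding H_carrier by blast
  then show "trace_of t (c \<odot>\<^bsub>H\<^esub> Y) = c * trace_of t Y"
    using t by (simp add: H_smult trace_of_cl[OF t] F_closed) (simp add: nc_trace_def)
next
  fix n m :: nat and Y Z assume nm: "n \<in> {0, 1}" "m \<in> {0, 1}" and "Y \<in> cl ` homog F n" "Z \<in> cl ` homog F m"
  then obtain f g where fg: "f \<in> homog F n" "g \<in> homog F m" "Y = cl f" "Z = cl g" by blast
  then have "t (f * g) = complex_of_real k ^ (n * m) * t (g * f)"
    using nm by (intro nc_traceD(4)[OF t]) auto
  then show "trace_of t (Y \<otimes>\<^bsub>H\<^esub> Z) = complex_of_real k ^ (n * m) * trace_of t (Z \<otimes>\<^bsub>H\<^esub> Y)"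
    using fg homog_carrier by (simp add: H_ops trace_of_cl[OF t] F_closed)
qed

section \<open>Projections onto even and odd degree\<close>

definition par :: "bool \<Rightarrow> ((real^'n \<Rightarrow> real^'n) \<Rightarrow> (bool \<times> 'n, 'k) mpol) \<Rightarrow> _" where
  "par c m = (\<lambda>w. degree_scale (\<lambda>n. if even n = c then 1 else 0) (m w))"

lemma linear_par: "linear_op (par c)"
  by (rule linear_opI) (auto simp: par_def fun_eq_iff fun_apply scale_def degree_scale_add degree_scale_Cst_mult)

lemma degree_scale_0: "degree_scale r 0 = 0"
  by (rule poly_mapping_eqI) (simp add: lookup_degree_scale)

lemma par_Par: "m \<in> Ms \<Longrightarrow> par c m \<in> Par c"
  by (auto simp: par_def Par_def Ms_def degree_scale_0) (auto simp: Graded_def in_keys_iff lookup_degree_scale split: if_splits)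

lemma Par_lookup: "m \<in> Par c \<Longrightarrow> Poly_Mapping.lookup (m w) x = 0 \<or> even (size x) = c"
  by (force simp: Par_def Graded_def in_keys_iff)

lemma par_id: "m \<in> Par c \<Longrightarrow> par c m = m"
  by (rule ext, rule poly_mapping_eqI) (use Par_lookup[of m c] in \<open>auto simp: par_def lookup_degree_scale\<close>)

lemma par_other: "m \<in> Par (\<not> c) \<Longrightarrow> par c m = 0"
  by (rule ext, rule poly_mapping_eqI)
    (use Par_lookup[of m "\<not> c"] in \<open>auto simp: par_def lookup_degree_scale fun_apply\<close>)

lemma par_sum: "m = par c m + par (\<not> c) m"
  by (auto simp: par_def fun_eq_iff fun_apply lookup_add lookup_degree_scale intro!: poly_mapping_eqI)

end

context calogero_twist
begin

text \<open>Such a functional kills every \<open>GG f\<close>, and by the fourth hypothesis also the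
  \<open>cpart\<close> components. Hence it takes the same value on f and \<open>Gam f\<close>, and
  iterating reaches 0.\<close>

lemma twisted_functional_unique:
  assumes add: "\<And>f g. f \<in> Ms \<Longrightarrow> g \<in> Ms \<Longrightarrow> L (f + g) = L f + L g"
    and sc: "\<And>c f. f \<in> Ms \<Longrightarrow> L (scale c f) = c * L f"
    and T: "\<And>b u f. f \<in> Ms \<Longrightarrow> L (T b u f) = (0 :: 'k)"
    and 1: "\<And>w. w \<in> W \<Longrightarrow> E w = 0 \<Longrightarrow> L (dl w 1) = 0"
    and m: "m \<in> Ms"
  shows "L m = 0"
proof -
  have 0: "L 0 = 0" using sc[OF Ms_simps(1), of 0] by (simp add: scale_simps)
  have diff: "L (f - g) = L f - L g" if "f \<in> Ms" "g \<in> Ms" for f g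
    using add[of "f - g" g] that by (simp add: Ms_simps)
  have sum: "finite I \<Longrightarrow> (\<And>i. i \<in> I \<Longrightarrow> f i \<in> Ms) \<Longrightarrow> L (sum f I) = (\<Sum>i\<in>I. L (f i))"
    for I :: "'i set" and f
  proof (induction I rule: finite_induct)
    case (insert i I)
    then have "sum f I \<in> Ms" by (intro Ms_sum) auto
    then show ?case unfolding sum.insert[OF insert(1,2)] using insert add by simp
  qed (simp only: sum.empty 0)
  note TdM = T_Ms[OF Ms_simps(6)]
  have GG1: "L (GG1 w G) = 0" if "w \<in> W" for w G
    unfolding GG1_def using that
    by (simp add: sum diff sc T TdM Ms_simps Ms_sum)
  then have GG: "L (GG f) = 0" for f
    unfolding GG_def by (simp add: sum finite_W GG1_Ms)
  have cp: "L (\<lambda>w. cpart w (f w)) = 0" if "f \<in> Ms" for f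
    using that
  proof (induction rule: Ms_induct)
    case zero
    then show ?case using 0 by (simp add: fun_apply cpart_simps zero_fun_def)
  next
    case (dl w G)
    have "(\<lambda>w'. cpart w' (dl w G w')) = (if E w = 0 then scale (ct G) (dl w 1) else 0)"
      by (rule ext) (auto simp: dl_def cpart_def scale_def ct_simps Cst_simps fun_apply)
    then show ?case using 1 dl by (simp add: sc Ms_simps 0)
  next
    case (add f g)
    have "(\<lambda>w. cpart w ((f + g) w)) = (\<lambda>w. cpart w (f w)) + (\<lambda>w. cpart w (g w))"
      by (simp add: fun_eq_iff fun_apply cpart_simps)
    moreover have "(\<lambda>w. cpart w (h w)) \<in> Ms" if "h \<in> Ms" for h using that by (simp add: Ms_def cpart_simps)
    ultimately show ?case using add assms(1) by simp
  qed
  have "L f = L (Gam f)" if f: "f \<in> Ms" for f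
  proof -
    have cM: "(\<lambda>w. cpart w (f w)) \<in> Ms" using f by (simp add: Ms_def cpart_simps)
    have "Gam f = (f - (\<lambda>w. cpart w (f w))) - GG (\<lambda>w. rho w (f w))"
      by (simp add: Gam_def fun_eq_iff fun_apply)
    then show ?thesis by (simp add: diff Ms_simps f cM GG_Ms GG cp)
  qed
  then have "L ((Gam ^^ n) m) = L m" for n by (induction n) (simp_all add: Gam_pow_Ms m)
  moreover obtain N where "(Gam ^^ N) m = 0" using Gam_nilpotent[OF m] by blast
  ultimately show ?thesis using 0 by metis
qed

lemma E_zero_iff: "w \<in> W \<Longrightarrow> E w = 0 \<longleftrightarrow> \<not> has_eigenvalue w \<kappa>"
proof -
  assume w: "w \<in> W"
  have "E w = 0 \<longleftrightarrow> Fix \<kappa> w \<subseteq> {0}" unfolding E_def by simp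
  also have "\<dots> \<longleftrightarrow> \<not> has_eigenvalue w \<kappa>"
    using Fix_iff[OF \<kappa> W_orth[OF w]] unfolding has_eigenvalue_def by auto
  finally show ?thesis .
qed

end

section \<open>Uniqueness of traces\<close>

context calogero_complex
begin

lemma homog_sig1:
  assumes w: "w \<in> W" and G: "G \<in> Graded {j. even j = c}"
  shows "sig1 w G \<in> homog F (if c then 0 else 1)"
  using G
proof (induction rule: Graded_induct)
  case zero
  show ?case by (simp add: sig1_0 homog_0)
next
  case (single m d)
  then have "size m mod 2 = (if c then 0 else 1)" by (auto simp: odd_iff_mod_2_eq_one)
  then have "oword w m \<in> homog F (if c then 0 else 1)" using homog_oword[OF w, of m] by simp
  then show ?case unfolding sig1_single by (rule homog_scalar_mult) simp
next
  case (add f g)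
  then show ?case by (simp only: sig1_add homog_add)
qed

lemma homog_sig: "m \<in> Par c \<Longrightarrow> sig m \<in> homog F (if c then 0 else 1)"
  unfolding sig_def by (intro homog_sum homog_sig1) (auto simp: Par_def)

text \<open>The even and the odd part are treated by twisted commutators with possibly different
  signs. In the odd part the initial values vanish automatically, because group elements are
  even.\<close>

lemma nc_trace_unique:
  assumes k: "k \<in> {1, - 1}" and t: "nc_trace k t"
    and ell: "\<And>w. w \<in> W \<Longrightarrow> \<not> has_eigenvalue w k \<Longrightarrow> t (grp_elem w) = 0"
    and f: "f \<in> carrier F"
  shows "t f = 0"
proof -
  have add: "t (f + g) = t f + t g" if "f \<in> carrier F" "g \<in> carrier F" for f g
    using t that by (simp add: nc_trace_def)
  have sc: "t (scalar c * f) = c * t f" if "f \<in> carrier F" for f c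
    using t that by (simp add: nc_trace_def)
  have cg: "t f = t g" if "cg f g" for f g
  proof -
    have "t (g + (f - g)) = t g + t (f - g)" using that Id_closed(6) by (intro add) (auto simp: cg_def)
    moreover have "t (f - g) = 0" using that t by (simp add: cg_def nc_trace_def)
    ultimately show ?thesis by simp
  qed
  have lr: "t (sig (lop (Gen \<alpha> i) m)) = complex_of_real (if c then k else 1) * t (sig (rop (Gen \<alpha> i) m))"
    if m: "m \<in> Par (\<not> c)" for m c \<alpha> i
  proof -
    have mM: "m \<in> Ms" using m by (simp add: Par_def)
    have "t (sig (lop (Gen \<alpha> i) m)) = t (letter (Gen \<alpha> i) * sig m)"
      by (rule cg[OF sig_lop[OF Gen_generators mM]])
    also have "\<dots> = complex_of_real k ^ (1 * (if c then 1 else 0)) * t (sig m * letter (Gen \<alpha> i))"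
      using homog_sig[OF m] by (intro nc_traceD(4)[OF t _ _ homog_letter(1)]) (cases c; simp)+
    also have "t (sig m * letter (Gen \<alpha> i)) = t (sig (rop (Gen \<alpha> i) m))"
      by (rule cg[OF sig_rop[OF Gen_generators mM], symmetric])
    finally show ?thesis by (cases c) simp_all
  qed
  have part0: "t (sig (par c m)) = 0" if m: "m \<in> Ms" for m c
  proof -
    \<comment> \<open>If the twisted commutator of a generator with f is even, then f is odd and
      exchanging them costs k; if it is odd, then f is even and the exchange costs 1.\<close>
    define k' where "k' = (if c then k else 1)"
    have k': "k' \<in> {1, - 1}" using k by (auto simp: k'_def)
    interpret tw: calogero_twist R \<nu> "\<lambda>c. c" 1 k' by unfold_locales (rule k')
    have kk: "complex_of_real k' * complex_of_real k' = 1" using k' by auto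
    let ?L = "\<lambda>m. t (sig (par c m))"
    have Ladd: "?L (f + g) = ?L f + ?L g" for f g
      by (simp add: linear_opD[OF linear_par] sig_add add sig_carrier)
    have Lsc: "?L (scale d f) = d * ?L f" for d f
      by (simp add: linear_opD[OF linear_par] sig_scale sc sig_carrier)
    have axis: "?L (tw.T b (axis i 1) f) = 0" if f: "f \<in> Ms" for b i f
    proof -
      have P: "par d f \<in> Par d" for d by (rule par_Par[OF f])
      have TP: "tw.T b (axis i 1) g \<in> Par (\<not> d)" if "g \<in> Par d" for g d
        using mul_Par[OF that] dun_Par[OF that] by (simp add: tw.T_def Par_simps)
      have "tw.T b (axis i 1) f = tw.T b (axis i 1) (par c f) + tw.T b (axis i 1) (par (\<not> c) f)"
        by (subst par_sum[of f c]) (simp add: tw.T_simps)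
      then have "par c (tw.T b (axis i 1) f) = tw.T b (axis i 1) (par (\<not> c) f)"
        using par_other[OF TP[OF P]] par_id[OF TP[OF P, of "\<not> c"]] by (simp add: linear_opD[OF linear_par])
      moreover define g where "g = par (\<not> c) f"
      ultimately have eq: "?L (tw.T b (axis i 1) f) = t (sig (tw.T b (axis i 1) g))" by simp
      have g: "g \<in> Par (\<not> c)" unfolding g_def by (rule P)
      have s: "t (sig (f' - scale (ir k') g')) = t (sig f') - complex_of_real k' * t (sig g')" for f' g'
      proof -
        have "f' - scale (ir k') g' = f' + scale (- ir k') g'" by (simp add: scale_simps)
        then show ?thesis by (simp only: sig_add sig_scale add sc sig_carrier F_closed ir_complex) simp
      qed
      have "t (sig (tw.T b (axis i 1) g)) = 0"
      proof (cases b)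
        case True
        then show ?thesis using lr[OF g, of 1 i] unfolding tw.T_def s by (simp add: k'_def)
      next
        case False
        have "t (sig (dun True (axis i 1) g)) = complex_of_real k' * t (sig (mul False (axis i 1) g))"
          using lr[OF g, of 0 i] by (simp add: k'_def)
        then show ?thesis using False kk unfolding tw.T_def s by (simp add: mult.assoc[symmetric])
      qed
      then show ?thesis using eq by simp
    qed
    have "?L (tw.T b u f) = 0" if f: "f \<in> Ms" for b u f
    proof -
      have "tw.T b u f = (\<Sum>i\<in>UNIV. scale (ir (u $ i)) (tw.T b (axis i 1) f))"
        by (subst vec_expand[of u]) (simp add: tw.T_dir_sum f tw.T_dir_scale)
      moreover have "?L (sum h I) = (\<Sum>i\<in>I. ?L (h i))" for h and I :: "'n set"
        using sum_comp_morphism[of ?L h I] Lsc[of 0 0] by (simp add: Ladd o_def scale_simps)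
      ultimately show ?thesis by (simp add: Lsc axis f)
    qed
    moreover have "?L (dl w 1) = 0" if w: "w \<in> W" "tw.E w = 0" for w
    proof (cases c)
      case True
      have "dl w 1 \<in> Par True" by (rule dl_Par[OF w(1)]) (simp add: Graded_def)
      then have "?L (dl w 1) = t (grp_elem w)"
        using True sig1_Cst[of w 1] by (simp add: par_id sig_dl w Cst_simps scalar_mult)
      then show ?thesis using ell w tw.E_zero_iff[OF w(1)] True by (simp add: k'_def)
    next
      case False
      have "dl w 1 \<in> Par True" by (rule dl_Par[OF w(1)]) (simp add: Graded_def)
      then show ?thesis using False par_other[of "dl w 1" False] sc[OF F_closed(4), of 0] by (simp add: sig_0)
    qed
    ultimately show ?thesis by (intro tw.twisted_functional_unique[of ?L, OF Ladd Lsc _ _ m])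
  qed
  have m: "act_nc f unit1 \<in> Ms" by (rule act_nc_Ms[OF f unit1_Ms])
  have "t f = t (sig (act_nc f unit1))" by (rule cg[OF cg_sym[OF sig_act_nc[OF f]]])
  also have "\<dots> = t (sig (par True (act_nc f unit1))) + t (sig (par False (act_nc f unit1)))"
    by (subst par_sum[of _ True]) (simp add: sig_add add sig_carrier)
  finally show ?thesis by (simp add: part0[OF m])
qed

end

section \<open>Existence of traces\<close>

text \<open>A power of the variable beyond the degree cannot divide a nonzero polynomial.\<close>

lemma poly_eq_0_if_divisible:
  fixes z :: "complex poly"
  assumes "\<And>k. [:0, 1:] ^ k dvd z"
  shows "z = 0"
proof (rule ccontr)
  assume "z \<noteq> 0"
  then have "degree ([:0, 1 :: complex:] ^ Suc (degree z)) \<le> degree z"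
    by (intro dvd_imp_degree_le assms)
  then show False by (simp only: degree_linear_power)
qed

lemma ring_map_pCons: "ring_map (\<lambda>c. [:c :: complex:])"
  by (simp add: ring_map_def)

text \<open>The deformation parameter \<open>s\<close> multiplies all the constants \<open>\<nu>\<close>; the given superalgebra is the
  fibre at \<open>s = 1\<close>.\<close>

locale calogero_deformed = calogero_twist R \<nu> "\<lambda>c. [:c :: complex:]" "[:0, 1:]" \<kappa>
  for R :: "(real^'n) set" and \<nu> and \<kappa>
begin

lemma ir_poly: "ir c = [:complex_of_real c:]"
  by (simp add: ir_def)

context
  fixes a :: "(real^'n \<Rightarrow> real^'n) \<Rightarrow> complex poly"
  assumes a: "class_function a"
begin

lemma sp_T: "f \<in> Ms \<Longrightarrow> sp a (T b u f) = 0"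
  by (rule poly_eq_0_if_divisible) (rule T_dvd[OF a])

text \<open>For generators this restates the vanishing on \<open>T\<close>; for group elements it is
  the invariance under conjugation.\<close>

lemma sp_lop_rop:
  assumes x: "x \<in> generators R" and m: "m \<in> Ms"
  shows "sp a (lop x m) = (if is_gen x then ir \<kappa> else 1) * sp a (rop x m)"
  using x
proof (rule letter_W)
  fix \<alpha> i assume x: "x = Gen \<alpha> i"
  let ?e = "axis i 1 :: real^'n"
  have T: "sp a (mul b ?e m) = ir \<kappa> * sp a (dun (\<not> b) ?e m)" for b
    using sp_T[OF m, of b ?e] by (simp add: T_def sp_diff sp_scale mul_Ms dun_Ms Ms_simps m)
  show ?thesis
  proof (cases "\<alpha> = 0")
    case True
    \<comment> \<open>Here \<open>T\<close> gives the exchange in the opposite direction; it is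
      inverted by multiplying with \<kappa>, whose square is 1.\<close>
    have "ir \<kappa> * sp a (mul False ?e m) = (ir \<kappa> * ir \<kappa>) * sp a (dun True ?e m)"
      using T[of False] by (simp only: mult.assoc) simp
    then show ?thesis using True x by (simp only: ir_kk) simp
  next
    case False
    then show ?thesis using T[of True] x by simp
  qed
next
  fix g assume x: "x = Grp g" and g: "g \<in> W"
  have "Ad g (sh False (inv_into UNIV g) m) = sh True g (sh False (g \<circ> inv_into UNIV g) m)"
    unfolding Ad_def by (simp only: sh_sh(1)[OF g W_inv[OF g]])
  also have "g \<circ> inv_into UNIV g = id" using W_inv_apply[OF g] by (simp add: fun_eq_iff)
  finally have "sh True g m = Ad g (sh False (inv_into UNIV g) m)" by (simp only: sh_id)
  then have "sp a (sh True g m) = sp a (sh False (inv_into UNIV g) m)"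
    using sp_Ad[OF a sh_Ms[OF W_inv[OF g] m] g] by simp
  then show ?thesis using x by simp
qed

section \<open>Values on words and the specialisation at \<open>s = 1\<close>\<close>

definition word_val :: "'n gen list \<Rightarrow> complex poly" where
  "word_val l = sp a (wact l unit1)"

lemma wact_rop: "set l \<subseteq> generators R \<Longrightarrow> x \<in> generators R \<Longrightarrow> wact (l @ [x]) unit1 = rop x (wact l unit1)"
proof -
  assume l: "set l \<subseteq> generators R" and x: "x \<in> generators R"
  have "wact l (rop x m) = rop x (wact l m)" if "m \<in> Ms" for m
    using l by (induction l) (simp_all add: wact_simps lop_rop x that wact_Ms)
  then show ?thesis using unit1_Ms lop_unit1[OF x] by (simp add: wact_simps)
qed

text \<open>Each generator that is carried round costs \<kappa>, whatever the parity of the rest of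
  the word. This agrees with the sign rule for traces only because odd words have value 0
  (\<open>word_val_odd\<close>).\<close>

lemma word_val_rotate:
  assumes "set l \<subseteq> generators R" "set l' \<subseteq> generators R"
  shows "word_val (l @ l') = ir \<kappa> ^ length (filter is_gen l) * word_val (l' @ l)"
  using assms
proof (induction l arbitrary: l')
  case (Cons x l)
  then have x: "x \<in> generators R" and l: "set (l @ l') \<subseteq> generators R" by auto
  have "word_val ((x # l) @ l') = (if is_gen x then ir \<kappa> else 1) * word_val ((l @ l') @ [x])"
    unfolding word_val_def wact_rop[OF l x]
    using sp_lop_rop[OF x wact_Ms[OF l unit1_Ms]] by (simp add: wact_simps)
  also have "word_val ((l @ l') @ [x]) = ir \<kappa> ^ length (filter is_gen l) * word_val ((l' @ [x]) @ l)"
    using Cons.IH[of "l' @ [x]"] Cons.prems x by simp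
  finally show ?case by simp
qed simp

lemma word_val_odd:
  assumes "set l \<subseteq> generators R" "odd (length (filter is_gen l))"
  shows "word_val l = 0"
  unfolding word_val_def using wact_Par[OF assms(1)] assms(2) by (intro sp_odd) simp

definition tval :: "'n observable \<Rightarrow> complex" where
  "tval f = poly (sp a (act_nc f unit1)) 1"

lemma tval_add: "f \<in> carrier F \<Longrightarrow> g \<in> carrier F \<Longrightarrow> tval (f + g) = tval f + tval g"
  by (simp add: tval_def act_nc_add sp_add act_nc_Ms unit1_Ms)

lemma tval_scalar: "f \<in> carrier F \<Longrightarrow> tval (scalar c * f) = c * tval f"
  by (simp add: tval_def act_nc_mult act_nc_scalar sp_scale act_nc_Ms unit1_Ms)

text \<open>A relation acts as a multiple of s - 1, and evaluation at s = 1 removes it.\<close>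

lemma tval_relation:
  assumes r: "r \<in> calogero_relations R \<nu>" and A: "A \<in> carrier F" and B: "B \<in> carrier F"
  shows "tval (A * r * B) = 0"
proof -
  obtain m where m: "m \<in> Ms" "act_nc r (act_nc B unit1) = scale ([:0, 1:] - 1) m"
    using relation_act[OF r act_nc_Ms[OF B unit1_Ms]] by blast
  have "sp a (act_nc (A * r * B) unit1) = ([:0, 1:] - 1) * sp a (act_nc A m)"
    by (simp only: act_nc_mult m(2) linear_opD(2)[OF linear_act_nc] sp_scale[OF act_nc_Ms[OF A m(1)]])
  then show ?thesis by (simp add: tval_def)
qed

text \<open>The kernel of a functional is not an ideal in general. Allowing factors on both sides
  gives an ideal inside the kernel, and it contains the relations.\<close>

lemma tval_Id:
  assumes f: "f \<in> Id"
  shows "tval f = 0"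
proof -
  let ?K = "{f \<in> carrier F. \<forall>A\<in>carrier F. \<forall>B\<in>carrier F. tval (A * f * B) = 0}"
  interpret F: ring F by (rule free_superalgebra_ring)
  have t0: "tval 0 = 0" by (simp add: tval_def act_nc_0 sp_0)
  have "subgroup ?K (add_monoid F)"
  proof (rule F.add.subgroupI)
    show "?K \<noteq> {}" using F_closed(4) t0 by auto
    fix f assume f: "f \<in> ?K"
    have "\<ominus>\<^bsub>F\<^esub> f = - f" using F.minus_equality[of "- f" f] f F_closed(3) by (simp add: F_ops)
    moreover have "tval (A * - f * B) = 0" if "A \<in> carrier F" "B \<in> carrier F" for A B
      using tval_add[of "A * f * B" "A * - f * B"] f that
      by (simp add: F_closed t0)
    ultimately show "\<ominus>\<^bsub>F\<^esub> f \<in> ?K" using f F_closed(3) by simp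
  qed (auto simp: F_ops F_closed distrib_left distrib_right tval_add)
  then have "ideal ?K F"
  proof (rule idealI[OF free_superalgebra_ring])
    fix f g assume f: "f \<in> ?K" and g: "g \<in> carrier F"
    show "g \<otimes>\<^bsub>F\<^esub> f \<in> ?K" unfolding F_ops mem_Collect_eq
    proof (intro conjI ballI)
      show "g * f \<in> carrier F" using f g F_closed(2) by blast
      fix A B assume "A \<in> carrier F" "B \<in> carrier F"
      then have "tval (A * g * f * B) = 0" using f F_closed(2)[OF _ g] by blast
      then show "tval (A * (g * f) * B) = 0" by (simp only: mult.assoc)
    qed
    show "f \<otimes>\<^bsub>F\<^esub> g \<in> ?K" unfolding F_ops mem_Collect_eq
    proof (intro conjI ballI)
      show "f * g \<in> carrier F" using f g F_closed(2) by blast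
      fix A B assume "A \<in> carrier F" "B \<in> carrier F"
      then have "tval (A * f * (g * B)) = 0" using f F_closed(2)[OF g] by blast
      then show "tval (A * (f * g) * B) = 0" by (simp only: mult.assoc)
    qed
  qed
  moreover have "calogero_relations R \<nu> \<subseteq> ?K"
    using tval_relation calogero_relations_carrier by blast
  ultimately have "Id \<subseteq> ?K" by (rule F.genideal_minimal)
  then have "tval (1 * f * 1) = 0" using f F_closed(5) by blast
  then show ?thesis by simp
qed

lemma tval_mult:
  assumes "f \<in> carrier F" "g \<in> carrier F"
  shows "tval (f * g) = (\<Sum>u\<in>Poly_Mapping.keys f. \<Sum>v\<in>Poly_Mapping.keys g.
    Poly_Mapping.lookup f u * Poly_Mapping.lookup g v * poly (word_val (letters u @ letters v)) 1)"
proof -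
  have s: "act_nc (f * g) unit1 = (\<Sum>u\<in>Poly_Mapping.keys f. \<Sum>v\<in>Poly_Mapping.keys g.
    scale [:Poly_Mapping.lookup f u * Poly_Mapping.lookup g v:] (wact (letters u @ letters v) unit1))"
    unfolding act_nc_mult
    by (simp add: act_nc_def linear_opD[OF linear_wact] scale_sum scale_simps wact_simps mult.commute)
  have "wact (letters u @ letters v) unit1 \<in> Ms" if "u \<in> Poly_Mapping.keys f" "v \<in> Poly_Mapping.keys g" for u v
    using assms that by (intro wact_Ms unit1_Ms) (auto simp: carrier_F)
  then show ?thesis
    unfolding tval_def s by (simp add: sp_sum Ms_sum Ms_simps sp_scale word_val_def poly_sum)
qed

lemma nc_trace_tval: "nc_trace \<kappa> tval"
  unfolding nc_trace_def
proof (intro conjI ballI allI)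
  fix n m :: nat and f g
  assume nm: "n \<in> {0, 1}" "m \<in> {0, 1}" and f: "f \<in> homog F n" and g: "g \<in> homog F m"
  have kpow: "complex_of_real \<kappa> ^ l = complex_of_real \<kappa> ^ (l mod 2)" for l
  proof (cases "even l")
    case True
    then show ?thesis using \<kappa> by auto
  next
    case False
    then have "l mod 2 = 1" by presburger
    then show ?thesis using \<kappa> False by auto
  qed
  have "poly (word_val (letters u @ letters v)) 1 = complex_of_real \<kappa> ^ (n * m) * poly (word_val (letters v @ letters u)) 1"
    if "u \<in> Poly_Mapping.keys f" "v \<in> Poly_Mapping.keys g" for u v
  proof -
    have u: "set (letters u) \<subseteq> generators R" "length (filter is_gen (letters u)) mod 2 = n"
      and v: "set (letters v) \<subseteq> generators R" "length (filter is_gen (letters v)) mod 2 = m"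
      using f g that by (auto simp: homog_iff)
    \<comment> \<open>Rotation gives \<kappa> to the power n, the sign rule \<kappa> to the power n
      m. For n = m in {0, 1} they agree; otherwise both words have odd parity and both values
      vanish.\<close>
    show ?thesis
    proof (cases "n = m")
      case True
      have nn: "n * m = n" using nm True by auto
      have "poly (ir \<kappa> ^ length (filter is_gen (letters u))) 1 = complex_of_real \<kappa> ^ length (filter is_gen (letters u))"
        by (simp add: poly_power ir_poly)
      also have "\<dots> = complex_of_real \<kappa> ^ n" using kpow u(2) by metis
      finally show ?thesis using word_val_rotate[OF u(1) v(1)] by (simp add: nn)
    next
      case False
      have "(length (filter is_gen (letters u)) + length (filter is_gen (letters v))) mod 2 = (n + m) mod 2"
        using u(2) v(2) mod_add_eq by metis
      then have "odd (length (filter is_gen (letters u)) + length (filter is_gen (letters v)))"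
        using False nm by (simp only: odd_iff_mod_2_eq_one) auto
      then show ?thesis using word_val_odd[of "letters u @ letters v"] word_val_odd[of "letters v @ letters u"] u(1) v(1)
        by (simp add: add.commute)
    qed
  qed
  then have "tval (f * g) = (\<Sum>u\<in>Poly_Mapping.keys f. \<Sum>v\<in>Poly_Mapping.keys g. complex_of_real \<kappa> ^ (n * m) *
    (Poly_Mapping.lookup g v * Poly_Mapping.lookup f u * poly (word_val (letters v @ letters u)) 1))"
    unfolding tval_mult[OF homog_carrier[OF f] homog_carrier[OF g]] by (intro sum.cong refl) simp
  also have "\<dots> = complex_of_real \<kappa> ^ (n * m) * tval (g * f)"
    unfolding tval_mult[OF homog_carrier[OF g] homog_carrier[OF f]]
    by (subst sum.swap) (simp add: sum_distrib_left)
  finally show "tval (f * g) = complex_of_real \<kappa> ^ (n * m) * tval (g * f)" .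
qed (auto simp: tval_Id tval_add tval_scalar)

lemma tval_grp:
  assumes w: "w \<in> W" "\<not> has_eigenvalue w \<kappa>"
  shows "tval (grp_elem w) = poly (a w) 1"
proof -
  have "act_nc (grp_elem w) unit1 = dl w 1"
    by (simp add: grp_elem_act unit1_def sh_dl w act_1 trn_def W_inv_inv)
  then show ?thesis using w sp_dl_one[OF w(1)] E_zero_iff[OF w(1)] by (simp add: tval_def)
qed

end

end

section \<open>The dimension of the space of traces\<close>

lemma subspace_kappa_traces: "cfun.subspace (kappa_traces k A)"
proof -
  let ?tr = "\<lambda>t. \<forall>p\<in>{0, 1}. \<forall>q\<in>{0, 1}. \<forall>f\<in>homog A p. \<forall>g\<in>homog A q.
    t (f \<otimes>\<^bsub>A\<^esub> g) = complex_of_real k ^ (p * q) * t (g \<otimes>\<^bsub>A\<^esub> f)"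
  let ?lin = "\<lambda>t. (\<forall>f. f \<notin> carrier A \<longrightarrow> t f = 0) \<and>
    (\<forall>f\<in>carrier A. \<forall>g\<in>carrier A. t (f \<oplus>\<^bsub>A\<^esub> g) = t f + t g) \<and>
    (\<forall>c. \<forall>f\<in>carrier A. t (c \<odot>\<^bsub>A\<^esub> f) = c * t f)"
  have iff: "t \<in> kappa_traces k A \<longleftrightarrow> ?lin t \<and> ?tr t" for t
    unfolding kappa_traces_def by blast
  have tr: "?tr t \<Longrightarrow> ?tr u \<Longrightarrow> ?tr (\<lambda>f. c * t f + d * u f)" for t u :: "'a \<Rightarrow> complex" and c d
  proof (intro ballI)
    fix p q :: nat and f g
    assume t: "?tr t" and u: "?tr u" and pq: "p \<in> {0, 1}" "q \<in> {0, 1}" and fg: "f \<in> homog A p" "g \<in> homog A q"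
    have "t (f \<otimes>\<^bsub>A\<^esub> g) = complex_of_real k ^ (p * q) * t (g \<otimes>\<^bsub>A\<^esub> f)"
      "u (f \<otimes>\<^bsub>A\<^esub> g) = complex_of_real k ^ (p * q) * u (g \<otimes>\<^bsub>A\<^esub> f)"
      using t u pq fg by blast+
    then show "c * t (f \<otimes>\<^bsub>A\<^esub> g) + d * u (f \<otimes>\<^bsub>A\<^esub> g) =
        complex_of_real k ^ (p * q) * (c * t (g \<otimes>\<^bsub>A\<^esub> f) + d * u (g \<otimes>\<^bsub>A\<^esub> f))"
      by (simp only: distrib_left mult.left_commute)
  qed
  have lin: "?lin t \<Longrightarrow> ?lin u \<Longrightarrow> ?lin (\<lambda>f. c * t f + d * u f)" for t u :: "'a \<Rightarrow> complex" and c d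
    by (auto simp: algebra_simps)
  have comb: "t \<in> kappa_traces k A \<Longrightarrow> u \<in> kappa_traces k A \<Longrightarrow> (\<lambda>f. c * t f + d * u f) \<in> kappa_traces k A" for t u c d
  proof -
    assume t: "t \<in> kappa_traces k A" and u: "u \<in> kappa_traces k A"
    have t': "?lin t" "?tr t" by (rule conjunct1[OF iffD1[OF iff t]], rule conjunct2[OF iffD1[OF iff t]])
    have u': "?lin u" "?tr u" by (rule conjunct1[OF iffD1[OF iff u]], rule conjunct2[OF iffD1[OF iff u]])
    show "(\<lambda>f. c * t f + d * u f) \<in> kappa_traces k A"
      unfolding iff by (rule conjI[OF lin[OF t'(1) u'(1)] tr[OF t'(2) u'(2)]])
  qed
  have 0: "(\<lambda>_. 0) \<in> kappa_traces k A" unfolding iff by simp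
  show ?thesis
    by (rule cfun.subspaceI)
      (use 0 comb[of _ _ 1 1] comb[OF _ 0, of _ _ 0] in \<open>auto simp: zero_fun_def plus_fun_def fun_scale_def\<close>)
qed

section \<open>Conjugacy classes of the reflection group\<close>

context reflection_group
begin

definition cls :: "(real^'n \<Rightarrow> real^'n) \<Rightarrow> (real^'n \<Rightarrow> real^'n) set" where
  "cls w = {y \<in> W. conjugate_in (coxeter_group R) w y}"

lemma conjugacy_classes_eq: "conjugacy_classes (coxeter_group R) = cls ` W"
  by (simp add: conjugacy_classes_def cls_def[abs_def])

lemma cls_eq: "cls w = {g \<circ> w \<circ> inv_into UNIV g |g. g \<in> W}" if "w \<in> W"
  unfolding cls_def conjugate_in_def using that
  by (auto simp: W_inv_eq W_comp W_inv)

lemma cls_self: "w \<in> W \<Longrightarrow> w \<in> cls w"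
proof -
  assume w: "w \<in> W"
  have "w = id \<circ> w \<circ> inv_into UNIV id" by simp
  then show "w \<in> cls w" unfolding cls_eq[OF w] using W_id by blast
qed

lemma cls_conj:
  assumes w: "w \<in> W" and v: "v \<in> W" and g: "g \<in> W"
  shows "g \<circ> v \<circ> inv_into UNIV g \<in> cls w \<longleftrightarrow> v \<in> cls w"
proof
  assume "v \<in> cls w"
  then obtain h where "h \<in> W" "v = h \<circ> w \<circ> inv_into UNIV h" unfolding cls_eq[OF w] by blast
  then have "g \<circ> v \<circ> inv_into UNIV g = (g \<circ> h) \<circ> w \<circ> inv_into UNIV (g \<circ> h)" "g \<circ> h \<in> W"
    using W_inv_comp[OF g] W_comp[OF g] by (simp_all add: o_assoc)
  then show "g \<circ> v \<circ> inv_into UNIV g \<in> cls w" unfolding cls_eq[OF w] by blast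
next
  assume "g \<circ> v \<circ> inv_into UNIV g \<in> cls w"
  then obtain h where h: "h \<in> W" "g \<circ> v \<circ> inv_into UNIV g = h \<circ> w \<circ> inv_into UNIV h"
    unfolding cls_eq[OF w] by blast
  let ?h = "inv_into UNIV g \<circ> h"
  have "inv_into UNIV ?h = inv_into UNIV h \<circ> g"
    using W_inv_comp[OF W_inv[OF g] h(1)] W_inv_inv[OF g] by simp
  moreover have "v = inv_into UNIV g \<circ> (g \<circ> v \<circ> inv_into UNIV g) \<circ> g"
    using W_inv_apply[OF g] by (simp add: fun_eq_iff)
  ultimately have "v = ?h \<circ> w \<circ> inv_into UNIV ?h" unfolding h(2) by (simp add: o_assoc)
  then show "v \<in> cls w" unfolding cls_eq[OF w] using W_comp[OF W_inv[OF g] h(1)] by blast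
qed

lemma cls_sub: "w \<in> W \<Longrightarrow> cls w \<subseteq> W"
  by (auto simp: cls_def)

lemma cls_eqI:
  assumes w: "w \<in> W" and v: "v \<in> cls w"
  shows "cls v = cls w"
proof -
  have vW: "v \<in> W" using v cls_sub[OF w] by blast
  obtain h where h: "h \<in> W" "v = h \<circ> w \<circ> inv_into UNIV h" using v unfolding cls_eq[OF w] by blast
  have "w \<in> cls v" using cls_conj[OF vW w h(1)] cls_self[OF vW] h(2) by simp
  have "cls v \<subseteq> cls w" using cls_conj[OF w vW] v unfolding cls_eq[OF vW] by blast
  moreover have "cls w \<subseteq> cls v" using cls_conj[OF vW w] \<open>w \<in> cls v\<close> unfolding cls_eq[OF w] by blast
  ultimately show ?thesis by blast
qed

end

lemma kappa_traces_outside: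
  assumes "t \<in> kappa_traces k A" and "f \<notin> carrier A"
  shows "t f = 0"
  using assms unfolding kappa_traces_def by blast

theorem theorem2:
  fixes \<kappa> :: real
    and R :: "(real^'n) set"
    and \<nu> :: "real^'n \<Rightarrow> complex"
  assumes "\<kappa> \<in> {1, - 1}"
    and "root_system R"
    and "root_constants R \<nu>"
  shows "(\<exists>B. finite B \<and> cfun.span B = kappa_traces \<kappa> (calogero_superalgebra R \<nu>)) \<and>
    cfun.dim (kappa_traces \<kappa> (calogero_superalgebra R \<nu>)) =
      card {C \<in> conjugacy_classes (coxeter_group R). \<forall>g\<in>C. \<not> has_eigenvalue g \<kappa>}"
proof -
  \<comment> \<open>Two coefficient rings for the same superalgebra: \<open>X\<close> supplies the
    uniqueness of traces, \<open>Y\<close> their existence.\<close>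
  interpret X: calogero_complex R \<nu>
    by unfold_locales (use assms in \<open>simp_all add: ring_map_ident\<close>)
  interpret Y: calogero_deformed R \<nu> \<kappa>
    by unfold_locales (use assms in \<open>simp_all add: ring_map_pCons\<close>)
  let ?H = "calogero_superalgebra R \<nu>" and ?V = "kappa_traces \<kappa> (calogero_superalgebra R \<nu>)"
  let ?EC = "{C \<in> conjugacy_classes (coxeter_group R). \<forall>g\<in>C. \<not> has_eigenvalue g \<kappa>}"
  have EC: "\<exists>w\<in>X.W. C = X.cls w \<and> \<not> has_eigenvalue w \<kappa>" if "C \<in> ?EC" for C
    using that X.cls_self unfolding X.conjugacy_classes_eq by blast
  have fin: "finite ?EC" unfolding X.conjugacy_classes_eq using X.finite_W by simp
  define r where "r C = (SOME w. w \<in> X.W \<and> C = X.cls w)" for C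
  have r: "r C \<in> X.W" "C = X.cls (r C)" if "C \<in> ?EC" for C
    using someI_ex[of "\<lambda>w. w \<in> X.W \<and> C = X.cls w"] EC[OF that] unfolding r_def by blast+
  have r_ell: "\<not> has_eigenvalue (r C) \<kappa>" if "C \<in> ?EC" for C
    using that r[OF that] X.cls_self by blast
  \<comment> \<open>The indicator function of a class, as a constant polynomial in s. The traces
    built from these are dual to the class representatives, which gives independence.\<close>
  define a where "a C w = (if w \<in> C then 1 else 0 :: complex poly)" for C and w :: "real^'n \<Rightarrow> real^'n"
  have a: "Y.class_function (a C)" if "C \<in> ?EC" for C
    using X.cls_conj[OF r(1)[OF that(1)]] r(2)[OF that(1)] by (auto simp: Y.class_function_def a_def)
  define \<tau> where "\<tau> C = X.trace_of (Y.tval (a C))" for C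
  have nct: "X.nc_trace \<kappa> (Y.tval (a C))" if "C \<in> ?EC" for C
    by (rule Y.nc_trace_tval[OF a[OF that]])
  have \<tau>V: "\<tau> C \<in> ?V" if "C \<in> ?EC" for C
    unfolding \<tau>_def by (rule X.trace_of_trace[OF nct[OF that]])
  have \<tau>_val: "\<tau> C (X.cl (grp_elem w)) = (if w \<in> C then 1 else 0)"
    if "C \<in> ?EC" "w \<in> X.W" "\<not> has_eigenvalue w \<kappa>" for C w
    using X.trace_of_cl[OF nct[OF that(1)] X.F_elem(2)[OF that(2)]] Y.tval_grp[OF a[OF that(1)] that(2,3)]
    by (simp add: \<tau>_def a_def)
  have mem: "r D \<in> C \<longleftrightarrow> C = D" if "C \<in> ?EC" "D \<in> ?EC" for C D
    using X.cls_eqI[OF r(1)[OF that(1)], of "r D"] r[OF that(1)] r[OF that(2)] X.cls_self by metis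
  have \<tau>_r: "\<tau> C (X.cl (grp_elem (r D))) = (if C = D then 1 else 0)" if "C \<in> ?EC" "D \<in> ?EC" for C D
    using \<tau>_val[OF that(1) r(1)[OF that(2)] r_ell[OF that(2)]] mem[OF that] by simp
  have inj: "inj_on \<tau> ?EC"
  proof (rule inj_onI)
    fix C D assume C: "C \<in> ?EC" and D: "D \<in> ?EC" and eq: "\<tau> C = \<tau> D"
    show "C = D"
    proof (rule ccontr)
      assume "C \<noteq> D"
      then show False using \<tau>_r[OF C D] \<tau>_r[OF D D] eq by simp
    qed
  qed
  let ?B = "\<tau> ` ?EC"
  have sum_apply: "(\<Sum>C\<in>?EC. fun_scale (c C) (\<tau> C)) x = (\<Sum>C\<in>?EC. c C * \<tau> C x)" for c x
    by (simp add: sum_fun_apply fun_scale_def)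
  have indep: "\<not> cfun.dependent ?B"
  proof (rule cfun.independent_if_scalars_zero)
    show "finite ?B" using fin by simp
    fix f x assume 0: "(\<Sum>y\<in>?B. fun_scale (f y) y) = 0" and x: "x \<in> ?B"
    obtain D where D: "D \<in> ?EC" "x = \<tau> D" using x by blast
    have "(\<Sum>C\<in>?EC. fun_scale (f (\<tau> C)) (\<tau> C)) = 0" using 0 unfolding sum.reindex[OF inj] comp_apply .
    then have "(\<Sum>C\<in>?EC. f (\<tau> C) * \<tau> C (X.cl (grp_elem (r D)))) = 0"
      using sum_apply[of "\<lambda>C. f (\<tau> C)" "X.cl (grp_elem (r D))"] by (simp only: zero_fun_apply)
    moreover have "(\<Sum>C\<in>?EC. f (\<tau> C) * \<tau> C (X.cl (grp_elem (r D)))) = (\<Sum>C\<in>?EC. if C = D then f (\<tau> D) else 0)"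
      by (rule sum.cong) (use \<tau>_r D(1) in auto)
    ultimately show "f x = 0" using D fin by simp
  qed
  have span: "cfun.span ?B = ?V"
  proof
    show "cfun.span ?B \<subseteq> ?V" by (rule cfun.span_minimal[OF _ subspace_kappa_traces]) (use \<tau>V in blast)
    show "?V \<subseteq> cfun.span ?B"
    proof
      fix t assume t: "t \<in> ?V"
      \<comment> \<open>The coefficients are forced by duality: they are the values of
        \<open>t\<close> at the representatives. It remains to see that \<open>t - ?S\<close>
        vanishes at all elements without eigenvalue \<kappa>.\<close>
      let ?S = "\<Sum>C\<in>?EC. fun_scale (t (X.cl (grp_elem (r C)))) (\<tau> C)"
      have S: "?S \<in> cfun.span ?B" by (intro cfun.span_sum cfun.span_scale cfun.span_base) blast
      have SV: "?S \<in> ?V"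
        using \<tau>V by (intro cfun.subspace_sum[OF subspace_kappa_traces] cfun.subspace_scale[OF subspace_kappa_traces]) blast
      have d: "t - ?S \<in> ?V" by (rule cfun.subspace_diff[OF subspace_kappa_traces t SV])
      let ?t = "\<lambda>f. (t - ?S) (X.cl f)"
      have tr: "X.nc_trace \<kappa> ?t" by (rule X.nc_trace_of_trace[OF d])
      have tt: "X.nc_trace \<kappa> (\<lambda>f. t (X.cl f))" by (rule X.nc_trace_of_trace[OF t])
      \<comment> \<open>A trace of either kind is constant on conjugacy classes, because group
        elements are even and commute under it without a sign.\<close>
      have conj: "t (X.cl (grp_elem (g \<circ> w \<circ> inv_into UNIV g))) = t (X.cl (grp_elem w))" if "g \<in> X.W" "w \<in> X.W" for g w
      proof -
        have c: "t (X.cl f) = t (X.cl f')" if "X.cg f f'" for f f'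
          using that X.cl_eq by (metis X.cg_def)
        note gi = X.W_inv[OF that(1)]
        note wg = X.W_comp[OF that(2) gi]
        have "t (X.cl (grp_elem (g \<circ> (w \<circ> inv_into UNIV g)))) = t (X.cl (grp_elem g * grp_elem (w \<circ> inv_into UNIV g)))"
          by (rule c[OF X.cg_grp_grp[OF that(1) wg], symmetric])
        also have "\<dots> = t (X.cl (grp_elem (w \<circ> inv_into UNIV g) * grp_elem g))"
          using X.nc_traceD(4)[OF tt _ _ X.homog_letter(2)[OF that(1)] X.homog_letter(2)[OF wg]] by simp
        also have "\<dots> = t (X.cl (grp_elem ((w \<circ> inv_into UNIV g) \<circ> g)))"
          by (rule c[OF X.cg_grp_grp[OF wg that(1)]])
        also have "(w \<circ> inv_into UNIV g) \<circ> g = w" using X.W_inv_apply[OF that(1)] by (simp add: fun_eq_iff)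
        finally show ?thesis by (simp only: comp_assoc)
      qed
      have "?t (grp_elem w) = 0" if w: "w \<in> X.W" "\<not> has_eigenvalue w \<kappa>" for w
      proof -
        have "\<not> has_eigenvalue v \<kappa>" if v: "v \<in> X.cls w" for v
        proof -
          obtain g where g: "g \<in> X.W" "v = g \<circ> w \<circ> inv_into UNIV g" using v unfolding X.cls_eq[OF w(1)] by blast
          then show ?thesis using Y.E_conj[OF w(1) g(1)] Y.E_zero_iff[OF w(1)] w(2)
            Y.E_zero_iff[OF subsetD[OF X.cls_sub[OF w(1)] v]] by simp
        qed
        then have C: "X.cls w \<in> ?EC" unfolding X.conjugacy_classes_eq using w(1) by blast
        have "r (X.cls w) \<in> X.cls w" using mem[OF C C] by simp
        then have "t (X.cl (grp_elem (r (X.cls w)))) = t (X.cl (grp_elem w))"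
          using conj w(1) unfolding X.cls_eq[OF w(1)] by auto
        moreover have "(\<Sum>C\<in>?EC. t (X.cl (grp_elem (r C))) * \<tau> C (X.cl (grp_elem w))) =
            (\<Sum>C\<in>?EC. if C = X.cls w then t (X.cl (grp_elem (r (X.cls w)))) else 0)"
        proof (rule sum.cong[OF refl])
          fix C assume C': "C \<in> ?EC"
          have "w \<in> C \<longleftrightarrow> C = X.cls w"
            using X.cls_eqI[OF r(1)[OF C'], of w] r(2)[OF C'] X.cls_self[OF w(1)] by metis
          then show "t (X.cl (grp_elem (r C))) * \<tau> C (X.cl (grp_elem w)) = (if C = X.cls w then t (X.cl (grp_elem (r (X.cls w)))) else 0)"
            using \<tau>_val[OF C' w] by simp
        qed
        ultimately show ?thesis using C fin sum_apply[of "\<lambda>C. t (X.cl (grp_elem (r C)))"]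
          by (simp add: fun_diff_def)
      qed
      then have z: "?t f = 0" if "f \<in> carrier X.F" for f
        by (rule X.nc_trace_unique[OF assms(1) tr _ that])
      have zero: "(t - ?S) x = 0" for x
      proof (cases "x \<in> carrier ?H")
        case True
        then show ?thesis using z unfolding X.H_carrier by blast
      next
        case False
        then show ?thesis by (rule kappa_traces_outside[OF d])
      qed
      have "t - ?S = 0"
      proof (rule ext)
        fix x
        show "(t - ?S) x = 0 x" unfolding zero_fun_apply by (rule zero)
      qed
      then have "?S = t" by (rule right_minus_eq[THEN iffD1, symmetric])
      show "t \<in> cfun.span ?B" using S unfolding \<open>?S = t\<close> .
    qed
  qed
  have "cfun.dim ?V = card ?B"
    unfolding span[symmetric] by (rule cfun.dim_span_eq_card_independent[OF indep])
  then have "cfun.dim ?V = card ?EC" using card_image[OF inj] by simp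
  then show ?thesis using fin span by blast
qed

end
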